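(* Let $M_t$ be a family of smooth closed strictly convex surfaces in $\mathbb{R}^3$ moving according to $\frac{d}{dt}X=\frac{|A|^2}{K^2}\nu$. Then $$\max_{M_t}\frac{(\lambda_1-\lambda_2)^2}{2(\lambda_1+\lambda_2)\lambda_1\lambda_2}$$ is non-increasing in time.
   Context: $X$ denotes the embedding, $\nu$ the outer unit normal, $\lambda_1,\lambda_2>0$ the principal curvatures, $|A|^2=\lambda_1^2+\lambda_2^2$, $K=\lambda_1\lambda_2$. *)

theory Defs
  imports "HOL-Analysis.Analysis"
begin

definition dderiv :: "'a::real_normed_vector \<Rightarrow> ('a \<Rightarrow> 'b::real_normed_vector) \<Rightarrow> 'a \<Rightarrow> 'b" where
  "dderiv v g x = vector_derivative (\<lambda>s::real. g (x + s *\<^sub>R v)) (at 0)"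

fun iter_dderiv :: "'a::real_normed_vector list \<Rightarrow> ('a \<Rightarrow> 'b::real_normed_vector) \<Rightarrow> 'a \<Rightarrow> 'b" where
  "iter_dderiv [] f = f"
| "iter_dderiv (v # vs) f = dderiv v (iter_dderiv vs f)"

definition smooth_on :: "'a::real_normed_vector set \<Rightarrow> ('a \<Rightarrow> 'b::real_normed_vector) \<Rightarrow> bool" where
  "smooth_on U f \<longleftrightarrow> open U \<and>
     (\<forall>vs. continuous_on U (iter_dderiv vs f) \<and>
        (\<forall>v. \<forall>x\<in>U. (\<lambda>s::real. iter_dderiv vs f (x + s *\<^sub>R v)) differentiable (at 0)))"

abbreviation S2 :: "(real^3) set" where "S2 \<equiv> sphere 0 1"

definition unit_tangent :: "real^3 \<Rightarrow> real^3 \<Rightarrow> bool" where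
  "unit_tangent p v \<longleftrightarrow> v \<bullet> p = 0 \<and> norm v = 1"

definition gc :: "real^3 \<Rightarrow> real^3 \<Rightarrow> real \<Rightarrow> real^3" where
  "gc p v s = cos s *\<^sub>R p + sin s *\<^sub>R v"

definition dX :: "(real^3 \<Rightarrow> real^3) \<Rightarrow> real^3 \<Rightarrow> real^3 \<Rightarrow> real^3" where
  "dX Y p v = vector_derivative (\<lambda>s. Y (gc p v s)) (at 0)"

definition ddX :: "(real^3 \<Rightarrow> real^3) \<Rightarrow> real^3 \<Rightarrow> real^3 \<Rightarrow> real^3" where
  "ddX Y p v = vector_derivative (\<lambda>s. vector_derivative (\<lambda>r. Y (gc p v r)) (at s)) (at 0)"

definition outer_normal :: "(real^3 \<Rightarrow> real^3) \<Rightarrow> real^3 \<Rightarrow> real^3" where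
  "outer_normal Y p = (THE n. norm n = 1 \<and> (\<forall>v. unit_tangent p v \<longrightarrow> n \<bullet> dX Y p v = 0)
       \<and> (\<forall>q\<in>S2. (Y q - Y p) \<bullet> n \<le> 0))"

text \<open>normal curvature in the direction dX(v): II(v,v)/g(v,v), with the sign
  convention that the round sphere has positive curvature w.r.t. the outer normal\<close>
definition normal_curv :: "(real^3 \<Rightarrow> real^3) \<Rightarrow> real^3 \<Rightarrow> real^3 \<Rightarrow> real" where
  "normal_curv Y p v = - (ddX Y p v \<bullet> outer_normal Y p) / (norm (dX Y p v))\<^sup>2"

text \<open>principal curvatures = extremal normal curvatures\<close>
definition lambda1 :: "(real^3 \<Rightarrow> real^3) \<Rightarrow> real^3 \<Rightarrow> real" where
  "lambda1 Y p = Sup {normal_curv Y p v | v. unit_tangent p v}"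

definition lambda2 :: "(real^3 \<Rightarrow> real^3) \<Rightarrow> real^3 \<Rightarrow> real" where
  "lambda2 Y p = Inf {normal_curv Y p v | v. unit_tangent p v}"

definition normA2 :: "(real^3 \<Rightarrow> real^3) \<Rightarrow> real^3 \<Rightarrow> real" where
  "normA2 Y p = (lambda1 Y p)\<^sup>2 + (lambda2 Y p)\<^sup>2"

definition gaussK :: "(real^3 \<Rightarrow> real^3) \<Rightarrow> real^3 \<Rightarrow> real" where
  "gaussK Y p = lambda1 Y p * lambda2 Y p"

definition pinching_quot :: "(real^3 \<Rightarrow> real^3) \<Rightarrow> real^3 \<Rightarrow> real" where
  "pinching_quot Y p = (lambda1 Y p - lambda2 Y p)\<^sup>2 /
      (2 * (lambda1 Y p + lambda2 Y p) * lambda1 Y p * lambda2 Y p)"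

definition strictly_convex_embedded :: "(real^3 \<Rightarrow> real^3) \<Rightarrow> bool" where
  "strictly_convex_embedded Y \<longleftrightarrow> inj_on Y S2
     \<and> (\<forall>p\<in>S2. \<forall>v. unit_tangent p v \<longrightarrow> dX Y p v \<noteq> 0)
     \<and> (\<forall>p\<in>S2. \<exists>!n. norm n = 1 \<and> (\<forall>v. unit_tangent p v \<longrightarrow> n \<bullet> dX Y p v = 0)
                 \<and> (\<forall>q\<in>S2. (Y q - Y p) \<bullet> n \<le> 0))
     \<and> (\<forall>p\<in>S2. lambda1 Y p > 0 \<and> lambda2 Y p > 0)"

end

theory Submission
  imports Defs
begin

text \<open>
  In terms of the principal radii \<open>r\<^sub>i = 1/\<lambda>\<^sub>i\<close> the speed is \<open>r\<^sub>1\<^sup>2 + r\<^sub>2\<^sup>2\<close> and the quotient is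
  \<open>w = (r\<^sub>1 - r\<^sub>2)\<^sup>2 / (2 (r\<^sub>1 + r\<^sub>2))\<close>, both functions of the Hessian of the support function \<open>u\<close>. Writing
  the normal as \<open>(y\<^sub>1, y\<^sub>2, 1)\<close> up to scaling, the function \<open>v(t, y) = u(t, (y, 1))\<close> solves a scalar
  parabolic equation \<open>v\<^sub>t = G(y, D\<^sup>2v)\<close>. At a spatial maximum of \<open>w\<close> with \<open>w > 0\<close> take principal
  coordinates centred at the normal, with radii \<open>a \<noteq> b\<close>. There
  \<open>w\<^sub>t = 2a w\<^sub>1\<^sub>1 + 2b w\<^sub>2\<^sub>2 + Q - (a-b)\<^sup>2 (4a\<^sup>2+2ab+4b\<^sup>2)/(a+b)\<^sup>2\<close>, where \<open>Q\<close> is quadratic in the third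
  derivatives of \<open>v\<close>. The equations \<open>w\<^sub>1 = w\<^sub>2 = 0\<close> leave two free third derivatives, and on these \<open>Q\<close>
  is nonpositive. Hence \<open>w\<^sub>t < 0\<close>, and since this is strict, a maximum of \<open>w\<close> over \<open>[s, t] \<times> S\<^sup>2\<close>
  exceeding the maximum at time \<open>s\<close> is impossible.
\<close>

section \<open>Smooth functions\<close>

text \<open>The surfaces are parametrised by a fixed sphere, not by the normal, and
  \<open>lambda1\<close>, \<open>lambda2\<close> are a supremum and an infimum, which need not be
  differentiable at umbilics. The quotient is therefore rewritten through the sum and product of the
  principal radii, which are smooth. Evaluating the support function at the unnormalised normal
  makes the position its gradient and the equation scalar. The price is an explicit dependence on
  the slopes through the length of (y1, y2, 1); its second derivatives at the base point produce the
  zero-order term of the evolution of w, and the sign of that term makes the inequality strict. The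
  term vanishes only at umbilics, and these are harmless because a maximum exceeding the initial one
  has w > 0. The time derivatives of w at a fixed parameter and at a fixed normal differ by a drift
  paired with the spatial gradient of w, which is zero at the maximum.\<close>

definition pd :: "'a::real_normed_vector \<Rightarrow> ('a \<Rightarrow> 'b::real_normed_vector) \<Rightarrow> 'a \<Rightarrow> 'b" where
  "pd v f x = frechet_derivative f (at x) v"

text \<open>Level 0 asks for nothing, so level n is n-fold Frechet differentiability without
  continuity of the last derivatives. In the intersection \<open>Cinf\<close> every derivative is
  differentiable again and hence continuous.\<close>

fun Ck :: "nat \<Rightarrow> 'a::real_normed_vector set \<Rightarrow> ('a \<Rightarrow> 'b::real_normed_vector) \<Rightarrow> bool" where
  "Ck 0 U f = True"
| "Ck (Suc n) U f = ((\<forall>x\<in>U. f differentiable (at x)) \<and> (\<forall>v. Ck n U (pd v f)))"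

definition Cinf :: "'a::real_normed_vector set \<Rightarrow> ('a \<Rightarrow> 'b::real_normed_vector) \<Rightarrow> bool" where
  "Cinf U f \<longleftrightarrow> (\<forall>n. Ck n U f)"

lemma pd_eqI: "(f has_derivative f') (at x) \<Longrightarrow> pd v f x = f' v"
  unfolding pd_def by (metis frechet_derivative_at)

lemma has_derivative_pd: "f differentiable (at x) \<Longrightarrow> (f has_derivative (\<lambda>v. pd v f x)) (at x)"
  unfolding pd_def by (simp add: frechet_derivative_works)

lemma differentiable_cong_open:
  assumes "open U" "\<And>x. x \<in> U \<Longrightarrow> f x = g x" "x \<in> U"
  shows "f differentiable (at x) \<longleftrightarrow> g differentiable (at x)"
  unfolding differentiable_def
  using assms has_derivative_transform_within_open[of f _ x UNIV U g] has_derivative_transform_within_open[of g _ x UNIV U f]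
  by metis

lemma pd_cong_open:
  assumes "open U" "\<And>x. x \<in> U \<Longrightarrow> f x = g x" "x \<in> U"
  shows "pd v f x = pd v g x"
proof -
  have "(f has_derivative f') (at x) \<longleftrightarrow> (g has_derivative f') (at x)" for f'
    using assms has_derivative_transform_within_open[of f f' x UNIV U g] has_derivative_transform_within_open[of g f' x UNIV U f]
    by auto
  then show ?thesis unfolding pd_def frechet_derivative_def by simp
qed

lemma Ck_cong:
  assumes "open U" "\<And>x. x \<in> U \<Longrightarrow> f x = g x"
  shows "Ck n U f \<longleftrightarrow> Ck n U g"
  using assms(2)
proof (induction n arbitrary: f g)
  case (Suc n)
  have "Ck n U (pd v f) \<longleftrightarrow> Ck n U (pd v g)" for v
    using pd_cong_open[OF assms(1) Suc.prems] by (intro Suc.IH) auto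
  then show ?case
    using differentiable_cong_open[OF assms(1) Suc.prems] by auto
qed auto

lemma Ck_Suc_D: "Ck (Suc n) U f \<Longrightarrow> Ck n U f"
  by (induction n arbitrary: f) auto

lemma Ck_subset: "Ck n U f \<Longrightarrow> V \<subseteq> U \<Longrightarrow> Ck n V f"
  by (induction n arbitrary: f) auto

lemma Ck_const: "open U \<Longrightarrow> Ck n U (\<lambda>x. c)"
proof (induction n arbitrary: c)
  case (Suc n)
  have "pd v (\<lambda>x. c) = (\<lambda>x. 0)" for v :: 'a by (rule ext, rule pd_eqI) auto
  with Suc show ?case by auto
qed auto

lemma Ck_SucI:
  assumes "open U" "\<And>x. x \<in> U \<Longrightarrow> (f has_derivative f' x) (at x)"
    "\<And>v. Ck n U (\<lambda>x. f' x v)"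
  shows "Ck (Suc n) U f"
proof -
  have "Ck n U (pd v f)" for v
    using Ck_cong[OF assms(1), of "pd v f" "\<lambda>x. f' x v"] pd_eqI[OF assms(2)] assms(3) by simp
  then show ?thesis
    using assms(2) differentiableI by simp blast
qed

lemma Ck_Suc_has_derivative:
  "Ck (Suc n) U f \<Longrightarrow> x \<in> U \<Longrightarrow> (f has_derivative (\<lambda>v. pd v f x)) (at x)"
  by (simp add: has_derivative_pd)

lemma Ck_add:
  assumes "open U" "Ck n U f" "Ck n U g"
  shows "Ck n U (\<lambda>x. f x + g x)"
  using assms(2-)
proof (induction n arbitrary: f g)
  case (Suc n)
  show ?case
  proof (rule Ck_SucI[OF assms(1)])
    show "((\<lambda>x. f x + g x) has_derivative (\<lambda>v. pd v f x + pd v g x)) (at x)" if "x \<in> U" for x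
      using that Suc.prems by (intro has_derivative_add Ck_Suc_has_derivative)
    show "Ck n U (\<lambda>x. pd v f x + pd v g x)" for v
      by (rule Suc.IH) (use Suc.prems in simp_all)
  qed
qed auto

lemma Ck_linear:
  assumes "open U" "Ck n U f" "bounded_linear L"
  shows "Ck n U (\<lambda>x. L (f x))"
  using assms(2)
proof (induction n arbitrary: f)
  case (Suc n)
  show ?case
  proof (rule Ck_SucI[OF assms(1)])
    show "((\<lambda>x. L (f x)) has_derivative (\<lambda>v. L (pd v f x))) (at x)" if "x \<in> U" for x
      using that Suc.prems by (intro bounded_linear.has_derivative[OF assms(3)] Ck_Suc_has_derivative)
    show "Ck n U (\<lambda>x. L (pd v f x))" for v
      by (rule Suc.IH) (use Suc.prems in simp_all)
  qed
qed auto

lemma Ck_bilinear: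
  assumes "open U" "Ck n U f" "Ck n U g" "bounded_bilinear B"
  shows "Ck n U (\<lambda>x. B (f x) (g x))"
  using assms(2,3)
proof (induction n arbitrary: f g)
  case (Suc n)
  show ?case
  proof (rule Ck_SucI[OF assms(1)])
    show "((\<lambda>x. B (f x) (g x)) has_derivative (\<lambda>v. B (f x) (pd v g x) + B (pd v f x) (g x))) (at x)"
      if "x \<in> U" for x
      by (rule bounded_bilinear.FDERIV[OF assms(4) Suc.prems[THEN Ck_Suc_has_derivative, OF that]])
    show "Ck n U (\<lambda>x. B (f x) (pd v g x) + B (pd v f x) (g x))" for v
      using Suc.prems by (intro Ck_add[OF assms(1) Suc.IH Suc.IH] Suc.prems[THEN Ck_Suc_D]) simp_all
  qed
qed auto

text \<open>The derivative of 1/f is a polynomial in 1/f and a derivative of f, so order n of 1/f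
  itself yields order n + 1. \<open>Ck_sqrt\<close> runs on the same self-reference.\<close>

lemma Ck_inverse:
  fixes f :: "'a::real_normed_vector \<Rightarrow> real"
  assumes "open U" "Ck n U f" "\<And>x. x \<in> U \<Longrightarrow> f x \<noteq> 0"
  shows "Ck n U (\<lambda>x. inverse (f x))"
  using assms(2)
proof (induction n)
  case (Suc n)
  show ?case
  proof (rule Ck_SucI[OF assms(1)])
    show "((\<lambda>x. inverse (f x)) has_derivative
        (\<lambda>v. (- 1) * (pd v f x * (inverse (f x) * inverse (f x))))) (at x)" if "x \<in> U" for x
      using Deriv.has_derivative_inverse[OF assms(3)[OF that] Ck_Suc_has_derivative[OF Suc.prems that]]
      by (simp add: mult_ac)
    show "Ck n U (\<lambda>x. (- 1) * (pd v f x * (inverse (f x) * inverse (f x))))" for v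
      using Suc.prems Ck_Suc_D[OF Suc.prems]
      by (intro Ck_bilinear[OF assms(1) _ _ bounded_bilinear_mult] Suc.IH Ck_const[OF assms(1)]) simp_all
  qed
qed auto

lemma Ck_sqrt:
  fixes f :: "'a::real_normed_vector \<Rightarrow> real"
  assumes "open U" "Ck n U f" "\<And>x. x \<in> U \<Longrightarrow> f x > 0"
  shows "Ck n U (\<lambda>x. sqrt (f x))"
  using assms(2)
proof (induction n)
  case (Suc n)
  have nz: "sqrt (f x) \<noteq> 0" if "x \<in> U" for x
    using assms(3)[OF that] by simp
  show ?case
  proof (rule Ck_SucI[OF assms(1)])
    show "((\<lambda>x. sqrt (f x)) has_derivative (\<lambda>v. pd v f x * (1/2 * inverse (sqrt (f x))))) (at x)"
      if "x \<in> U" for x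
      by (rule has_derivative_eq_rhs[OF has_derivative_real_sqrt[OF assms(3)[OF that]
              Ck_Suc_has_derivative[OF Suc.prems that]]])
        simp
    show "Ck n U (\<lambda>x. pd v f x * (1/2 * inverse (sqrt (f x))))" for v
    proof (rule Ck_bilinear[OF assms(1) _ _ bounded_bilinear_mult])
      show "Ck n U (pd v f)" using Suc.prems by simp
      have *: "Ck n U (\<lambda>x. inverse (sqrt (f x)))"
        by (rule Ck_inverse[OF assms(1) Suc.IH[OF Ck_Suc_D[OF Suc.prems]] nz])
      show "Ck n U (\<lambda>x. 1/2 * inverse (sqrt (f x)))"
        by (rule Ck_bilinear[OF assms(1) Ck_const[OF assms(1)] * bounded_bilinear_mult])
    qed
  qed
qed auto

lemma Ck_sum:
  assumes "open U" "\<And>i. i \<in> I \<Longrightarrow> Ck n U (f i)"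
  shows "Ck n U (\<lambda>x. \<Sum>i\<in>I. f i x)"
  using assms(2)
  by (induction I rule: infinite_finite_induct) (simp_all add: Ck_const Ck_add assms(1))

text \<open>The direction \<open>pd v f x\<close> varies with x, whereas \<open>Ck\<close> speaks of
  constant directions. Expanding it in the basis leaves sums of products, to which the closure rules
  apply.\<close>

lemma pd_compose:
  fixes f :: "'a::real_normed_vector \<Rightarrow> 'c::euclidean_space"
  assumes "f differentiable (at x)" "g differentiable (at (f x))"
  shows "((\<lambda>x. g (f x)) has_derivative (\<lambda>v. \<Sum>b\<in>Basis. (pd v f x \<bullet> b) *\<^sub>R pd b g (f x))) (at x)"
proof -
  have L: "linear (\<lambda>v. pd v g (f x))"
    using has_derivative_pd[OF assms(2)] has_derivative_linear by blast
  have *: "pd w g (f x) = (\<Sum>b\<in>Basis. (w \<bullet> b) *\<^sub>R pd b g (f x))" for w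
    using linear_sum[OF L, of "\<lambda>b. (w \<bullet> b) *\<^sub>R b" Basis]
    unfolding euclidean_representation linear_scale[OF L] .
  from has_derivative_compose[OF has_derivative_pd[OF assms(1)] has_derivative_pd[OF assms(2)]]
  show ?thesis unfolding *[of "pd _ f x"] .
qed

lemma Ck_compose:
  fixes f :: "'a::real_normed_vector \<Rightarrow> 'c::euclidean_space"
  assumes "open U" "Ck n U f" "Ck n V g" "f ` U \<subseteq> V"
  shows "Ck n U (\<lambda>x. g (f x))"
  using assms(2,3)
proof (induction n arbitrary: g)
  case (Suc n)
  show ?case
  proof (rule Ck_SucI[OF assms(1)])
    show "((\<lambda>x. g (f x)) has_derivative (\<lambda>v. \<Sum>b\<in>Basis. (pd v f x \<bullet> b) *\<^sub>R pd b g (f x))) (at x)"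
      if "x \<in> U" for x
      by (rule pd_compose) (use that Suc.prems assms(4) in \<open>auto simp: image_subset_iff\<close>)
    show "Ck n U (\<lambda>x. \<Sum>b\<in>Basis. (pd v f x \<bullet> b) *\<^sub>R pd b g (f x))" for v
    proof (intro Ck_sum[OF assms(1)] Ck_bilinear[OF assms(1) _ _ bounded_bilinear_scaleR])
      fix b :: 'c
      have *: "Ck n U (pd v f)" "Ck n V (pd b g)" using Suc.prems by simp_all
      show "Ck n U (\<lambda>x. pd v f x \<bullet> b)"
        by (rule Ck_linear[OF assms(1) *(1) bounded_linear_inner_left])
      show "Ck n U (\<lambda>x. pd b g (f x))"
        by (rule Suc.IH[OF Ck_Suc_D[OF Suc.prems(1)] *(2)])
    qed
  qed
qed auto

lemma Ck_ident: "open U \<Longrightarrow> Ck n U (\<lambda>x. x)"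
proof (cases n)
  case (Suc m)
  have "pd v (\<lambda>x::'a. x) = (\<lambda>x. v)" for v by (rule ext, rule pd_eqI) auto
  moreover assume "open U"
  ultimately show ?thesis using Suc Ck_const by auto
qed auto

lemma CinfD: "Cinf U f \<Longrightarrow> Ck n U f"
  by (simp add: Cinf_def)

lemma Cinf_differentiable: "Cinf U f \<Longrightarrow> x \<in> U \<Longrightarrow> f differentiable (at x)"
  using CinfD[of U f "Suc 0"] by simp

lemma Cinf_pd: "Cinf U f \<Longrightarrow> Cinf U (pd v f)"
  unfolding Cinf_def using Ck.simps(2)[of _ U f] by simp

lemma Cinf_has_derivative: "Cinf U f \<Longrightarrow> x \<in> U \<Longrightarrow> (f has_derivative (\<lambda>v. pd v f x)) (at x)"
  by (simp add: Cinf_differentiable has_derivative_pd)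

lemma Cinf_continuous_on: "Cinf U f \<Longrightarrow> continuous_on U f"
  by (auto intro!: continuous_at_imp_continuous_on differentiable_imp_continuous_within Cinf_differentiable)

lemma Cinf_subset: "Cinf U f \<Longrightarrow> V \<subseteq> U \<Longrightarrow> Cinf V f"
  using Ck_subset[of _ U f V] by (simp add: Cinf_def)

lemma Cinf_cong: "open U \<Longrightarrow> (\<And>x. x \<in> U \<Longrightarrow> f x = g x) \<Longrightarrow> Cinf U f \<longleftrightarrow> Cinf U g"
  using Ck_cong[of U f g] by (simp add: Cinf_def)

lemma Cinf_linear: "open U \<Longrightarrow> bounded_linear L \<Longrightarrow> Cinf U f \<Longrightarrow> Cinf U (\<lambda>x. L (f x))"
  by (simp add: Cinf_def Ck_linear)

lemma Cinf_compose:
  fixes f :: "'a::real_normed_vector \<Rightarrow> 'c::euclidean_space"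
  shows "open U \<Longrightarrow> Cinf V g \<Longrightarrow> Cinf U f \<Longrightarrow> f ` U \<subseteq> V \<Longrightarrow> Cinf U (\<lambda>x. g (f x))"
  using Ck_compose[of U _ f V g] by (simp add: Cinf_def)

named_theorems Cinf_intros

lemma Cinf_ident [Cinf_intros]: "open U \<Longrightarrow> Cinf U (\<lambda>x. x)"
  by (simp add: Cinf_def Ck_ident)

lemma Cinf_const [Cinf_intros]: "open U \<Longrightarrow> Cinf U (\<lambda>x. c)"
  by (simp add: Cinf_def Ck_const)

lemma Cinf_add [Cinf_intros]:
  "open U \<Longrightarrow> Cinf U f \<Longrightarrow> Cinf U g \<Longrightarrow> Cinf U (\<lambda>x. f x + g x)"
  by (simp add: Cinf_def Ck_add)

lemma Cinf_mult [Cinf_intros]: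
  fixes f g :: "'a::real_normed_vector \<Rightarrow> real"
  shows "open U \<Longrightarrow> Cinf U f \<Longrightarrow> Cinf U g \<Longrightarrow> Cinf U (\<lambda>x. f x * g x)"
  by (simp add: Cinf_def Ck_bilinear bounded_bilinear_mult)

lemma Cinf_scaleR [Cinf_intros]:
  "open U \<Longrightarrow> Cinf U f \<Longrightarrow> Cinf U g \<Longrightarrow> Cinf U (\<lambda>x. f x *\<^sub>R g x)"
  by (simp add: Cinf_def Ck_bilinear bounded_bilinear_scaleR)

lemma Cinf_inner [Cinf_intros]:
  "open U \<Longrightarrow> Cinf U f \<Longrightarrow> Cinf U g \<Longrightarrow> Cinf U (\<lambda>x. f x \<bullet> g x)"
  by (simp add: Cinf_def Ck_bilinear bounded_bilinear_inner)

lemma Cinf_minus [Cinf_intros]: "open U \<Longrightarrow> Cinf U f \<Longrightarrow> Cinf U (\<lambda>x. - f x)"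
  using Cinf_linear[OF _ bounded_linear_minus[OF bounded_linear_ident]] .

lemma Cinf_diff [Cinf_intros]:
  "open U \<Longrightarrow> Cinf U f \<Longrightarrow> Cinf U g \<Longrightarrow> Cinf U (\<lambda>x. f x - g x)"
  using Cinf_add[OF _ _ Cinf_minus] by simp

lemma Cinf_inverse [Cinf_intros]:
  fixes f :: "'a::real_normed_vector \<Rightarrow> real"
  shows "open U \<Longrightarrow> Cinf U f \<Longrightarrow> (\<And>x. x \<in> U \<Longrightarrow> f x \<noteq> 0) \<Longrightarrow> Cinf U (\<lambda>x. inverse (f x))"
  using Ck_inverse[of U _ f] by (simp add: Cinf_def)

lemma Cinf_divide [Cinf_intros]:
  fixes f g :: "'a::real_normed_vector \<Rightarrow> real"
  shows "open U \<Longrightarrow> Cinf U f \<Longrightarrow> Cinf U g \<Longrightarrow> (\<And>x. x \<in> U \<Longrightarrow> g x \<noteq> 0) \<Longrightarrow> Cinf U (\<lambda>x. f x / g x)"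
  unfolding divide_inverse by (intro Cinf_mult Cinf_inverse)

lemma Cinf_sqrt [Cinf_intros]:
  fixes f :: "'a::real_normed_vector \<Rightarrow> real"
  shows "open U \<Longrightarrow> Cinf U f \<Longrightarrow> (\<And>x. x \<in> U \<Longrightarrow> f x > 0) \<Longrightarrow> Cinf U (\<lambda>x. sqrt (f x))"
  using Ck_sqrt[of U _ f] by (simp add: Cinf_def)

lemma Cinf_power [Cinf_intros]:
  fixes f :: "'a::real_normed_vector \<Rightarrow> real"
  shows "open U \<Longrightarrow> Cinf U f \<Longrightarrow> Cinf U (\<lambda>x. f x ^ n)"
  by (induction n) (simp_all add: Cinf_const Cinf_mult)

lemma Cinf_fst [Cinf_intros]: "open U \<Longrightarrow> Cinf U f \<Longrightarrow> Cinf U (\<lambda>x. fst (f x))"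
  by (rule Cinf_linear[OF _ bounded_linear_fst])

lemma Cinf_snd [Cinf_intros]: "open U \<Longrightarrow> Cinf U f \<Longrightarrow> Cinf U (\<lambda>x. snd (f x))"
  by (rule Cinf_linear[OF _ bounded_linear_snd])

lemma Cinf_Pair [Cinf_intros]:
  assumes "open U" "Cinf U f" "Cinf U g"
  shows "Cinf U (\<lambda>x. (f x, g x))"
proof -
  have "bounded_linear (\<lambda>x::'b. (x, 0::'c))" "bounded_linear (\<lambda>x::'c. (0::'b, x))"
    by (intro bounded_linear_Pair bounded_linear_ident bounded_linear_zero)+
  from Cinf_add[OF assms(1) Cinf_linear[OF assms(1) this(1) assms(2)] Cinf_linear[OF assms(1) this(2) assms(3)]]
  show ?thesis by simp
qed

section \<open>Derivatives along lines and total differentiability\<close>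

lemma has_derivative_line: "((\<lambda>s::real. a + s *\<^sub>R v) has_derivative (\<lambda>h. h *\<^sub>R v)) (at s within S)"
  by (auto intro!: derivative_eq_intros)

lemma has_vector_derivative_line:
  assumes "f differentiable (at (a + s *\<^sub>R v))"
  shows "((\<lambda>r::real. f (a + r *\<^sub>R v)) has_vector_derivative pd v f (a + s *\<^sub>R v)) (at s within S)"
proof -
  have "((\<lambda>r. f (a + r *\<^sub>R v)) has_derivative (\<lambda>h. pd (h *\<^sub>R v) f (a + s *\<^sub>R v))) (at s within S)"
    by (rule has_derivative_in_compose[OF has_derivative_line has_derivative_at_withinI[OF has_derivative_pd[OF assms]]])
  moreover have "pd (h *\<^sub>R v) f (a + s *\<^sub>R v) = h *\<^sub>R pd v f (a + s *\<^sub>R v)" for h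
    by (rule linear_scale[OF has_derivative_linear[OF has_derivative_pd[OF assms]]])
  ultimately show ?thesis by (simp add: has_vector_derivative_def)
qed

lemma pd_eq_vector_derivative_line:
  assumes "f differentiable (at a)"
  shows "pd v f a = vector_derivative (\<lambda>r::real. f (a + r *\<^sub>R v)) (at 0)"
  using has_vector_derivative_line[of f a 0 v UNIV] assms by (simp add: vector_derivative_at)

text \<open>\<open>smooth_on\<close> provides only derivatives along lines and their continuity.
  This is the classical passage from continuous partial derivatives to a total derivative, one
  coordinate at a time.\<close>

lemma has_derivative_partials_line:
  fixes f :: "'a::euclidean_space \<Rightarrow> 'b::real_normed_vector"
  assumes U: "open U" "x \<in> U"
    and g: "\<And>b. b \<in> Basis \<Longrightarrow> continuous_on U (g b)"
    and d: "\<And>b y. b \<in> Basis \<Longrightarrow> y \<in> U \<Longrightarrow> ((\<lambda>s::real. f (y + s *\<^sub>R b)) has_vector_derivative g b y) (at 0)"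
  shows "(f has_derivative (\<lambda>h. \<Sum>b\<in>Basis. (h \<bullet> b) *\<^sub>R g b x)) (at x)"
proof -
  have line: "((\<lambda>s::real. f (z + s *\<^sub>R b)) has_vector_derivative g b (z + s *\<^sub>R b)) (at s within S)"
    if "b \<in> Basis" "z + s *\<^sub>R b \<in> U" for z s b S
  proof -
    have "((\<lambda>r. r - s) has_vector_derivative 1) (at s)"
      by (auto intro!: derivative_eq_intros)
    moreover have "((\<lambda>r. f ((z + s *\<^sub>R b) + r *\<^sub>R b)) has_vector_derivative g b (z + s *\<^sub>R b)) (at (s - s))"
      using d[OF that] by simp
    ultimately have "((\<lambda>r. f ((z + s *\<^sub>R b) + r *\<^sub>R b)) \<circ> (\<lambda>r. r - s) has_vector_derivative
        1 *\<^sub>R g b (z + s *\<^sub>R b)) (at s)"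
      by (rule vector_diff_chain_at)
    then have "((\<lambda>r. f (z + r *\<^sub>R b)) has_vector_derivative g b (z + s *\<^sub>R b)) (at s)"
      by (simp add: o_def scaleR_diff_left)
    then show ?thesis by (rule has_vector_derivative_at_within)
  qed
  \<comment> \<open>Induction over the set of directions used. The base point z stays general near
    x, because after the step along b the remaining steps start from a shifted point.\<close>
  have main: "\<exists>d>0. \<forall>c z. norm (z - x) + (\<Sum>b\<in>B. \<bar>c b\<bar>) < d \<longrightarrow>
      norm (f (z + (\<Sum>b\<in>B. c b *\<^sub>R b)) - f z - (\<Sum>b\<in>B. c b *\<^sub>R g b x)) \<le> e * (\<Sum>b\<in>B. \<bar>c b\<bar>)"
    if "finite B" "B \<subseteq> Basis" "e > 0" for B :: "'a set" and e :: real
    using that(1,2)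
  proof (induction B)
    case empty
    then show ?case by (auto intro!: exI[of _ 1])
  next
    case (insert b B)
    then obtain d1 where d1: "d1 > 0" and IH: "\<And>c z. norm (z - x) + (\<Sum>b\<in>B. \<bar>c b\<bar>) < d1 \<Longrightarrow>
      norm (f (z + (\<Sum>b\<in>B. c b *\<^sub>R b)) - f z - (\<Sum>b\<in>B. c b *\<^sub>R g b x)) \<le> e * (\<Sum>b\<in>B. \<bar>c b\<bar>)"
      by auto
    have b: "b \<in> Basis" using insert by auto
    have "isCont (g b) x" using g[OF b] U by (simp add: continuous_on_eq_continuous_at)
    then obtain d2 where d2: "d2 > 0" "\<And>y. norm (y - x) < d2 \<Longrightarrow> norm (g b y - g b x) < e/3"
      unfolding continuous_at_eps_delta dist_norm using \<open>e > 0\<close> by (metis divide_pos_pos zero_less_numeral)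
    obtain d3 where d3: "d3 > 0" "ball x d3 \<subseteq> U" using U openE by blast
    define d where "d = min d1 (min d2 d3)"
    have "norm (f (z + (\<Sum>b\<in>insert b B. c b *\<^sub>R b)) - f z - (\<Sum>b\<in>insert b B. c b *\<^sub>R g b x))
        \<le> e * (\<Sum>b\<in>insert b B. \<bar>c b\<bar>)"
      if small: "norm (z - x) + (\<Sum>b\<in>insert b B. \<bar>c b\<bar>) < d" for c z
    proof -
      have sB: "(\<Sum>b\<in>insert b B. \<bar>c b\<bar>) = \<bar>c b\<bar> + (\<Sum>b\<in>B. \<bar>c b\<bar>)" using insert by simp
      have pos: "(\<Sum>b\<in>B. \<bar>c b\<bar>) \<ge> 0" by (simp add: sum_nonneg)
      define z' where "z' = z + c b *\<^sub>R b"
      have nb: "norm b = 1" using b by simp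
      have "norm (z' - x) \<le> norm (z - x) + \<bar>c b\<bar>"
        unfolding z'_def using norm_triangle_ineq[of "z - x" "c b *\<^sub>R b"] nb by (simp add: algebra_simps)
      then have 1: "norm (f (z' + (\<Sum>b\<in>B. c b *\<^sub>R b)) - f z' - (\<Sum>b\<in>B. c b *\<^sub>R g b x)) \<le> e * (\<Sum>b\<in>B. \<bar>c b\<bar>)"
        by (intro IH) (use small sB d_def in linarith)
      have near: "norm (z + s *\<^sub>R b - x) < d" if "s \<in> closed_segment 0 (c b)" for s
      proof -
        have "\<bar>s\<bar> \<le> \<bar>c b\<bar>" using that by (auto simp: closed_segment_eq_real_ivl split: if_splits)
        moreover have "norm (z + s *\<^sub>R b - x) \<le> norm (z - x) + \<bar>s\<bar>"
          using norm_triangle_ineq[of "z - x" "s *\<^sub>R b"] nb by (simp add: algebra_simps)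
        ultimately show ?thesis using small sB pos by linarith
      qed
      have gn: "norm (g b (z + s *\<^sub>R b) - g b x) \<le> e/3" if "s \<in> closed_segment 0 (c b)" for s
        using d2(2)[of "z + s *\<^sub>R b"] near[OF that] by (simp add: d_def)
      \<comment> \<open>On the segment the derivative is within e/3 of its value at x, hence within
        2e/3 of its value at z; replacing the latter by the value at x costs the remaining
        e/3.\<close>
      have "norm (f (z + c b *\<^sub>R b) - f (z + 0 *\<^sub>R b) - (c b - 0) *\<^sub>R g b (z + 0 *\<^sub>R b)) \<le> norm (c b - 0) * (2*e/3)"
      proof (rule vector_differentiable_bound_linearization[where S="closed_segment 0 (c b)" and
            f' = "\<lambda>s. g b (z + s *\<^sub>R b)" and f="\<lambda>s. f (z + s *\<^sub>R b)"])
        fix s assume s: "s \<in> closed_segment 0 (c b)"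
        have "z + s *\<^sub>R b \<in> U" using near[OF s] d3 by (auto simp: d_def dist_norm norm_minus_commute subset_eq)
        then show "((\<lambda>s. f (z + s *\<^sub>R b)) has_vector_derivative g b (z + s *\<^sub>R b)) (at s within closed_segment 0 (c b))"
          using line b by blast
        show "norm (g b (z + s *\<^sub>R b) - g b (z + 0 *\<^sub>R b)) \<le> 2*e/3"
          using norm_triangle_ineq4[of "g b (z + s *\<^sub>R b) - g b x" "g b (z + 0 *\<^sub>R b) - g b x"] gn[OF s] gn[of 0]
          by simp
      qed auto
      moreover have "norm (c b *\<^sub>R g b z - c b *\<^sub>R g b x) \<le> \<bar>c b\<bar> * (e/3)"
        using mult_left_mono[OF gn[of 0], of "\<bar>c b\<bar>"] by (simp flip: scaleR_diff_right)
      ultimately have 2: "norm (f z' - f z - c b *\<^sub>R g b x) \<le> e * \<bar>c b\<bar>"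
        using norm_triangle_ineq[of "f z' - f z - c b *\<^sub>R g b z" "c b *\<^sub>R g b z - c b *\<^sub>R g b x"]
        by (simp add: z'_def algebra_simps)
      have "norm (f (z + (\<Sum>b\<in>insert b B. c b *\<^sub>R b)) - f z - (\<Sum>b\<in>insert b B. c b *\<^sub>R g b x))
        = norm ((f (z' + (\<Sum>b\<in>B. c b *\<^sub>R b)) - f z' - (\<Sum>b\<in>B. c b *\<^sub>R g b x)) + (f z' - f z - c b *\<^sub>R g b x))"
        using insert by (simp add: z'_def algebra_simps)
      also have "\<dots> \<le> e * (\<Sum>b\<in>B. \<bar>c b\<bar>) + e * \<bar>c b\<bar>" using 1 2 norm_triangle_mono by blast
      finally show ?thesis using sB by (simp add: algebra_simps)
    qed
    moreover have "d > 0" using d1 d2 d3 by (simp add: d_def)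
    ultimately show ?case by blast
  qed
  show ?thesis
    unfolding has_derivative_at_alt
  proof (intro conjI allI impI)
    show "bounded_linear (\<lambda>h. \<Sum>b\<in>Basis. (h \<bullet> b) *\<^sub>R g b x)"
      by (intro bounded_linear_sum bounded_linear_scaleR_const bounded_linear_inner_left)
    fix e :: real assume e: "e > 0"
    define n where "n = real DIM('a)"
    have n: "n > 0" by (simp add: n_def)
    \<comment> \<open>The sum of the absolute coordinates is at most n times the Euclidean norm,
      hence the accuracy e/n here and the radius d/n below.\<close>
    obtain d where d: "d > 0" "\<And>c z. norm (z - x) + (\<Sum>b\<in>Basis. \<bar>c b\<bar>) < d \<Longrightarrow>
      norm (f (z + (\<Sum>b\<in>Basis. c b *\<^sub>R b)) - f z - (\<Sum>b\<in>Basis. c b *\<^sub>R g b x)) \<le> e/n * (\<Sum>b\<in>Basis. \<bar>c b\<bar>)"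
      using main[of Basis "e/n"] e n by auto
    have "norm (f y - f x - (\<Sum>b\<in>Basis. ((y - x) \<bullet> b) *\<^sub>R g b x)) \<le> e * norm (y - x)"
      if y: "norm (y - x) < d/n" for y
    proof -
      have "(\<Sum>b\<in>Basis. \<bar>(y - x) \<bullet> b\<bar>) \<le> (\<Sum>b\<in>(Basis::'a set). norm (y - x))"
        by (intro sum_mono) (simp add: Basis_le_norm)
      then have S: "(\<Sum>b\<in>Basis. \<bar>(y - x) \<bullet> b\<bar>) \<le> n * norm (y - x)" by (simp add: n_def)
      moreover have "n * norm (y - x) < d" using y n by (simp add: field_simps)
      ultimately have "norm (f (x + (\<Sum>b\<in>Basis. ((y - x) \<bullet> b) *\<^sub>R b)) - f x - (\<Sum>b\<in>Basis. ((y - x) \<bullet> b) *\<^sub>R g b x))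
          \<le> e/n * (\<Sum>b\<in>Basis. \<bar>(y - x) \<bullet> b\<bar>)"
        by (intro d(2)) simp
      also have "\<dots> \<le> e/n * (n * norm (y - x))" using S e n by (intro mult_left_mono) auto
      also have "\<dots> = e * norm (y - x)" using n by simp
      finally show ?thesis by (simp add: euclidean_representation)
    qed
    then show "\<exists>d>0. \<forall>y. norm (y - x) < d \<longrightarrow>
        norm (f y - f x - (\<Sum>b\<in>Basis. ((y - x) \<bullet> b) *\<^sub>R g b x)) \<le> e * norm (y - x)"
      using d n by (intro exI[of _ "d/n"]) simp
  qed
qed

text \<open>Every iterated line derivative has continuous line derivatives, so it is totally
  differentiable, and on U its \<open>pd\<close> is the next \<open>dderiv\<close>. The induction
  covers all direction lists at once.\<close>

lemma smooth_on_imp_Cinf: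
  fixes f :: "'a::euclidean_space \<Rightarrow> 'b::real_normed_vector"
  assumes "smooth_on U f"
  shows "Cinf U f"
proof -
  have U: "open U" using assms by (simp add: smooth_on_def)
  have diff: "iter_dderiv vs f differentiable (at x)" if "x \<in> U" for vs x
  proof -
    have "(iter_dderiv vs f has_derivative (\<lambda>h. \<Sum>b\<in>Basis. (h \<bullet> b) *\<^sub>R iter_dderiv (b # vs) f x)) (at x)"
    proof (rule has_derivative_partials_line[OF U that])
      show "continuous_on U (iter_dderiv (b # vs) f)" for b
        using assms unfolding smooth_on_def by blast
      show "((\<lambda>s. iter_dderiv vs f (y + s *\<^sub>R b)) has_vector_derivative iter_dderiv (b # vs) f y) (at 0)"
        if "y \<in> U" for y b
        using assms that unfolding smooth_on_def by (simp add: dderiv_def vector_derivative_works)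
    qed
    then show ?thesis by (rule differentiableI)
  qed
  have "Ck n U (iter_dderiv vs f)" for n vs
  proof (induction n arbitrary: vs)
    case (Suc n)
    have "Ck n U (pd v (iter_dderiv vs f)) \<longleftrightarrow> Ck n U (iter_dderiv (v # vs) f)" for v
      by (rule Ck_cong[OF U]) (simp add: dderiv_def pd_eq_vector_derivative_line diff)
    then show ?case using Suc.IH[of "_ # vs"] diff by simp
  qed simp
  from this[of _ "[]"] show ?thesis by (simp add: Cinf_def)
qed

section \<open>Symmetry of second derivatives\<close>

lemma pd_mixed_mvt:
  fixes f :: "'a::real_normed_vector \<Rightarrow> real"
  assumes f: "Cinf U f" and h: "h > 0"
    and U: "\<And>s r. 0 \<le> s \<Longrightarrow> s \<le> h \<Longrightarrow> 0 \<le> r \<Longrightarrow> r \<le> h \<Longrightarrow> x + s *\<^sub>R u + r *\<^sub>R v \<in> U"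
  obtains s r where "0 \<le> s" "s \<le> h" "0 \<le> r" "r \<le> h"
    "f (x + h *\<^sub>R u + h *\<^sub>R v) - f (x + h *\<^sub>R u) - f (x + h *\<^sub>R v) + f x
      = h\<^sup>2 * pd v (pd u f) (x + s *\<^sub>R u + r *\<^sub>R v)"
proof -
  \<comment> \<open>The second difference over the square is the increment of this first difference
    in direction v; the mean value theorem is applied in direction u and then in direction
    v.\<close>
  define g where "g s = f (x + h *\<^sub>R v + s *\<^sub>R u) - f (x + s *\<^sub>R u)" for s
  have D: "DERIV g s :> pd u f (x + h *\<^sub>R v + s *\<^sub>R u) - pd u f (x + s *\<^sub>R u)" if "0 \<le> s" "s \<le> h" for s
    unfolding g_def has_real_derivative_iff_has_vector_derivative
    using U[of s h] U[of s 0] that h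
    by (intro has_vector_derivative_diff has_vector_derivative_line Cinf_differentiable[OF f])
      (simp_all add: algebra_simps)
  obtain s where s: "0 < s" "s < h"
    "g h - g 0 = h * (pd u f (x + h *\<^sub>R v + s *\<^sub>R u) - pd u f (x + s *\<^sub>R u))"
    using MVT2[OF h D] by auto
  have D2: "DERIV (\<lambda>r. pd u f (x + s *\<^sub>R u + r *\<^sub>R v)) r :> pd v (pd u f) (x + s *\<^sub>R u + r *\<^sub>R v)"
    if "0 \<le> r" "r \<le> h" for r
    unfolding has_real_derivative_iff_has_vector_derivative
    using U[of s r] s that
    by (intro has_vector_derivative_line Cinf_differentiable[OF Cinf_pd[OF f]]) auto
  obtain r where r: "0 < r" "r < h"
    "pd u f (x + s *\<^sub>R u + h *\<^sub>R v) - pd u f (x + s *\<^sub>R u + 0 *\<^sub>R v)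
      = h * pd v (pd u f) (x + s *\<^sub>R u + r *\<^sub>R v)"
    using MVT2[OF h D2] by auto
  show thesis
  proof (rule that[of s r])
    show "f (x + h *\<^sub>R u + h *\<^sub>R v) - f (x + h *\<^sub>R u) - f (x + h *\<^sub>R v) + f x
      = h\<^sup>2 * pd v (pd u f) (x + s *\<^sub>R u + r *\<^sub>R v)"
      using s(3) r(3) by (simp add: g_def power2_eq_square algebra_simps)
  qed (use s r in auto)
qed

text \<open>The second difference is symmetric in u and v, so \<open>pd_mixed_mvt\<close> in both
  orders equates the two mixed derivatives at nearby points; continuity does the rest.\<close>

lemma pd_commute:
  fixes f :: "'a::real_normed_vector \<Rightarrow> real"
  assumes U: "open U" "x \<in> U" and f: "Cinf U f"
  shows "pd u (pd v f) x = pd v (pd u f) x"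
proof (rule ccontr)
  assume ne: "pd u (pd v f) x \<noteq> pd v (pd u f) x"
  define e where "e = \<bar>pd u (pd v f) x - pd v (pd u f) x\<bar> / 2"
  have e: "e > 0" using ne by (simp add: e_def)
  have "isCont (pd a (pd b f)) x" for a b
    using Cinf_differentiable[OF Cinf_pd[OF Cinf_pd[OF f]] U(2)] differentiable_imp_continuous_within by blast
  then have "\<exists>d>0. \<forall>y. dist y x < d \<longrightarrow> \<bar>pd a (pd b f) y - pd a (pd b f) x\<bar> < e" for a b
    using e unfolding continuous_at_eps_delta dist_real_def by simp
  then obtain d1 d2 where d: "d1 > 0" "d2 > 0"
    "\<And>y. dist y x < d1 \<Longrightarrow> \<bar>pd u (pd v f) y - pd u (pd v f) x\<bar> < e"
    "\<And>y. dist y x < d2 \<Longrightarrow> \<bar>pd v (pd u f) y - pd v (pd u f) x\<bar> < e"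
    by meson
  obtain d3 where d3: "d3 > 0" "ball x d3 \<subseteq> U" using U openE by blast
  define dd where "dd = min d1 (min d2 d3)"
  \<comment> \<open>The summand 1 keeps the divisor of h positive even if u = v = 0.\<close>
  define m where "m = norm u + norm v + 1"
  define h where "h = dd / (2 * m)"
  have nn: "m > 0" unfolding m_def using norm_ge_zero[of u] norm_ge_zero[of v] by linarith
  have dd: "dd > 0" using d d3 by (simp add: dd_def)
  have h: "h > 0" using dd nn by (simp add: h_def)
  have hh: "h * (norm u + norm v) < dd"
  proof -
    have "h * (norm u + norm v) \<le> h * m" using h by (simp add: m_def)
    also have "\<dots> = dd / 2" using nn by (simp add: h_def)
    finally show ?thesis using dd by simp
  qed
  have near: "dist (x + s *\<^sub>R a + r *\<^sub>R b) x < dd"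
    if "0 \<le> s" "s \<le> h" "0 \<le> r" "r \<le> h" "norm a + norm b = norm u + norm v" for s r a b
  proof -
    have "dist (x + s *\<^sub>R a + r *\<^sub>R b) x \<le> s * norm a + r * norm b"
      using norm_triangle_ineq[of "s *\<^sub>R a" "r *\<^sub>R b"] that by (simp add: dist_norm)
    also have "\<dots> \<le> h * norm a + h * norm b"
      using that by (intro add_mono mult_right_mono) auto
    also have "\<dots> = h * (norm u + norm v)" using that(5) by (simp flip: distrib_left)
    finally show ?thesis using hh by simp
  qed
  have inU: "x + s *\<^sub>R a + r *\<^sub>R b \<in> U"
    if "0 \<le> s" "s \<le> h" "0 \<le> r" "r \<le> h" "norm a + norm b = norm u + norm v" for s r a b
    using near[OF that] d3 by (auto simp: dd_def subset_eq dist_commute)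
  obtain s r where 1: "0 \<le> s" "s \<le> h" "0 \<le> r" "r \<le> h"
    "f (x + h *\<^sub>R u + h *\<^sub>R v) - f (x + h *\<^sub>R u) - f (x + h *\<^sub>R v) + f x
      = h\<^sup>2 * pd v (pd u f) (x + s *\<^sub>R u + r *\<^sub>R v)"
    using pd_mixed_mvt[OF f h, of x u v] inU[of _ _ u v] by blast
  obtain s' r' where 2: "0 \<le> s'" "s' \<le> h" "0 \<le> r'" "r' \<le> h"
    "f (x + h *\<^sub>R v + h *\<^sub>R u) - f (x + h *\<^sub>R v) - f (x + h *\<^sub>R u) + f x
      = h\<^sup>2 * pd u (pd v f) (x + s' *\<^sub>R v + r' *\<^sub>R u)"
    using pd_mixed_mvt[OF f h, of x v u] inU[of _ _ v u] by (auto simp: add.commute)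
  have "h\<^sup>2 * pd v (pd u f) (x + s *\<^sub>R u + r *\<^sub>R v) = h\<^sup>2 * pd u (pd v f) (x + s' *\<^sub>R v + r' *\<^sub>R u)"
    using 1(5) 2(5) by (simp add: algebra_simps)
  then have "pd v (pd u f) (x + s *\<^sub>R u + r *\<^sub>R v) = pd u (pd v f) (x + s' *\<^sub>R v + r' *\<^sub>R u)"
    using h by simp
  moreover have "\<bar>pd v (pd u f) (x + s *\<^sub>R u + r *\<^sub>R v) - pd v (pd u f) x\<bar> < e"
    using near[OF 1(1-4), of u v] by (intro d(4)) (simp add: dd_def)
  moreover have "\<bar>pd u (pd v f) (x + s' *\<^sub>R v + r' *\<^sub>R u) - pd u (pd v f) x\<bar> < e"
    using near[OF 2(1-4), of v u] by (intro d(3)) (simp add: dd_def)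
  moreover have "\<bar>p - b\<bar> < e \<Longrightarrow> \<bar>p - a\<bar> < e \<Longrightarrow> \<bar>a - b\<bar> < 2 * e" for p a b :: real
    by linarith
  ultimately have "\<bar>pd u (pd v f) x - pd v (pd u f) x\<bar> < 2 * e" by metis
  then show False by (simp add: e_def)
qed

section \<open>Derivatives along vector fields\<close>

lemma pd_add: "f differentiable (at x) \<Longrightarrow> g differentiable (at x) \<Longrightarrow>
    pd v (\<lambda>x. f x + g x) x = pd v f x + pd v g x"
  by (rule pd_eqI[OF has_derivative_add[OF has_derivative_pd has_derivative_pd]])

lemma pd_mult:
  fixes f g :: "'a::real_normed_vector \<Rightarrow> real"
  shows "f differentiable (at x) \<Longrightarrow> g differentiable (at x) \<Longrightarrow>
    pd v (\<lambda>x. f x * g x) x = f x * pd v g x + pd v f x * g x"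
  by (rule pd_eqI[OF has_derivative_mult[OF has_derivative_pd has_derivative_pd]])

lemma pd_const: "pd v (\<lambda>x. c) x = 0"
  by (rule pd_eqI[OF has_derivative_const])

lemma pd_linear:
  "f differentiable (at x) \<Longrightarrow> bounded_linear L \<Longrightarrow> pd v (\<lambda>x. L (f x)) x = L (pd v f x)"
  by (rule pd_eqI[OF bounded_linear.has_derivative[OF _ has_derivative_pd]])

lemma pd_dir_add: "f differentiable (at x) \<Longrightarrow> pd (v + w) f x = pd v f x + pd w f x"
  by (rule linear_add[OF has_derivative_linear[OF has_derivative_pd]])

lemma pd_dir_scale: "f differentiable (at x) \<Longrightarrow> pd (c *\<^sub>R v) f x = c *\<^sub>R pd v f x"
  by (rule linear_scale[OF has_derivative_linear[OF has_derivative_pd]])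

lemma pd_dir_sum: "f differentiable (at x) \<Longrightarrow> pd (\<Sum>i\<in>I. g i) f x = (\<Sum>i\<in>I. pd (g i) f x)"
  by (rule linear_sum[OF has_derivative_linear[OF has_derivative_pd]])

definition Lie :: "('a::real_normed_vector \<Rightarrow> 'a) \<Rightarrow> ('a \<Rightarrow> real) \<Rightarrow> 'a \<Rightarrow> real" where
  "Lie \<xi> f z = pd (\<xi> z) f z"

lemma Cinf_Lie:
  fixes \<xi> :: "'a::euclidean_space \<Rightarrow> 'a"
  assumes U: "open U" and f: "Cinf U f" and \<xi>: "Cinf U \<xi>"
  shows "Cinf U (Lie \<xi> f)"
proof -
  have eq: "Lie \<xi> f z = (\<Sum>b\<in>Basis. (\<xi> z \<bullet> b) * pd b f z)" if "z \<in> U" for z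
  proof -
    have d: "f differentiable (at z)" using f that by (rule Cinf_differentiable)
    have "pd (\<Sum>b\<in>Basis. (\<xi> z \<bullet> b) *\<^sub>R b) f z = (\<Sum>b\<in>Basis. (\<xi> z \<bullet> b) * pd b f z)"
      by (simp only: pd_dir_sum[OF d] pd_dir_scale[OF d] real_scaleR_def)
    then show ?thesis unfolding Lie_def euclidean_representation .
  qed
  have "Cinf U (\<lambda>z. \<Sum>b\<in>Basis. (\<xi> z \<bullet> b) * pd b f z)"
    unfolding Cinf_def
    by (intro allI Ck_sum[OF U] CinfD Cinf_mult[OF U] Cinf_inner[OF U] Cinf_const[OF U] \<xi> Cinf_pd[OF f])
  then show ?thesis using Cinf_cong[OF U eq] by simp
qed

lemma Lie_cong:
  assumes "open U" "\<And>x. x \<in> U \<Longrightarrow> f x = g x" "x \<in> U"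
  shows "Lie \<xi> f x = Lie \<xi> g x"
  unfolding Lie_def by (rule pd_cong_open[OF assms])

text \<open>With this predicate second derivatives of composite expressions are computed by resolution
  with \<open>jet_add\<close> and \<open>jet_mult\<close>.\<close>
definition jet :: "'a::euclidean_space set \<Rightarrow> ('a \<Rightarrow> 'a) \<Rightarrow> 'a \<Rightarrow> ('a \<Rightarrow> real) \<Rightarrow> real \<Rightarrow> real \<Rightarrow> real \<Rightarrow> bool" where
  "jet U \<xi> z f a b c \<longleftrightarrow> Cinf U f \<and> f z = a \<and> Lie \<xi> f z = b \<and> Lie \<xi> (Lie \<xi> f) z = c"

context
  fixes U :: "'a::euclidean_space set" and \<xi> :: "'a \<Rightarrow> 'a" and z :: 'a
  assumes U: "open U" "z \<in> U" and \<xi>: "Cinf U \<xi>"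
begin

lemma jetI: "Cinf U f \<Longrightarrow> jet U \<xi> z f (f z) (Lie \<xi> f z) (Lie \<xi> (Lie \<xi> f) z)"
  by (simp add: jet_def)

lemma jet_const: "jet U \<xi> z (\<lambda>x. k) k 0 0"
proof -
  have "Lie \<xi> (\<lambda>x. k) = (\<lambda>x. 0)" for k
    by (rule ext) (simp add: Lie_def pd_const)
  then show ?thesis unfolding jet_def using Cinf_const[OF U(1)] by simp
qed

lemma Lie_add: "Cinf U f \<Longrightarrow> Cinf U g \<Longrightarrow> x \<in> U \<Longrightarrow> Lie \<xi> (\<lambda>x. f x + g x) x = Lie \<xi> f x + Lie \<xi> g x"
  unfolding Lie_def by (intro pd_add Cinf_differentiable[of U])

lemma Lie_mult: "Cinf U f \<Longrightarrow> Cinf U g \<Longrightarrow> x \<in> U \<Longrightarrow>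
    Lie \<xi> (\<lambda>x. f x * g x) x = f x * Lie \<xi> g x + Lie \<xi> f x * g x"
  unfolding Lie_def by (intro pd_mult Cinf_differentiable[of U])

lemma jet_add:
  assumes "jet U \<xi> z f a b c" "jet U \<xi> z g a' b' c'"
  shows "jet U \<xi> z (\<lambda>x. f x + g x) (a + a') (b + b') (c + c')"
proof -
  have f: "Cinf U f" and g: "Cinf U g" using assms by (auto simp: jet_def)
  note L = Cinf_Lie[OF U(1) f \<xi>] Cinf_Lie[OF U(1) g \<xi>]
  have "Lie \<xi> (Lie \<xi> (\<lambda>x. f x + g x)) z = Lie \<xi> (\<lambda>x. Lie \<xi> f x + Lie \<xi> g x) z"
    by (rule Lie_cong[OF U(1) Lie_add[OF f g] U(2)])
  then show ?thesis
    using assms Lie_add[OF f g U(2)] Lie_add[OF L U(2)] Cinf_add[OF U(1) f g]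
    by (simp add: jet_def)
qed

lemma jet_mult:
  assumes "jet U \<xi> z f a b c" "jet U \<xi> z g a' b' c'"
  shows "jet U \<xi> z (\<lambda>x. f x * g x) (a * a') (a * b' + b * a') (a * c' + 2 * (b * b') + c * a')"
proof -
  have f: "Cinf U f" and g: "Cinf U g" using assms by (auto simp: jet_def)
  note L = Cinf_Lie[OF U(1) f \<xi>] Cinf_Lie[OF U(1) g \<xi>]
  have "Lie \<xi> (Lie \<xi> (\<lambda>x. f x * g x)) z = Lie \<xi> (\<lambda>x. f x * Lie \<xi> g x + Lie \<xi> f x * g x) z"
    by (rule Lie_cong[OF U(1) Lie_mult[OF f g] U(2)])
  also have "\<dots> = f z * Lie \<xi> (Lie \<xi> g) z + 2 * (Lie \<xi> f z * Lie \<xi> g z) + Lie \<xi> (Lie \<xi> f) z * g z"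
    by (simp add: Lie_add[OF Cinf_mult[OF U(1) f L(2)] Cinf_mult[OF U(1) L(1) g] U(2)]
      Lie_mult[OF f L(2) U(2)] Lie_mult[OF L(1) g U(2)])
  finally show ?thesis
    using assms Lie_mult[OF f g U(2)] Cinf_mult[OF U(1) f g]
    by (simp add: jet_def)
qed

lemma jet_cong:
  assumes "jet U \<xi> z f a b c" "\<And>x. x \<in> U \<Longrightarrow> g x = f x"
  shows "jet U \<xi> z g a b c"
proof -
  have "Cinf U g" using assms Cinf_cong[OF U(1), of g f] by (simp add: jet_def)
  moreover have "Lie \<xi> (Lie \<xi> g) z = Lie \<xi> (Lie \<xi> f) z"
    by (rule Lie_cong[OF U(1) Lie_cong[OF U(1) assms(2)] U(2)])
  ultimately show ?thesis
    using assms Lie_cong[OF U(1) assms(2) U(2), where \<xi>=\<xi>] U by (simp add: jet_def)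
qed

lemma jet_linear_const: "Cinf U y \<Longrightarrow> (\<And>x. x \<in> U \<Longrightarrow> Lie \<xi> y x = k) \<Longrightarrow> jet U \<xi> z y (y z) k 0"
  using Lie_cong[OF U(1), of "Lie \<xi> y" "\<lambda>x. k" z \<xi>] U by (simp add: jet_def Lie_def pd_const)

end

text \<open>Serves implicit differentiation: a root or a quotient is put into a polynomial identity,
  and the jets of both sides are compared.\<close>

lemma jet_unique: "jet U \<xi> z f a b c \<Longrightarrow> jet U \<xi> z f a' b' c' \<Longrightarrow> a = a' \<and> b = b' \<and> c = c'"
  by (simp add: jet_def)

lemma jet_eq: "jet U \<xi> z f a b c \<Longrightarrow> a = a' \<Longrightarrow> b = b' \<Longrightarrow> c = c' \<Longrightarrow> jet U \<xi> z f a' b' c'"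
  by simp

text \<open>Here \<open>a, b\<close> are the principal radii, \<open>A, B, C, E\<close> the third derivatives
  \<open>v\<^sub>1\<^sub>1\<^sub>1, v\<^sub>1\<^sub>1\<^sub>2, v\<^sub>1\<^sub>2\<^sub>2, v\<^sub>2\<^sub>2\<^sub>2\<close> and \<open>p, q, r\<close> the fourth derivatives
  \<open>v\<^sub>1\<^sub>1\<^sub>1\<^sub>1, v\<^sub>1\<^sub>1\<^sub>2\<^sub>2, v\<^sub>2\<^sub>2\<^sub>2\<^sub>2\<close>; \<open>H\<close> is the sum of the radii, \<open>P11, P22\<close> are second derivatives of
  their product, \<open>V11, V22\<close> the time derivatives of \<open>v\<^sub>1\<^sub>1, v\<^sub>2\<^sub>2\<close>.\<close>
lemma pinching_algebra:
  fixes a b A B C E p q r w w0 w11 w22 :: real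
  defines "H \<equiv> a + b" and "H11 \<equiv> p + q + 3*a + b" and "H22 \<equiv> q + r + a + 3*b"
  defines "P11 \<equiv> b*p + a*q + 2*A*C - 2*B\<^sup>2 + 4*a*b" and "P22 \<equiv> b*q + a*r + 2*B*E - 2*C\<^sup>2 + 4*a*b"
  defines "N \<equiv> a\<^sup>2 + b\<^sup>2"
  defines "V11 \<equiv> 2*H*H11 + 2*(A+C)\<^sup>2 - 2*P11 + N" and "V22 \<equiv> 2*H*H22 + 2*(B+E)\<^sup>2 - 2*P22 + N"
  assumes pos: "a > 0" "b > 0" and ne: "a \<noteq> b"
    and w: "2*w*H = (a - b)\<^sup>2"
    and crit1: "2*w*(A+C) = 2*H*(A+C) - 4*(b*A + a*C)"
    and crit2: "2*w*(B+E) = 2*H*(B+E) - 4*(b*B + a*E)"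
    and sec1: "2*(w11*H + w*H11) = 2*H*H11 + 2*(A+C)\<^sup>2 - 4*P11"
    and sec2: "2*(w22*H + w*H22) = 2*H*H22 + 2*(B+E)\<^sup>2 - 4*P22"
    and time: "2*(w0*H + w*(V11 + V22)) = 2*H*(V11 + V22) - 4*(b*V11 + a*V22)"
    and max: "w11 \<le> 0" "w22 \<le> 0"
  shows "w0 < 0"
proof -
  have H: "H > 0" using pos by (simp add: H_def)
  \<comment> \<open>Multiplying the critical point equation by H and inserting 2wH = (a - b)^2
    removes w; what remains has the factor a - b.\<close>
  have c1: "(a + 3*b) * A = (b + 3*a) * C"
  proof -
    have "(a - b)\<^sup>2 * (A + C) = H * (2*H*(A+C) - 4*(b*A + a*C))"
      using w crit1 by algebra
    then have "(a - b) * ((a + 3*b) * A - (b + 3*a) * C) = 0"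
      unfolding H_def by algebra
    then show ?thesis using ne by simp
  qed
  have c2: "(a + 3*b) * B = (b + 3*a) * E"
  proof -
    have "(a - b)\<^sup>2 * (B + E) = H * (2*H*(B+E) - 4*(b*B + a*E))"
      using w crit2 by algebra
    then have "(a - b) * ((a + 3*b) * B - (b + 3*a) * E) = 0"
      unfolding H_def by algebra
    then show ?thesis using ne by simp
  qed
  \<comment> \<open>The critical equations make (A, C) and (B, E) multiples of (b + 3a, a + 3b); the
    factors s and t are the two remaining degrees of freedom.\<close>
  define s where "s = A / (b + 3*a)"
  define t where "t = B / (b + 3*a)"
  have nz: "b + 3*a \<noteq> 0" using pos by simp
  have A: "A = (b + 3*a) * s" and B: "B = (b + 3*a) * t" using nz by (auto simp: s_def t_def)
  have "(b + 3*a) * C = (b + 3*a) * ((a + 3*b) * s)" "(b + 3*a) * E = (b + 3*a) * ((a + 3*b) * t)"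
    using c1 c2 unfolding A B by algebra+
  then have C: "C = (a + 3*b) * s" and E: "E = (a + 3*b) * t" using nz by simp_all
  define Q1 where "Q1 = 4*(a-b)^3*(a+3*b) - 8*H*(a*(a-b)\<^sup>2 + b*(a+3*b)\<^sup>2)"
  define Q2 where "Q2 = 4*(b-a)^3*(b+3*a) - 8*H*(b*(b-a)\<^sup>2 + a*(b+3*a)\<^sup>2)"
  \<comment> \<open>The fourth derivatives p, q, r enter only through \<open>w11\<close> and
    \<open>w22\<close>, with weights 2a and 2b, the derivatives of the speed a^2 + b^2 in the radii.
    No product s * t occurs, so \<open>Q1\<close> and \<open>Q2\<close> can be estimated
    separately.\<close>
  have key: "H\<^sup>2 * w0 = H\<^sup>2 * (2*a*w11 + 2*b*w22) + s\<^sup>2 * Q1 + t\<^sup>2 * Q2 - (a-b)\<^sup>2 * (4*a\<^sup>2 + 2*a*b + 4*b\<^sup>2)"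
  proof -
    have e1: "2 * H\<^sup>2 * w11 = H * (2*H*H11 + 2*(A+C)\<^sup>2 - 4*P11) - (a-b)\<^sup>2 * H11"
      using sec1 w by algebra
    have e2: "2 * H\<^sup>2 * w22 = H * (2*H*H22 + 2*(B+E)\<^sup>2 - 4*P22) - (a-b)\<^sup>2 * H22"
      using sec2 w by algebra
    have e0: "2 * H\<^sup>2 * w0 = H * (2*H*(V11 + V22) - 4*(b*V11 + a*V22)) - (a-b)\<^sup>2 * (V11 + V22)"
      using time w by algebra
    have "2 * H\<^sup>2 * w0 = 2*a*(2 * H\<^sup>2 * w11) + 2*b*(2 * H\<^sup>2 * w22) + 2*(s\<^sup>2 * Q1 + t\<^sup>2 * Q2 - (a-b)\<^sup>2 * (4*a\<^sup>2 + 2*a*b + 4*b\<^sup>2))"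
      unfolding e0 e1 e2
      unfolding V11_def V22_def P11_def P22_def H11_def H22_def N_def H_def Q1_def Q2_def A B C E
      by algebra
    then show ?thesis by (simp add: algebra_simps)
  qed
  have Q: "4*(x-y)^3*(x+3*y) - 8*(x+y)*(x*(x-y)\<^sup>2 + y*(x+3*y)\<^sup>2) \<le> 0" if "x > 0" "y > 0" for x y :: real
  proof -
    \<comment> \<open>The terms with the factor (x-y)^2 combine because (x-y)(x+3y) - 2x(x+y) =
      -(x^2 + 3y^2).\<close>
    have "4*(x-y)^3*(x+3*y) - 8*(x+y)*(x*(x-y)\<^sup>2 + y*(x+3*y)\<^sup>2)
        = - (4*(x-y)\<^sup>2*(x\<^sup>2+3*y\<^sup>2) + 8*(x+y)*(y*(x+3*y)\<^sup>2))"
      by algebra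
    also have "\<dots> \<le> 0"
      using that unfolding neg_le_0_iff_le by (intro add_nonneg_nonneg mult_nonneg_nonneg) auto
    finally show ?thesis .
  qed
  have "s\<^sup>2 * Q1 \<le> 0" "t\<^sup>2 * Q2 \<le> 0"
    using Q[OF pos] Q[OF pos(2,1)] unfolding Q1_def Q2_def H_def
    by (auto intro!: mult_nonneg_nonpos simp: add.commute)
  moreover have "H\<^sup>2 * (2*a*w11 + 2*b*w22) \<le> 0"
    using max pos by (intro mult_nonneg_nonpos) (auto intro!: add_nonpos_nonpos mult_nonneg_nonpos)
  \<comment> \<open>This term alone makes the inequality strict.\<close>
  moreover have "(a-b)\<^sup>2 * (4*a\<^sup>2 + 2*a*b + 4*b\<^sup>2) > 0"
    using ne pos by (intro mult_pos_pos) (auto intro!: add_pos_pos)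
  ultimately have "H\<^sup>2 * w0 < 0" using key by linarith
  then show ?thesis using H by (simp add: mult_less_0_iff)
qed

section \<open>The equation for the support function\<close>

text \<open>The fields stand for the coordinate derivatives of (t, y1, y2): \<open>\<xi>1\<close>
  and \<open>\<xi>2\<close> differentiate in the slopes, \<open>\<xi>0\<close> in time at a fixed
  normal. Duality and commutation suffice for the calculus, so no change of variables
  appears.\<close>

locale slope_frame =
  fixes U :: "'a::euclidean_space set" and \<xi>0 \<xi>1 \<xi>2 :: "'a \<Rightarrow> 'a" and y1 y2 :: "'a \<Rightarrow> real"
  assumes U: "open U"
    and \<xi>: "Cinf U \<xi>0" "Cinf U \<xi>1" "Cinf U \<xi>2"
    and y: "Cinf U y1" "Cinf U y2"
    and dual: "\<And>z. z \<in> U \<Longrightarrow> Lie \<xi>0 y1 z = 0" "\<And>z. z \<in> U \<Longrightarrow> Lie \<xi>0 y2 z = 0"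
      "\<And>z. z \<in> U \<Longrightarrow> Lie \<xi>1 y1 z = 1" "\<And>z. z \<in> U \<Longrightarrow> Lie \<xi>1 y2 z = 0"
      "\<And>z. z \<in> U \<Longrightarrow> Lie \<xi>2 y1 z = 0" "\<And>z. z \<in> U \<Longrightarrow> Lie \<xi>2 y2 z = 1"
    and comm: "\<And>f z. Cinf U f \<Longrightarrow> z \<in> U \<Longrightarrow> Lie \<xi>0 (Lie \<xi>1 f) z = Lie \<xi>1 (Lie \<xi>0 f) z"
      "\<And>f z. Cinf U f \<Longrightarrow> z \<in> U \<Longrightarrow> Lie \<xi>0 (Lie \<xi>2 f) z = Lie \<xi>2 (Lie \<xi>0 f) z"
      "\<And>f z. Cinf U f \<Longrightarrow> z \<in> U \<Longrightarrow> Lie \<xi>2 (Lie \<xi>1 f) z = Lie \<xi>1 (Lie \<xi>2 f) z"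
begin

text \<open>Length of the normal vector (y1, y2, 1).\<close>

definition \<rho> :: "'a \<Rightarrow> real" where "\<rho> z = sqrt (1 + (y1 z)\<^sup>2 + (y2 z)\<^sup>2)"

text \<open>Sum and product of the principal radii: the Hessian of the 1-homogeneous function
  \<open>u(y, z) = z v(y/z)\<close> restricted to the tangent plane, in terms of the Hessian of \<open>v\<close>.\<close>
definition H :: "('a \<Rightarrow> real) \<Rightarrow> ('a \<Rightarrow> real) \<Rightarrow> ('a \<Rightarrow> real) \<Rightarrow> 'a \<Rightarrow> real" where
  "H V11 V12 V22 z = \<rho> z * (V11 z + V22 z + (y1 z)\<^sup>2 * V11 z + 2 * y1 z * y2 z * V12 z + (y2 z)\<^sup>2 * V22 z)"

definition P :: "('a \<Rightarrow> real) \<Rightarrow> ('a \<Rightarrow> real) \<Rightarrow> ('a \<Rightarrow> real) \<Rightarrow> 'a \<Rightarrow> real" where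
  "P V11 V12 V22 z = (\<rho> z)^4 * (V11 z * V22 z - (V12 z)\<^sup>2)"

lemma \<rho>_pos: "\<rho> z > 0"
  by (simp add: \<rho>_def add_pos_nonneg)

lemma Cinf_\<rho>: "Cinf U \<rho>"
  unfolding \<rho>_def
  by (intro Cinf_sqrt Cinf_add Cinf_power Cinf_const U y) (simp add: add_pos_nonneg)

text \<open>The square 1 + y1^2 + y2^2 is differentiated twice instead of the root.\<close>

lemma jet_\<rho>:
  assumes \<xi>: "Cinf U \<xi>" and c: "\<And>z. z \<in> U \<Longrightarrow> Lie \<xi> y1 z = c1" "\<And>z. z \<in> U \<Longrightarrow> Lie \<xi> y2 z = c2"
    and z: "z \<in> U" "y1 z = 0" "y2 z = 0"
  shows "jet U \<xi> z \<rho> 1 0 (c1\<^sup>2 + c2\<^sup>2)"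
proof -
  note i = U z(1) \<xi>
  note Y = jet_linear_const[OF i y(1) c(1)] jet_linear_const[OF i y(2) c(2)]
  note R = jetI[OF i Cinf_\<rho>]
  have "jet U \<xi> z (\<lambda>z. \<rho> z * \<rho> z) 1 0 (2*(c1\<^sup>2 + c2\<^sup>2))"
  proof (rule jet_cong[OF i])
    show "jet U \<xi> z (\<lambda>z. 1 + y1 z * y1 z + y2 z * y2 z) 1 0 (2*(c1\<^sup>2 + c2\<^sup>2))"
      by (rule jet_eq[OF jet_add[OF i jet_add[OF i jet_const[OF i] jet_mult[OF i Y(1) Y(1)]] jet_mult[OF i Y(2) Y(2)]]])
        (simp_all add: z power2_eq_square)
  qed (simp add: \<rho>_def power2_eq_square)
  from jet_unique[OF jet_mult[OF i R R] this] have "2 * (\<rho> z * Lie \<xi> \<rho> z) = 0"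
    "2 * (\<rho> z * Lie \<xi> (Lie \<xi> \<rho>) z) + 2 * (Lie \<xi> \<rho> z * Lie \<xi> \<rho> z) = 2*(c1\<^sup>2 + c2\<^sup>2)"
    by (simp_all add: algebra_simps)
  moreover have "\<rho> z = 1" using z by (simp add: \<rho>_def)
  ultimately show ?thesis using R by (simp add: jet_def)
qed

text \<open>Where the slopes and \<open>V12\<close> vanish, \<open>V12\<close> survives only through
  the square of its first derivative in the product. The terms with \<open>c1\<close> and
  \<open>c2\<close> come from differentiating \<open>\<rho>\<close> and the slopes; they feed the
  zero-order part of the evolution equation.\<close>

lemma jet_H_P:
  assumes \<xi>: "Cinf U \<xi>" and c: "\<And>z. z \<in> U \<Longrightarrow> Lie \<xi> y1 z = c1" "\<And>z. z \<in> U \<Longrightarrow> Lie \<xi> y2 z = c2"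
    and z: "z \<in> U" "y1 z = 0" "y2 z = 0"
    and V: "jet U \<xi> z V11 a d11 e11" "jet U \<xi> z V12 0 d12 e12" "jet U \<xi> z V22 b d22 e22"
  shows "jet U \<xi> z (H V11 V12 V22) (a + b) (d11 + d22)
      (e11 + e22 + (c1\<^sup>2 + c2\<^sup>2) * (a + b) + 2 * c1\<^sup>2 * a + 2 * c2\<^sup>2 * b)"
    and "jet U \<xi> z (P V11 V12 V22) (a * b) (b * d11 + a * d22)
      (b * e11 + a * e22 + 2 * d11 * d22 - 2 * d12\<^sup>2 + 4 * (c1\<^sup>2 + c2\<^sup>2) * a * b)"
proof -
  note i = U z(1) \<xi>
  note Y = jet_linear_const[OF i y(1) c(1)] jet_linear_const[OF i y(2) c(2)]
  note R = jet_\<rho>[OF \<xi> c z]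
  note m = jet_mult[OF i]
  note k = jet_const[OF i]
  note s = jet_add[OF i]
  have H: "H V11 V12 V22 = (\<lambda>z. \<rho> z * (V11 z + V22 z + y1 z * y1 z * V11 z + 2 * (y1 z * y2 z * V12 z) + y2 z * y2 z * V22 z))"
    by (rule ext) (simp add: H_def power2_eq_square algebra_simps)
  show "jet U \<xi> z (H V11 V12 V22) (a + b) (d11 + d22)
      (e11 + e22 + (c1\<^sup>2 + c2\<^sup>2) * (a + b) + 2 * c1\<^sup>2 * a + 2 * c2\<^sup>2 * b)"
    unfolding H
    by (rule jet_eq[OF m[OF R s[OF s[OF s[OF s[OF V(1) V(3)] m[OF m[OF Y(1) Y(1)] V(1)]]
                m[OF k m[OF m[OF Y(1) Y(2)] V(2)]]] m[OF m[OF Y(2) Y(2)] V(3)]]]])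
      (simp_all add: z power2_eq_square algebra_simps)
  have P: "P V11 V12 V22 = (\<lambda>z. \<rho> z * \<rho> z * (\<rho> z * \<rho> z) * (V11 z * V22 z + (-1) * (V12 z * V12 z)))"
    by (rule ext) (simp add: P_def power2_eq_square power4_eq_xxxx mult_ac)
  show "jet U \<xi> z (P V11 V12 V22) (a * b) (b * d11 + a * d22)
      (b * e11 + a * e22 + 2 * d11 * d22 - 2 * d12\<^sup>2 + 4 * (c1\<^sup>2 + c2\<^sup>2) * a * b)"
    unfolding P
    by (rule jet_eq[OF m[OF m[OF m[OF R R] m[OF R R]] s[OF m[OF V(1) V(3)] m[OF k m[OF V(2) V(2)]]]]])
      (simp_all add: z power2_eq_square algebra_simps)
qed

text \<open>The support function at a vector of length \<open>\<rho>\<close> grows by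
  \<open>\<rho>\<close> times the speed, and the speed a^2 + b^2 is H^2 - 2P. This equation and the
  one for w are differentiated twice in the slopes and handed to
  \<open>pinching_algebra\<close>.\<close>

theorem pinching_derivative_neg:
  assumes v: "Cinf U v" and w: "Cinf U w"
    and V: "V11 = Lie \<xi>1 (Lie \<xi>1 v)" "V12 = Lie \<xi>1 (Lie \<xi>2 v)" "V22 = Lie \<xi>2 (Lie \<xi>2 v)"
    and pde: "\<And>z. z \<in> U \<Longrightarrow> Lie \<xi>0 v z = \<rho> z * ((H V11 V12 V22 z)\<^sup>2 - 2 * P V11 V12 V22 z)"
    and w_eq: "\<And>z. z \<in> U \<Longrightarrow> 2 * w z * H V11 V12 V22 z = (H V11 V12 V22 z)\<^sup>2 - 4 * P V11 V12 V22 z"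
    and z: "z \<in> U" "y1 z = 0" "y2 z = 0" "V12 z = 0"
    and pos: "H V11 V12 V22 z > 0" "P V11 V12 V22 z > 0" "w z \<noteq> 0"
    and crit: "Lie \<xi>1 w z = 0" "Lie \<xi>2 w z = 0"
    and max: "Lie \<xi>1 (Lie \<xi>1 w) z \<le> 0" "Lie \<xi>2 (Lie \<xi>2 w) z \<le> 0"
  shows "Lie \<xi>0 w z < 0"
proof -
  have CL: "Cinf U (Lie \<xi>0 f)" "Cinf U (Lie \<xi>1 f)" "Cinf U (Lie \<xi>2 f)" if "Cinf U f" for f
    using that Cinf_Lie U \<xi> by blast+
  have CV: "Cinf U V11" "Cinf U V12" "Cinf U V22" unfolding V by (intro CL v)+
  define h where "h = H V11 V12 V22"
  define k where "k = P V11 V12 V22"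
  define a where "a = V11 z"
  define b where "b = V22 z"
  define A where "A = Lie \<xi>1 V11 z"
  define B where "B = Lie \<xi>1 V12 z"
  define C where "C = Lie \<xi>2 V12 z"
  define E where "E = Lie \<xi>2 V22 z"
  define p where "p = Lie \<xi>1 (Lie \<xi>1 V11) z"
  define q where "q = Lie \<xi>1 (Lie \<xi>1 V22) z"
  define r where "r = Lie \<xi>2 (Lie \<xi>2 V22) z"
  define H11 where "H11 = p + q + 3*a + b"
  define H22 where "H22 = q + r + a + 3*b"
  define P11 where "P11 = b*p + a*q + 2*A*C - 2*B\<^sup>2 + 4*a*b"
  define P22 where "P22 = b*q + a*r + 2*B*E - 2*C\<^sup>2 + 4*a*b"
  note i1 = U z(1) \<xi>(2)
  note i2 = U z(1) \<xi>(3)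
  \<comment> \<open>Commutation makes the third and fourth derivatives of \<open>v\<close>
    symmetric, so that A, B, C, E, p, q, r name all those that matter.\<close>
  have v12: "Lie \<xi>2 (Lie \<xi>1 v) x = V12 x" if "x \<in> U" for x
    unfolding V by (rule comm(3)[OF v that])
  have B': "Lie \<xi>2 V11 z = B"
    unfolding B_def V(1) comm(3)[OF CL(2)[OF v] z(1)]
    by (rule Lie_cong[OF U v12 z(1)])
  have C': "Lie \<xi>1 V22 z = C"
    unfolding C_def V comm(3)[OF CL(3)[OF v] z(1), symmetric] ..
  have q': "Lie \<xi>2 (Lie \<xi>2 V11) z = q"
  proof -
    have "Lie \<xi>2 (Lie \<xi>2 (Lie \<xi>1 (Lie \<xi>1 v))) z = Lie \<xi>2 (Lie \<xi>1 (Lie \<xi>2 (Lie \<xi>1 v))) z"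
      by (rule Lie_cong[OF U comm(3)[OF CL(2)[OF v]] z(1)])
    also have "\<dots> = Lie \<xi>1 (Lie \<xi>2 (Lie \<xi>2 (Lie \<xi>1 v))) z"
      by (rule comm(3)[OF CL(3)[OF CL(2)[OF v]] z(1)])
    also have "\<dots> = Lie \<xi>1 (Lie \<xi>2 (Lie \<xi>1 (Lie \<xi>2 v))) z"
      by (rule Lie_cong[OF U Lie_cong[OF U comm(3)[OF v]] z(1)])
    also have "\<dots> = Lie \<xi>1 (Lie \<xi>1 (Lie \<xi>2 (Lie \<xi>2 v))) z"
      by (rule Lie_cong[OF U comm(3)[OF CL(3)[OF v]] z(1)])
    finally show ?thesis by (simp add: V q_def)
  qed
  have V1: "jet U \<xi>1 z V11 a A p" "jet U \<xi>1 z V12 0 B (Lie \<xi>1 (Lie \<xi>1 V12) z)" "jet U \<xi>1 z V22 b C q"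
    using CV z by (auto simp: jet_def a_def A_def p_def B_def b_def C' q_def)
  have V2: "jet U \<xi>2 z V11 a B q" "jet U \<xi>2 z V12 0 C (Lie \<xi>2 (Lie \<xi>2 V12) z)" "jet U \<xi>2 z V22 b E r"
    using CV z by (auto simp: jet_def a_def B' q' C_def b_def E_def r_def)
  have HP1: "jet U \<xi>1 z h (a + b) (A + C) H11" "jet U \<xi>1 z k (a * b) (b * A + a * C) P11"
    unfolding h_def k_def
    by (rule jet_eq[OF jet_H_P(1)[OF \<xi>(2) dual(3,4) z(1-3) V1]];
        simp add: H11_def)
      (rule jet_eq[OF jet_H_P(2)[OF \<xi>(2) dual(3,4) z(1-3) V1]];
        simp add: P11_def)
  have HP2: "jet U \<xi>2 z h (a + b) (B + E) H22" "jet U \<xi>2 z k (a * b) (b * B + a * E) P22"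
    unfolding h_def k_def
    by (rule jet_eq[OF jet_H_P(1)[OF \<xi>(3) dual(5,6) z(1-3) V2]];
        simp add: H22_def)
      (rule jet_eq[OF jet_H_P(2)[OF \<xi>(3) dual(5,6) z(1-3) V2]];
        simp add: P22_def)
  define V110 where "V110 = Lie \<xi>0 V11 z"
  define V220 where "V220 = Lie \<xi>0 V22 z"
  have V0: "jet U \<xi>0 z V11 a V110 (Lie \<xi>0 (Lie \<xi>0 V11) z)" "jet U \<xi>0 z V12 0 (Lie \<xi>0 V12 z) (Lie \<xi>0 (Lie \<xi>0 V12) z)"
    "jet U \<xi>0 z V22 b V220 (Lie \<xi>0 (Lie \<xi>0 V22) z)"
    using CV z by (auto simp: jet_def a_def V110_def b_def V220_def)
  note HP0 = jet_H_P[OF \<xi>(1) dual(1,2) z(1-3) V0, folded h_def k_def]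
  \<comment> \<open>Jet of the right-hand side of the equation for \<open>v\<close>. Since
    \<open>\<rho>\<close> has second derivative c1^2 + c2^2 at z, the speed itself reappears as a
    zero-order term.\<close>
  have speed: "jet U \<xi> z (\<lambda>x. \<rho> x * (h x * h x + (-2) * k x)) (a\<^sup>2 + b\<^sup>2) D
      (2*(a+b)*h2 + 2*h1\<^sup>2 - 2*k2 + (c1\<^sup>2 + c2\<^sup>2) * (a\<^sup>2 + b\<^sup>2))"
    if i: "Cinf U \<xi>" and c: "\<And>z. z \<in> U \<Longrightarrow> Lie \<xi> y1 z = c1" "\<And>z. z \<in> U \<Longrightarrow> Lie \<xi> y2 z = c2"
    and j: "jet U \<xi> z h (a + b) h1 h2" "jet U \<xi> z k (a * b) k1 k2"
    and D: "D = 2*(a+b)*h1 - 2*k1" for \<xi> c1 c2 h1 h2 k1 k2 D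
    by (rule jet_eq[OF jet_mult[OF U z(1) i jet_\<rho>[OF i c z(1-3)] jet_add[OF U z(1) i
            jet_mult[OF U z(1) i j(1) j(1)] jet_mult[OF U z(1) i jet_const[OF U z(1) i] j(2)]]]])
      (simp_all add: D power2_eq_square algebra_simps)
  have pde': "Lie \<xi>0 v x = \<rho> x * (h x * h x + (-2) * k x)" if "x \<in> U" for x
    using pde[OF that] by (simp add: h_def k_def power2_eq_square)
  \<comment> \<open>To differentiate the Hessian in time, \<open>\<xi>0\<close> is moved inside both
    slope derivatives, where the equation for \<open>v\<close> applies.\<close>
  have t1: "V110 = 2*(a+b)*H11 + 2*(A+C)\<^sup>2 - 2*P11 + (a\<^sup>2 + b\<^sup>2)"
  proof -
    have "V110 = Lie \<xi>1 (Lie \<xi>0 (Lie \<xi>1 v)) z"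
      unfolding V110_def V by (rule comm(1)[OF CL(2)[OF v] z(1)])
    also have "\<dots> = Lie \<xi>1 (Lie \<xi>1 (Lie \<xi>0 v)) z"
      by (rule Lie_cong[OF U comm(1)[OF v] z(1)])
    also have "\<dots> = 2*(a+b)*H11 + 2*(A+C)\<^sup>2 - 2*P11 + (1\<^sup>2 + 0\<^sup>2) * (a\<^sup>2 + b\<^sup>2)"
      using jet_cong[OF i1 speed[OF \<xi>(2) dual(3,4) HP1 refl] pde'] by (simp add: jet_def)
    finally show ?thesis by simp
  qed
  have t2: "V220 = 2*(a+b)*H22 + 2*(B+E)\<^sup>2 - 2*P22 + (a\<^sup>2 + b\<^sup>2)"
  proof -
    have "V220 = Lie \<xi>2 (Lie \<xi>0 (Lie \<xi>2 v)) z"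
      unfolding V220_def V by (rule comm(2)[OF CL(3)[OF v] z(1)])
    also have "\<dots> = Lie \<xi>2 (Lie \<xi>2 (Lie \<xi>0 v)) z"
      by (rule Lie_cong[OF U comm(2)[OF v] z(1)])
    also have "\<dots> = 2*(a+b)*H22 + 2*(B+E)\<^sup>2 - 2*P22 + (0\<^sup>2 + 1\<^sup>2) * (a\<^sup>2 + b\<^sup>2)"
      using jet_cong[OF i2 speed[OF \<xi>(3) dual(5,6) HP2 refl] pde'] by (simp add: jet_def)
    finally show ?thesis by simp
  qed
  have w_eq': "2 * (w x * h x) = h x * h x + (-4) * k x" if "x \<in> U" for x
    using w_eq[OF that] by (simp add: h_def k_def power2_eq_square)
  have wjet: "2 * (w z * (a+b)) = (a - b)\<^sup>2 \<and>
      2 * (w z * h1 + Lie \<xi> w z * (a+b)) = 2*(a+b)*h1 - 4*k1 \<and>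
      2 * (w z * h2 + 2 * (Lie \<xi> w z * h1) + Lie \<xi> (Lie \<xi> w) z * (a+b)) = 2*(a+b)*h2 + 2*h1\<^sup>2 - 4*k2"
    if i: "Cinf U \<xi>" and j: "jet U \<xi> z h (a + b) h1 h2" "jet U \<xi> z k (a * b) k1 k2" for \<xi> h1 h2 k1 k2
    using jet_unique[OF jet_mult[OF U z(1) i jet_const[OF U z(1) i, of 2]
          jet_mult[OF U z(1) i jetI[OF U z(1) i w] j(1)]]
        jet_cong[OF U z(1) i jet_add[OF U z(1) i jet_mult[OF U z(1) i j(1) j(1)]
          jet_mult[OF U z(1) i jet_const[OF U z(1) i, of "-4"] j(2)]] w_eq']]
    by (simp add: power2_eq_square algebra_simps)
  note w1 = wjet[OF \<xi>(2) HP1] and w2 = wjet[OF \<xi>(3) HP2] and w0 = wjet[OF \<xi>(1) HP0]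
  have ab: "a + b > 0" "a * b > 0"
    using pos HP1 by (auto simp: h_def k_def jet_def)
  then have "a > 0" "b > 0" by (auto simp: zero_less_mult_iff)
  \<comment> \<open>At a = b the identity 2wH = (a - b)^2 would force w to vanish.\<close>
  moreover have "a \<noteq> b" using w1 ab pos(3) by auto
  ultimately show ?thesis
  proof (rule pinching_algebra[where A=A and B=B and C=C and E=E and p=p and q=q and r=r and w="w z"
        and ?w11.0="Lie \<xi>1 (Lie \<xi>1 w) z" and ?w22.0="Lie \<xi>2 (Lie \<xi>2 w) z"])
    show "Lie \<xi>1 (Lie \<xi>1 w) z \<le> 0" "Lie \<xi>2 (Lie \<xi>2 w) z \<le> 0" by (fact max)+
  qed (use w1 w2 w0 in \<open>simp_all add: crit t1 t2 H11_def H22_def P11_def P22_def algebra_simps\<close>)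
qed

end

section \<open>Slopes of the normal as coordinates\<close>

type_synonym spacetime = "real \<times> real \<times> real"

abbreviation e0 :: spacetime where "e0 \<equiv> (1, 0, 0)"
abbreviation e1 :: spacetime where "e1 \<equiv> (0, 1, 0)"
abbreviation e2 :: spacetime where "e2 \<equiv> (0, 0, 1)"

lemma pd_coords:
  assumes "f differentiable (at (z :: spacetime))"
  shows "pd (a, b, c) f z = a *\<^sub>R pd e0 f z + b *\<^sub>R pd e1 f z + c *\<^sub>R pd e2 f z"
proof -
  have "(a, b, c) = a *\<^sub>R e0 + b *\<^sub>R e1 + c *\<^sub>R e2" by simp
  then show ?thesis
    by (simp only: pd_dir_add[OF assms] pd_dir_scale[OF assms])
qed

lemma second_derivative_local_max:
  fixes f :: "'a::real_normed_vector \<Rightarrow> real"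
  assumes f: "Cinf U f" and U: "open U" "z \<in> U"
    and max: "\<And>s. z + s *\<^sub>R c \<in> U \<Longrightarrow> f (z + s *\<^sub>R c) \<le> f z"
  shows "pd c f z = 0" "pd c (pd c f) z \<le> 0"
proof -
  define g where "g s = f (z + s *\<^sub>R c)" for s :: real
  define g' where "g' s = pd c f (z + s *\<^sub>R c)" for s :: real
  have "((\<lambda>s. z + s *\<^sub>R c) \<longlongrightarrow> z + 0 *\<^sub>R c) (at 0)"
    by (intro tendsto_intros)
  then have "\<forall>\<^sub>F s in at 0. z + s *\<^sub>R c \<in> U"
    using topological_tendstoD[OF _ U(1)] U(2) by force
  then obtain d where d: "d > 0" "\<And>s. \<bar>s\<bar> < d \<Longrightarrow> z + s *\<^sub>R c \<in> U"
    using U(2) unfolding eventually_at dist_real_def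
    by (metis UNIV_I diff_zero pth_4(1) scaleR_zero_left add.right_neutral)
  have D: "DERIV g s :> g' s" if "\<bar>s\<bar> < d" for s
    unfolding g_def g'_def has_real_derivative_iff_has_vector_derivative
    by (intro has_vector_derivative_line Cinf_differentiable[OF f] d(2) that)
  have D': "DERIV g' 0 :> pd c (pd c f) z"
    using has_vector_derivative_line[OF Cinf_differentiable[OF Cinf_pd[OF f]], of z 0 c c UNIV] U(2)
    unfolding g'_def has_real_derivative_iff_has_vector_derivative by simp
  have le: "g s \<le> g 0" if "\<bar>s\<bar> < d" for s
    using max[OF d(2)[OF that]] by (simp add: g_def)
  have "g' 0 = 0"
    by (rule DERIV_local_max[OF D d(1)]) (use le d(1) in auto)
  then show "pd c f z = 0" by (simp add: g'_def)
  show "pd c (pd c f) z \<le> 0"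
  proof (rule ccontr)
    assume "\<not> ?thesis"
    \<comment> \<open>A positive second derivative makes the first one positive just to the right of
      0, so the function would rise above its maximum.\<close>
    then obtain r where r: "r > 0" "\<And>h. 0 < h \<Longrightarrow> h < r \<Longrightarrow> g' 0 < g' h"
      using DERIV_pos_inc_right[OF D'] by force
    define h where "h = min r d / 2"
    have h: "0 < h" "h < r" "h < d" using r d by (auto simp: h_def min_def)
    obtain x where "0 < x" "x < h" "g h - g 0 = (h - 0) * g' x"
      using MVT2[of 0 h g g'] D h by fastforce
    moreover have "g' x > 0" if "0 < x" "x < h" for x
      using r(2)[of x] that h \<open>g' 0 = 0\<close> by simp
    ultimately have "g h > g 0" using h by (metis diff_gt_0_iff_gt diff_zero mult_pos_pos)
    with le[of h] h show False by simp
  qed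
qed

text \<open>Functions \<open>y1, y2\<close> with nonvanishing spatial Jacobian serve as spatial coordinates; the
  coordinate vector fields are given by Cramer's rule, and \<open>\<xi>0\<close> is the time derivative at fixed
  \<open>y\<close>.  They commute because of the chain rule and the symmetry of second derivatives, so no inverse
  function theorem is needed.\<close>
locale slope_coords =
  fixes U :: "spacetime set" and y1 y2 :: "spacetime \<Rightarrow> real"
  assumes U: "open U" and y: "Cinf U y1" "Cinf U y2"
    and J: "\<And>z. z \<in> U \<Longrightarrow> pd e1 y1 z * pd e2 y2 z - pd e2 y1 z * pd e1 y2 z \<noteq> 0"
begin

definition jac :: "spacetime \<Rightarrow> real" where
  "jac z = pd e1 y1 z * pd e2 y2 z - pd e2 y1 z * pd e1 y2 z"

definition \<xi>1 :: "spacetime \<Rightarrow> spacetime" where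
  "\<xi>1 z = (0, pd e2 y2 z / jac z, - pd e1 y2 z / jac z)"

definition \<xi>2 :: "spacetime \<Rightarrow> spacetime" where
  "\<xi>2 z = (0, - pd e2 y1 z / jac z, pd e1 y1 z / jac z)"

definition \<xi>0 :: "spacetime \<Rightarrow> spacetime" where
  "\<xi>0 z = e0 + (- pd e0 y1 z) *\<^sub>R \<xi>1 z + (- pd e0 y2 z) *\<^sub>R \<xi>2 z"

lemma jac_nz: "z \<in> U \<Longrightarrow> jac z \<noteq> 0"
  using J by (simp add: jac_def)

lemma Cinf_\<xi>: "Cinf U \<xi>0" "Cinf U \<xi>1" "Cinf U \<xi>2"
proof -
  have j: "Cinf U jac" unfolding jac_def by (intro Cinf_diff Cinf_mult U Cinf_pd y)
  note p = y[THEN Cinf_pd]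
  note d = Cinf_divide[OF U _ j jac_nz]
  show 1: "Cinf U \<xi>1" unfolding \<xi>1_def
    by (rule Cinf_Pair[OF U Cinf_const[OF U] Cinf_Pair[OF U d[OF p(2)] d[OF Cinf_minus[OF U p(2)]]]])
  show 2: "Cinf U \<xi>2" unfolding \<xi>2_def
    by (rule Cinf_Pair[OF U Cinf_const[OF U] Cinf_Pair[OF U d[OF Cinf_minus[OF U p(1)]] d[OF p(1)]]])
  show "Cinf U \<xi>0" unfolding \<xi>0_def
    by (rule Cinf_add[OF U Cinf_add[OF U Cinf_const[OF U] Cinf_scaleR[OF U Cinf_minus[OF U p(1)] 1]]
          Cinf_scaleR[OF U Cinf_minus[OF U p(2)] 2]])
qed

context
  fixes f :: "spacetime \<Rightarrow> real" and z :: spacetime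
  assumes f: "Cinf U f" and z: "z \<in> U"
begin

lemma Lie_coords:
  shows Lie1: "Lie \<xi>1 f z = (pd e1 f z * pd e2 y2 z - pd e2 f z * pd e1 y2 z) / jac z"
    and Lie2: "Lie \<xi>2 f z = (pd e2 f z * pd e1 y1 z - pd e1 f z * pd e2 y1 z) / jac z"
    and Lie0: "Lie \<xi>0 f z = pd e0 f z - pd e0 y1 z * Lie \<xi>1 f z - pd e0 y2 z * Lie \<xi>2 f z"
proof -
  note d = Cinf_differentiable[OF f z]
  show "Lie \<xi>1 f z = (pd e1 f z * pd e2 y2 z - pd e2 f z * pd e1 y2 z) / jac z"
    "Lie \<xi>2 f z = (pd e2 f z * pd e1 y1 z - pd e1 f z * pd e2 y1 z) / jac z"
    using pd_coords[OF d, of 0 "pd e2 y2 z / jac z" "- pd e1 y2 z / jac z"]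
      pd_coords[OF d, of 0 "- pd e2 y1 z / jac z" "pd e1 y1 z / jac z"]
    unfolding Lie_def \<xi>1_def \<xi>2_def by (simp_all add: diff_divide_distrib mult.commute)
  show "Lie \<xi>0 f z = pd e0 f z - pd e0 y1 z * Lie \<xi>1 f z - pd e0 y2 z * Lie \<xi>2 f z"
    unfolding Lie_def \<xi>0_def pd_dir_add[OF d] pd_dir_scale[OF d] by simp
qed

text \<open>Cramer's formulas solved back for the original derivatives; in this form the symmetry of
  second derivatives can be exploited.\<close>

lemma chain:
  shows chain1: "pd e1 f z = Lie \<xi>1 f z * pd e1 y1 z + Lie \<xi>2 f z * pd e1 y2 z"
    and chain2: "pd e2 f z = Lie \<xi>1 f z * pd e2 y1 z + Lie \<xi>2 f z * pd e2 y2 z"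
    and chain0: "pd e0 f z = Lie \<xi>0 f z + Lie \<xi>1 f z * pd e0 y1 z + Lie \<xi>2 f z * pd e0 y2 z"
proof -
  have L: "Lie \<xi>1 f z * jac z = pd e1 f z * pd e2 y2 z - pd e2 f z * pd e1 y2 z"
    "Lie \<xi>2 f z * jac z = pd e2 f z * pd e1 y1 z - pd e1 f z * pd e2 y1 z"
    using jac_nz[OF z] by (simp_all add: Lie1 Lie2)
  have "jac z * pd e1 f z = jac z * (Lie \<xi>1 f z * pd e1 y1 z + Lie \<xi>2 f z * pd e1 y2 z)"
    "jac z * pd e2 f z = jac z * (Lie \<xi>1 f z * pd e2 y1 z + Lie \<xi>2 f z * pd e2 y2 z)"
    using L unfolding jac_def by algebra+
  then show "pd e1 f z = Lie \<xi>1 f z * pd e1 y1 z + Lie \<xi>2 f z * pd e1 y2 z"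
    "pd e2 f z = Lie \<xi>1 f z * pd e2 y1 z + Lie \<xi>2 f z * pd e2 y2 z"
    using jac_nz[OF z] by simp_all
  show "pd e0 f z = Lie \<xi>0 f z + Lie \<xi>1 f z * pd e0 y1 z + Lie \<xi>2 f z * pd e0 y2 z"
    by (simp add: Lie0 algebra_simps)
qed

end

text \<open>Symmetry of the second derivatives of f, y1 and y2 gives one relation per pair of
  directions. Expanded by the chain rule, these are homogeneous linear equations for the
  commutators, with determinant \<open>jac\<close>.\<close>

lemma Lie_commute:
  fixes f :: "spacetime \<Rightarrow> real"
  assumes f: "Cinf U f" and z: "z \<in> U"
  shows "Lie \<xi>0 (Lie \<xi>1 f) z = Lie \<xi>1 (Lie \<xi>0 f) z" (is ?A)
    "Lie \<xi>0 (Lie \<xi>2 f) z = Lie \<xi>2 (Lie \<xi>0 f) z" (is ?B)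
    "Lie \<xi>2 (Lie \<xi>1 f) z = Lie \<xi>1 (Lie \<xi>2 f) z" (is ?C)
proof -
  define F0 where "F0 = Lie \<xi>0 f"
  define F1 where "F1 = Lie \<xi>1 f"
  define F2 where "F2 = Lie \<xi>2 f"
  have F: "Cinf U F0" "Cinf U F1" "Cinf U F2"
    unfolding F0_def F1_def F2_def by (intro Cinf_Lie U f Cinf_\<xi>)+
  note dF = F[THEN Cinf_differentiable, OF z]
  note dy = Cinf_differentiable[OF Cinf_pd[OF y(1)] z] Cinf_differentiable[OF Cinf_pd[OF y(2)] z]
  note sym = pd_commute[OF U z]
  have prod: "pd e (\<lambda>x. F1 x * pd k y1 x + F2 x * pd k y2 x) z
      = F1 z * pd e (pd k y1) z + pd e F1 z * pd k y1 z + F2 z * pd e (pd k y2) z + pd e F2 z * pd k y2 z" for e k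
    by (simp add: pd_add pd_mult dF dy differentiable_mult)
  have f1: "pd e (pd e1 f) z = pd e (\<lambda>x. F1 x * pd e1 y1 x + F2 x * pd e1 y2 x) z" for e
    by (rule pd_cong_open[OF U _ z]) (simp add: F1_def F2_def chain1[OF f])
  have f2: "pd e (pd e2 f) z = pd e (\<lambda>x. F1 x * pd e2 y1 x + F2 x * pd e2 y2 x) z" for e
    by (rule pd_cong_open[OF U _ z]) (simp add: F1_def F2_def chain2[OF f])
  have f0: "pd e (pd e0 f) z = pd e F0 z + pd e (\<lambda>x. F1 x * pd e0 y1 x + F2 x * pd e0 y2 x) z" for e
  proof -
    have "pd e (pd e0 f) z = pd e (\<lambda>x. F0 x + (F1 x * pd e0 y1 x + F2 x * pd e0 y2 x)) z"
      by (rule pd_cong_open[OF U _ z]) (simp add: F0_def F1_def F2_def chain0[OF f])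
    then show ?thesis by (simp add: pd_add dF dy differentiable_mult differentiable_add)
  qed
  have s12: "pd e2 F1 z * pd e1 y1 z + pd e2 F2 z * pd e1 y2 z = pd e1 F1 z * pd e2 y1 z + pd e1 F2 z * pd e2 y2 z"
    using sym[OF f, of e2 e1] sym[OF y(1), of e2 e1] sym[OF y(2), of e2 e1] unfolding f1 f2 prod by simp
  have s01: "pd e1 F0 z + pd e1 F1 z * pd e0 y1 z + pd e1 F2 z * pd e0 y2 z = pd e0 F1 z * pd e1 y1 z + pd e0 F2 z * pd e1 y2 z"
    using sym[OF f, of e1 e0] sym[OF y(1), of e1 e0] sym[OF y(2), of e1 e0] unfolding f1 f0 prod by simp
  have s02: "pd e2 F0 z + pd e2 F1 z * pd e0 y1 z + pd e2 F2 z * pd e0 y2 z = pd e0 F1 z * pd e2 y1 z + pd e0 F2 z * pd e2 y2 z"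
    using sym[OF f, of e2 e0] sym[OF y(1), of e2 e0] sym[OF y(2), of e2 e0] unfolding f2 f0 prod by simp
  note c = chain1[OF F(1) z] chain1[OF F(2) z] chain1[OF F(3) z] chain2[OF F(1) z] chain2[OF F(2) z] chain2[OF F(3) z]
    chain0[OF F(1) z] chain0[OF F(2) z] chain0[OF F(3) z]
  have "jac z * (Lie \<xi>2 F1 z - Lie \<xi>1 F2 z) = 0"
    using s12 unfolding c jac_def by algebra
  then have C: "Lie \<xi>2 F1 z = Lie \<xi>1 F2 z" using jac_nz[OF z] by simp
  then show ?C by (simp add: F1_def F2_def)
  have k1: "pd e1 y1 z * (Lie \<xi>1 F0 z - Lie \<xi>0 F1 z) + pd e1 y2 z * (Lie \<xi>2 F0 z - Lie \<xi>0 F2 z) = 0"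
    using s01 unfolding c C by algebra
  have k2: "pd e2 y1 z * (Lie \<xi>1 F0 z - Lie \<xi>0 F1 z) + pd e2 y2 z * (Lie \<xi>2 F0 z - Lie \<xi>0 F2 z) = 0"
    using s02 unfolding c C by algebra
  have "jac z * (Lie \<xi>1 F0 z - Lie \<xi>0 F1 z) = 0" "jac z * (Lie \<xi>2 F0 z - Lie \<xi>0 F2 z) = 0"
    using k1 k2 unfolding jac_def by algebra+
  then show ?A ?B using jac_nz[OF z] by (simp_all add: F0_def F1_def F2_def)
qed

sublocale slope_frame U \<xi>0 \<xi>1 \<xi>2 y1 y2
proof
  fix z assume z: "z \<in> U"
  have j: "jac z \<noteq> 0" by (rule jac_nz[OF z])
  show d: "Lie \<xi>1 y1 z = 1" "Lie \<xi>1 y2 z = 0" "Lie \<xi>2 y1 z = 0" "Lie \<xi>2 y2 z = 1"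
    using j unfolding Lie1[OF y(1) z] Lie1[OF y(2) z] Lie2[OF y(1) z] Lie2[OF y(2) z]
    by (simp_all add: jac_def mult.commute)
  show "Lie \<xi>0 y1 z = 0" "Lie \<xi>0 y2 z = 0"
    unfolding Lie0[OF y(1) z] Lie0[OF y(2) z] d by simp_all
qed (use U y Cinf_\<xi> Lie_commute in auto)

text \<open>Derivatives of the coefficients of \<open>\<xi>\<close> are multiplied by first spatial
  derivatives of w, which vanish at z. Thus the second derivative test along straight lines also
  bounds iterated frame derivatives.\<close>

lemma Lie2_at_critical:
  fixes w :: "spacetime \<Rightarrow> real"
  assumes w: "Cinf U w" and z: "z \<in> U" and crit: "\<And>a b. pd (0, a, b) w z = 0"
    and \<xi>: "Cinf U \<xi>" "\<And>x. fst (\<xi> x) = 0"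
  shows "Lie \<xi> (Lie \<xi> w) z = pd (\<xi> z) (pd (\<xi> z) w) z"
proof -
  define a where "a x = fst (snd (\<xi> x))" for x
  define b where "b x = snd (snd (\<xi> x))" for x
  have ab: "\<xi> x = (0, a x, b x)" for x using \<xi>(2)[of x] by (simp add: a_def b_def prod_eq_iff)
  have Cab: "Cinf U a" "Cinf U b" unfolding a_def b_def by (intro Cinf_fst Cinf_snd U \<xi>)+
  note D = Cab[THEN Cinf_differentiable, OF z] Cinf_differentiable[OF Cinf_pd[OF w] z]
  have spatial: "pd (\<xi> x') w x = a x' * pd e1 w x + b x' * pd e2 w x" if "x \<in> U" for x x'
    using pd_coords[OF Cinf_differentiable[OF w that(1)], of 0 "a x'" "b x'"] ab[of x'] by simp
  have "Lie \<xi> (Lie \<xi> w) z = pd (\<xi> z) (\<lambda>x. a x * pd e1 w x + b x * pd e2 w x) z"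
    unfolding Lie_def
    by (rule pd_cong_open[OF U _ z]) (simp add: spatial)
  also have "\<dots> = a z * pd (\<xi> z) (pd e1 w) z + b z * pd (\<xi> z) (pd e2 w) z"
    by (simp add: pd_add pd_mult D differentiable_mult crit)
  also have "\<dots> = pd (\<xi> z) (\<lambda>x. a z * pd e1 w x + b z * pd e2 w x) z"
    by (simp add: pd_add pd_mult D differentiable_mult pd_const)
  also have "\<dots> = pd (\<xi> z) (pd (\<xi> z) w) z"
    by (rule pd_cong_open[OF U _ z]) (simp add: spatial)
  finally show ?thesis .
qed

end

text \<open>The a and b are the chart derivatives of y1 and y2; the x, u, t are those of the three
  position components, tied to the slopes by the Hessian of \<open>v\<close> and by orthogonality to
  (y1, y2, 1). The h form the second fundamental form times the length of that vector, the g the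
  first.\<close>

lemma fundamental_forms_trace:
  fixes a1 a2 b1 b2 V11 V12 V22 y1 y2 :: real
  defines "x1 \<equiv> V11*a1 + V12*b1" and "x2 \<equiv> V11*a2 + V12*b2"
    and "u1 \<equiv> V12*a1 + V22*b1" and "u2 \<equiv> V12*a2 + V22*b2"
  defines "t1 \<equiv> - (y1*x1 + y2*u1)" and "t2 \<equiv> - (y1*x2 + y2*u2)"
  defines "h11 \<equiv> x1*a1 + u1*b1" and "h12 \<equiv> x1*a2 + u1*b2" and "h22 \<equiv> x2*a2 + u2*b2"
  defines "g11 \<equiv> x1*x1 + u1*u1 + t1*t1" and "g12 \<equiv> x1*x2 + u1*u2 + t1*t2" and "g22 \<equiv> x2*x2 + u2*u2 + t2*t2"
  shows "h11*h22 - h12*h12 = (a1*b2 - a2*b1)\<^sup>2 * (V11*V22 - V12\<^sup>2)"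
    and "g11*g22 - g12*g12 = (1 + y1\<^sup>2 + y2\<^sup>2) * (a1*b2 - a2*b1)\<^sup>2 * (V11*V22 - V12\<^sup>2)\<^sup>2"
    and "h11*g22 - 2*h12*g12 + h22*g11
      = (a1*b2 - a2*b1)\<^sup>2 * (V11*V22 - V12\<^sup>2) * (V11 + V22 + y1\<^sup>2*V11 + 2*y1*y2*V12 + y2\<^sup>2*V22)"
proof -
  have D: "x1*u2 - x2*u1 = (a1*b2 - a2*b1) * (V11*V22 - V12\<^sup>2)"
    unfolding x1_def x2_def u1_def u2_def by algebra
  \<comment> \<open>The symmetry of h is not visible in its definition; it comes from the symmetric
    Hessian.\<close>
  have sym: "h12 = x2*a1 + u2*b1"
    unfolding h12_def x1_def x2_def u1_def u2_def by algebra
  have "h11*h22 - h12*(x2*a1 + u2*b1) = (x1*u2 - x2*u1) * (a1*b2 - a2*b1)"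
    unfolding h11_def h22_def h12_def by algebra
  then show "h11*h22 - h12*h12 = (a1*b2 - a2*b1)\<^sup>2 * (V11*V22 - V12\<^sup>2)"
    using D sym by algebra
  have "g11*g22 - g12*g12 = (1 + y1\<^sup>2 + y2\<^sup>2) * (x1*u2 - x2*u1)\<^sup>2"
    unfolding g11_def g22_def g12_def t1_def t2_def by algebra
  then show "g11*g22 - g12*g12 = (1 + y1\<^sup>2 + y2\<^sup>2) * (a1*b2 - a2*b1)\<^sup>2 * (V11*V22 - V12\<^sup>2)\<^sup>2"
    using D by algebra
  have "h11*g22 - h12*g12 - (x2*a1 + u2*b1)*g12 + h22*g11
      = (x1*u2 - x2*u1) * (a1*u2 - a2*u1 + (x1*b2 - x2*b1) + y1 * (y1*(x1*b2 - x2*b1) + y2*(a1*x2 - a2*x1))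
        + y2 * (y2*(a1*u2 - a2*u1) + y1*(u1*b2 - u2*b1)))"
    unfolding h11_def h12_def h22_def g11_def g12_def g22_def t1_def t2_def by algebra
  moreover have "a1*u2 - a2*u1 = (a1*b2 - a2*b1) * V22" "x1*b2 - x2*b1 = (a1*b2 - a2*b1) * V11"
    "a1*x2 - a2*x1 = (a1*b2 - a2*b1) * V12" "u1*b2 - u2*b1 = (a1*b2 - a2*b1) * V12"
    unfolding x1_def x2_def u1_def u2_def by algebra+
  ultimately show "h11*g22 - 2*h12*g12 + h22*g11
      = (a1*b2 - a2*b1)\<^sup>2 * (V11*V22 - V12\<^sup>2) * (V11 + V22 + y1\<^sup>2*V11 + 2*y1*y2*V12 + y2\<^sup>2*V22)"
    using D sym by algebra
qed

text \<open>The \<open>\<zeta>\<close> are position components in a fixed orthonormal frame, and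
  \<open>normal\<close> says that (y1, y2, 1) is orthogonal to the surface.\<close>

locale graph_flow = slope_coords +
  fixes \<zeta>1 \<zeta>2 \<zeta>3 :: "spacetime \<Rightarrow> real"
  assumes \<zeta>: "Cinf U \<zeta>1" "Cinf U \<zeta>2" "Cinf U \<zeta>3"
    and normal: "\<And>z. z \<in> U \<Longrightarrow> pd e1 \<zeta>1 z * y1 z + pd e1 \<zeta>2 z * y2 z + pd e1 \<zeta>3 z = 0"
      "\<And>z. z \<in> U \<Longrightarrow> pd e2 \<zeta>1 z * y1 z + pd e2 \<zeta>2 z * y2 z + pd e2 \<zeta>3 z = 0"
begin

definition first_form :: "spacetime \<Rightarrow> spacetime \<Rightarrow> spacetime \<Rightarrow> real" where
  "first_form a b z = pd a \<zeta>1 z * pd b \<zeta>1 z + pd a \<zeta>2 z * pd b \<zeta>2 z + pd a \<zeta>3 z * pd b \<zeta>3 z"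

text \<open>Position derivative paired with the derivative of (y1, y2, 1)/\<open>\<rho>\<close>:
  differentiating 1/\<open>\<rho>\<close> contributes a normal vector, which is orthogonal to the
  position derivative, and the third entry is constant.\<close>

definition second_form :: "spacetime \<Rightarrow> spacetime \<Rightarrow> spacetime \<Rightarrow> real" where
  "second_form a b z = (pd a \<zeta>1 z * pd b y1 z + pd a \<zeta>2 z * pd b y2 z) / \<rho> z"

definition det_second :: "spacetime \<Rightarrow> real" where
  "det_second z = second_form e1 e1 z * second_form e2 e2 z - second_form e1 e2 z * second_form e1 e2 z"

text \<open>The principal radii are the eigenvalues of the first form relative to the second; this
  is their trace, and \<open>radii_prod\<close> is the determinant.\<close>

definition radii_sum :: "spacetime \<Rightarrow> real" where
  "radii_sum z = (second_form e1 e1 z * first_form e2 e2 z - 2 * second_form e1 e2 z * first_form e1 e2 z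
      + second_form e2 e2 z * first_form e1 e1 z) / det_second z"

definition radii_prod :: "spacetime \<Rightarrow> real" where
  "radii_prod z = (first_form e1 e1 z * first_form e2 e2 z - first_form e1 e2 z * first_form e1 e2 z) / det_second z"

text \<open>The support function evaluated at the unnormalised normal \<open>(y1, y2, 1)\<close>.\<close>
definition v :: "spacetime \<Rightarrow> real" where "v z = \<zeta>1 z * y1 z + \<zeta>2 z * y2 z + \<zeta>3 z"

lemma Cinf_v: "Cinf U v"
  unfolding v_def by (intro Cinf_add Cinf_mult U \<zeta> y)

text \<open>The position is the gradient of the support function, since derivatives of the position
  along the surface are orthogonal to the normal. For the same reason the time derivative at fixed
  slopes sees only the motion of the point.\<close>

lemma Lie_v:
  assumes z: "z \<in> U"
  shows Lie1_v: "Lie \<xi>1 v z = \<zeta>1 z" and Lie2_v: "Lie \<xi>2 v z = \<zeta>2 z"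
    and Lie0_v: "Lie \<xi>0 v z = pd e0 \<zeta>1 z * y1 z + pd e0 \<zeta>2 z * y2 z + pd e0 \<zeta>3 z"
proof -
  have L: "Lie \<xi> v z = Lie \<xi> \<zeta>1 z * y1 z + Lie \<xi> \<zeta>2 z * y2 z + Lie \<xi> \<zeta>3 z
      + \<zeta>1 z * Lie \<xi> y1 z + \<zeta>2 z * Lie \<xi> y2 z" for \<xi>
    unfolding v_def Lie_def
    by (simp add: pd_add pd_mult Cinf_differentiable[OF _ z] \<zeta> y differentiable_mult differentiable_add)
  have n1: "Lie \<xi>1 \<zeta>1 z * y1 z + Lie \<xi>1 \<zeta>2 z * y2 z + Lie \<xi>1 \<zeta>3 z = 0"
  proof -
    have "jac z * (Lie \<xi>1 \<zeta>1 z * y1 z + Lie \<xi>1 \<zeta>2 z * y2 z + Lie \<xi>1 \<zeta>3 z)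
      = pd e2 y2 z * (pd e1 \<zeta>1 z * y1 z + pd e1 \<zeta>2 z * y2 z + pd e1 \<zeta>3 z)
        - pd e1 y2 z * (pd e2 \<zeta>1 z * y1 z + pd e2 \<zeta>2 z * y2 z + pd e2 \<zeta>3 z)"
      using jac_nz[OF z] by (simp add: Lie1[OF _ z] \<zeta> field_simps)
    then show ?thesis using normal[OF z] jac_nz[OF z] by simp
  qed
  have n2: "Lie \<xi>2 \<zeta>1 z * y1 z + Lie \<xi>2 \<zeta>2 z * y2 z + Lie \<xi>2 \<zeta>3 z = 0"
  proof -
    have "jac z * (Lie \<xi>2 \<zeta>1 z * y1 z + Lie \<xi>2 \<zeta>2 z * y2 z + Lie \<xi>2 \<zeta>3 z)
      = pd e1 y1 z * (pd e2 \<zeta>1 z * y1 z + pd e2 \<zeta>2 z * y2 z + pd e2 \<zeta>3 z)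
        - pd e2 y1 z * (pd e1 \<zeta>1 z * y1 z + pd e1 \<zeta>2 z * y2 z + pd e1 \<zeta>3 z)"
      using jac_nz[OF z] by (simp add: Lie2[OF _ z] \<zeta> field_simps)
    then show ?thesis using normal[OF z] jac_nz[OF z] by simp
  qed
  show "Lie \<xi>1 v z = \<zeta>1 z" "Lie \<xi>2 v z = \<zeta>2 z"
    using L[of \<xi>1] L[of \<xi>2] n1 n2 dual[OF z] by simp_all
  have "Lie \<xi>0 v z = (pd e0 \<zeta>1 z * y1 z + pd e0 \<zeta>2 z * y2 z + pd e0 \<zeta>3 z)
     - pd e0 y1 z * (Lie \<xi>1 \<zeta>1 z * y1 z + Lie \<xi>1 \<zeta>2 z * y2 z + Lie \<xi>1 \<zeta>3 z)
     - pd e0 y2 z * (Lie \<xi>2 \<zeta>1 z * y1 z + Lie \<xi>2 \<zeta>2 z * y2 z + Lie \<xi>2 \<zeta>3 z)"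
    unfolding L using dual[OF z] by (simp add: Lie0[OF _ z] \<zeta> algebra_simps)
  then show "Lie \<xi>0 v z = pd e0 \<zeta>1 z * y1 z + pd e0 \<zeta>2 z * y2 z + pd e0 \<zeta>3 z"
    using n1 n2 by simp
qed

definition "V11 = Lie \<xi>1 (Lie \<xi>1 v)"
definition "V12 = Lie \<xi>1 (Lie \<xi>2 v)"
definition "V22 = Lie \<xi>2 (Lie \<xi>2 v)"

lemma V_eq:
  assumes z: "z \<in> U"
  shows "Lie \<xi>1 \<zeta>1 z = V11 z" "Lie \<xi>1 \<zeta>2 z = V12 z" "Lie \<xi>2 \<zeta>1 z = V12 z" "Lie \<xi>2 \<zeta>2 z = V22 z"
proof -
  show "Lie \<xi>1 \<zeta>1 z = V11 z" "Lie \<xi>1 \<zeta>2 z = V12 z" "Lie \<xi>2 \<zeta>2 z = V22 z"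
    unfolding V11_def V12_def V22_def by (rule Lie_cong[OF U _ z]; simp add: Lie_v)+
  have "Lie \<xi>2 \<zeta>1 z = Lie \<xi>2 (Lie \<xi>1 v) z"
    by (rule Lie_cong[OF U _ z]) (simp add: Lie_v)
  then show "Lie \<xi>2 \<zeta>1 z = V12 z"
    unfolding V12_def Lie_commute(3)[OF Cinf_v z] .
qed

text \<open>The Jacobian of the slopes cancels between the two forms, and only powers of
  \<open>\<rho>\<close> are left: the second form carries 1/\<open>\<rho>\<close>, the determinant
  of the first \<open>\<rho>\<close>^2.\<close>

lemma radii:
  assumes z: "z \<in> U" and nz: "det_second z \<noteq> 0"
  shows "radii_sum z = H V11 V12 V22 z" "radii_prod z = P V11 V12 V22 z"
proof -
  define r where "r = \<rho> z"
  define a1 where "a1 = pd e1 y1 z"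
  define a2 where "a2 = pd e2 y1 z"
  define b1 where "b1 = pd e1 y2 z"
  define b2 where "b2 = pd e2 y2 z"
  define D where "D = V11 z * V22 z - (V12 z)\<^sup>2"
  define j where "j = (a1*b2 - a2*b1)\<^sup>2"
  have r: "r > 0" by (simp add: r_def \<rho>_pos)
  have r2: "r\<^sup>2 = 1 + (y1 z)\<^sup>2 + (y2 z)\<^sup>2"
    by (simp add: r_def \<rho>_def)
  have x: "pd e1 \<zeta>1 z = V11 z*a1 + V12 z*b1" "pd e2 \<zeta>1 z = V11 z*a2 + V12 z*b2"
    "pd e1 \<zeta>2 z = V12 z*a1 + V22 z*b1" "pd e2 \<zeta>2 z = V12 z*a2 + V22 z*b2"
    unfolding a1_def a2_def b1_def b2_def
    by (simp_all add: chain1[OF _ z] chain2[OF _ z] \<zeta> V_eq[OF z])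
  have t: "pd e1 \<zeta>3 z = - (y1 z*(V11 z*a1 + V12 z*b1) + y2 z*(V12 z*a1 + V22 z*b1))"
    "pd e2 \<zeta>3 z = - (y1 z*(V11 z*a2 + V12 z*b2) + y2 z*(V12 z*a2 + V22 z*b2))"
    using normal[OF z] unfolding x by (simp_all add: algebra_simps)
  note F = fundamental_forms_trace(1)[where ?a1.0=a1 and ?a2.0=a2 and ?b1.0=b1 and ?b2.0=b2
      and ?V11.0="V11 z" and ?V12.0="V12 z" and ?V22.0="V22 z"]
    fundamental_forms_trace(2,3)[where ?a1.0=a1 and ?a2.0=a2 and ?b1.0=b1 and ?b2.0=b2
      and ?V11.0="V11 z" and ?V12.0="V12 z" and ?V22.0="V22 z" and ?y1.0="y1 z" and ?y2.0="y2 z"]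
  define h11 where "h11 = r * second_form e1 e1 z"
  define h12 where "h12 = r * second_form e1 e2 z"
  define h22 where "h22 = r * second_form e2 e2 z"
  have h: "h11*h22 - h12*h12 = j * D"
    "h11*first_form e2 e2 z - 2*h12*first_form e1 e2 z + h22*first_form e1 e1 z
      = j * D * (V11 z + V22 z + (y1 z)\<^sup>2*V11 z + 2*y1 z*y2 z*V12 z + (y2 z)\<^sup>2*V22 z)"
    using F(1,3) r unfolding h11_def h12_def h22_def first_form_def second_form_def x t D_def j_def
    by (simp_all add: r_def a1_def a2_def b1_def b2_def)
  have g: "first_form e1 e1 z * first_form e2 e2 z - first_form e1 e2 z * first_form e1 e2 z = r\<^sup>2 * j * D\<^sup>2"
    using F(2) unfolding first_form_def x t D_def j_def r2 .
  have d: "r\<^sup>2 * det_second z = j * D"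
    unfolding h(1)[symmetric] det_second_def h11_def h12_def h22_def by algebra
  then have jD: "j \<noteq> 0" "D \<noteq> 0" using nz r by auto
  have d': "det_second z = j * D / r\<^sup>2" using d r by (simp add: field_simps)
  have "r * (second_form e1 e1 z * first_form e2 e2 z - 2 * second_form e1 e2 z * first_form e1 e2 z
      + second_form e2 e2 z * first_form e1 e1 z)
      = j * D * (V11 z + V22 z + (y1 z)\<^sup>2*V11 z + 2*y1 z*y2 z*V12 z + (y2 z)\<^sup>2*V22 z)"
    unfolding h(2)[symmetric] h11_def h12_def h22_def by algebra
  then have "second_form e1 e1 z * first_form e2 e2 z - 2 * second_form e1 e2 z * first_form e1 e2 z
      + second_form e2 e2 z * first_form e1 e1 z
      = j * D * (V11 z + V22 z + (y1 z)\<^sup>2*V11 z + 2*y1 z*y2 z*V12 z + (y2 z)\<^sup>2*V22 z) / r"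
    using r by (simp add: field_simps)
  then show "radii_sum z = H V11 V12 V22 z"
    unfolding radii_sum_def H_def d' r_def[symmetric] using r jD
    by (simp add: power2_eq_square)
  show "radii_prod z = P V11 V12 V22 z"
    unfolding radii_prod_def P_def g d' r_def[symmetric] D_def[symmetric] using r jD
    by (simp add: power2_eq_square power4_eq_xxxx)
qed

text \<open>Passes from a fixed normal to a fixed chart point, at no cost because the spatial
  gradient of w vanishes at z. The hypothesis \<open>diag\<close> says that the Hessian of the
  support function is diagonal there.\<close>

theorem time_derivative_neg:
  assumes w: "Cinf U w"
    and nz: "\<And>z. z \<in> U \<Longrightarrow> det_second z \<noteq> 0"
    and flow: "\<And>z. z \<in> U \<Longrightarrow> pd e0 \<zeta>1 z = ((radii_sum z)\<^sup>2 - 2 * radii_prod z) * (y1 z / \<rho> z)"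
      "\<And>z. z \<in> U \<Longrightarrow> pd e0 \<zeta>2 z = ((radii_sum z)\<^sup>2 - 2 * radii_prod z) * (y2 z / \<rho> z)"
      "\<And>z. z \<in> U \<Longrightarrow> pd e0 \<zeta>3 z = ((radii_sum z)\<^sup>2 - 2 * radii_prod z) * (1 / \<rho> z)"
    and w_eq: "\<And>z. z \<in> U \<Longrightarrow> 2 * w z * radii_sum z = (radii_sum z)\<^sup>2 - 4 * radii_prod z"
    and z: "z \<in> U" "y1 z = 0" "y2 z = 0"
    and diag: "pd e2 \<zeta>1 z * pd e1 y1 z = pd e1 \<zeta>1 z * pd e2 y1 z"
    and pos: "radii_sum z > 0" "radii_prod z > 0" "w z \<noteq> 0"
    and max: "\<And>s a b. z + s *\<^sub>R (0, a, b) \<in> U \<Longrightarrow> w (z + s *\<^sub>R (0, a, b)) \<le> w z"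
  shows "pd e0 w z < 0"
proof -
  note crit = second_derivative_local_max[OF w U z(1) max]
  have L: "Lie \<xi>1 w z = 0" "Lie \<xi>2 w z = 0"
    unfolding Lie_def \<xi>1_def \<xi>2_def using crit(1) by blast+
  have L2: "Lie \<xi>1 (Lie \<xi>1 w) z \<le> 0" "Lie \<xi>2 (Lie \<xi>2 w) z \<le> 0"
    using Lie2_at_critical[OF w z(1) crit(1) Cinf_\<xi>(2)] Lie2_at_critical[OF w z(1) crit(1) Cinf_\<xi>(3)]
      crit(2) by (simp_all add: \<xi>1_def \<xi>2_def)
  have V12: "V12 z = 0"
    unfolding V_eq(3)[OF z(1), symmetric] Lie2[OF \<zeta>(1) z(1)] using diag by simp
  have "Lie \<xi>0 w z < 0"
  proof (rule pinching_derivative_neg[OF Cinf_v w V11_def V12_def V22_def _ _ z V12 _ _ pos(3) L L2])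
    fix x assume x: "x \<in> U"
    note r = radii[OF x nz[OF x]]
    show "2 * w x * H V11 V12 V22 x = (H V11 V12 V22 x)\<^sup>2 - 4 * P V11 V12 V22 x"
      using w_eq[OF x] unfolding r .
    have "(\<rho> x)\<^sup>2 = 1 + (y1 x)\<^sup>2 + (y2 x)\<^sup>2" by (simp add: \<rho>_def)
    \<comment> \<open>The unit normal paired with (y1, y2, 1) is the length \<open>\<rho>\<close>,
      the factor in the equation for \<open>v\<close>.\<close>
    then have "y1 x / \<rho> x * y1 x + y2 x / \<rho> x * y2 x + 1 / \<rho> x = \<rho> x"
      using \<rho>_pos[of x] by (simp add: field_simps power2_eq_square)
    moreover have "N * (y1 x / \<rho> x) * y1 x + N * (y2 x / \<rho> x) * y2 x + N * (1 / \<rho> x)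
        = (y1 x / \<rho> x * y1 x + y2 x / \<rho> x * y2 x + 1 / \<rho> x) * N" for N
      by (simp only: distrib_right mult.assoc mult.commute[of N] mult.left_commute[of N])
    ultimately have "N * (y1 x / \<rho> x) * y1 x + N * (y2 x / \<rho> x) * y2 x + N * (1 / \<rho> x) = \<rho> x * N" for N
      by simp
    then show "Lie \<xi>0 v x = \<rho> x * ((H V11 V12 V22 x)\<^sup>2 - 2 * P V11 V12 V22 x)"
      unfolding Lie0_v[OF x] flow[OF x] r by blast
  qed (use pos radii[OF z(1) nz[OF z(1)]] in auto)
  then show ?thesis using L by (simp add: Lie0[OF w z(1)])
qed

end

section \<open>Pairs of quadratic forms\<close>

definition quad :: "real \<Rightarrow> real \<Rightarrow> real \<Rightarrow> real \<Rightarrow> real \<Rightarrow> real" where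
  "quad h11 h12 h22 a b = h11 * a\<^sup>2 + 2 * h12 * a * b + h22 * b\<^sup>2"

lemma rotation_diagonalises:
  fixes A B D :: real
  obtains c s where "c\<^sup>2 + s\<^sup>2 = 1" "c * s * (D - A) + (c\<^sup>2 - s\<^sup>2) * B = 0"
proof (cases "B = 0")
  case True
  then show ?thesis by (intro that[of 1 0]) auto
next
  case False
  define d where "d = (D - A) / 2"
  define r where "r = sqrt (d\<^sup>2 + B\<^sup>2)"
  define m where "m = sqrt (B\<^sup>2 + (d + r)\<^sup>2)"
  have r: "r\<^sup>2 = d\<^sup>2 + B\<^sup>2" by (simp add: r_def)
  have "B\<^sup>2 + (d + r)\<^sup>2 > 0" using False by (simp add: add_pos_nonneg)
  then have m: "m > 0" "m\<^sup>2 = B\<^sup>2 + (d + r)\<^sup>2" by (simp_all add: m_def)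
  show ?thesis
  \<comment> \<open>Normalised eigenvector of the symmetric matrix with diagonal A, D and
    off-diagonal entry B, for the eigenvalue (A + D)/2 + r; its second entry is that eigenvalue
    minus A.\<close>
  proof (rule that[of "B/m" "(d+r)/m"])
    show "(B/m)\<^sup>2 + ((d+r)/m)\<^sup>2 = 1"
      unfolding power_divide add_divide_distrib[symmetric] m(2)[symmetric] using m(1) by simp
    have "B * (d+r) * (2*d) + (B\<^sup>2 - (d+r)\<^sup>2) * B = 0" using r by algebra
    moreover have "B/m * ((d+r)/m) * (D - A) + ((B/m)\<^sup>2 - ((d+r)/m)\<^sup>2) * B
      = (B * (d+r) * (2*d) + (B\<^sup>2 - (d+r)\<^sup>2) * B) / m\<^sup>2"
      using m by (simp add: d_def power2_eq_square field_simps)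
    ultimately show "B/m * ((d+r)/m) * (D - A) + ((B/m)\<^sup>2 - ((d+r)/m)\<^sup>2) * B = 0" by simp
  qed
qed

lemma simultaneous_diagonalisation:
  fixes g11 g12 g22 h11 h12 h22 :: real
  assumes g: "g11 > 0" "g11 * g22 - g12 * g12 > 0"
  obtains a b c d where
    "quad g11 g12 g22 a b = 1" "quad g11 g12 g22 c d = 1" "g11*a*c + g12*(a*d + b*c) + g22*b*d = 0"
    "h11*a*c + h12*(a*d + b*c) + h22*b*d = 0"
proof -
  define r where "r = sqrt g11"
  define m where "m = sqrt (g11 * (g11 * g22 - g12 * g12))"
  have r: "r > 0" "r\<^sup>2 = g11" using g by (simp_all add: r_def)
  have m: "m > 0" "m\<^sup>2 = g11 * (g11 * g22 - g12 * g12)" using g by (simp_all add: m_def)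
  \<comment> \<open>Gram-Schmidt: (x, 0) and (p, q) are g-orthonormal. A rotation preserves this,
    which leaves an angle free to diagonalise h.\<close>
  define x where "x = 1/r"
  define p where "p = - g12 / m"
  define q where "q = g11 / m"
  have x: "g11 * x\<^sup>2 = 1" using r g by (simp add: x_def power_divide)
  have pq: "quad g11 g12 g22 p q = 1"
  proof -
    have "quad g11 g12 g22 p q = (g11 * g12\<^sup>2 - 2 * g12 * g12 * g11 + g22 * g11\<^sup>2) / m\<^sup>2"
      using m(1) by (simp add: quad_def p_def q_def power2_eq_square field_simps)
    also have "\<dots> = 1" using m by (simp add: power2_eq_square algebra_simps)
    finally show ?thesis .
  qed
  have xp: "g11 * x * p + g12 * x * q = 0" using m by (simp add: p_def q_def)
  define A where "A = h11 * x\<^sup>2"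
  define B where "B = h11 * x * p + h12 * x * q"
  define D where "D = quad h11 h12 h22 p q"
  obtain c s where cs: "c\<^sup>2 + s\<^sup>2 = 1" "c * s * (D - A) + (c\<^sup>2 - s\<^sup>2) * B = 0"
    by (rule rotation_diagonalises)
  show ?thesis
  proof (rule that[of "c*x + s*p" "s*q" "- s*x + c*p" "c*q"])
    show "quad g11 g12 g22 (c*x + s*p) (s*q) = 1"
      using x pq xp cs(1) unfolding quad_def by algebra
    show "quad g11 g12 g22 (- s*x + c*p) (c*q) = 1"
      using x pq xp cs(1) unfolding quad_def by algebra
    show "g11*(c*x + s*p)*(- s*x + c*p) + g12*((c*x + s*p)*(c*q) + s*q*(- s*x + c*p)) + g22*(s*q)*(c*q) = 0"
      using x pq xp cs(1) unfolding quad_def by algebra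
    show "h11*(c*x + s*p)*(- s*x + c*p) + h12*((c*x + s*p)*(c*q) + s*q*(- s*x + c*p)) + h22*(s*q)*(c*q) = 0"
      using cs(2) unfolding A_def B_def D_def quad_def by algebra
  qed
qed

text \<open>In a g-orthonormal basis that diagonalises h the quotients are weighted means of
  \<open>k1\<close> and \<open>k2\<close>, so these two are the extrema; sum and product do not
  depend on their order.\<close>

lemma Sup_Inf_Rayleigh:
  fixes g11 g12 g22 h11 h12 h22 :: real
  assumes g: "g11 > 0" "g11 * g22 - g12 * g12 > 0"
  defines "S \<equiv> {quad h11 h12 h22 a b / quad g11 g12 g22 a b | a b. (a, b) \<noteq> (0, 0)}"
  shows "Sup S + Inf S = (h11 * g22 - 2 * h12 * g12 + h22 * g11) / (g11 * g22 - g12 * g12)"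
    and "Sup S * Inf S = (h11 * h22 - h12 * h12) / (g11 * g22 - g12 * g12)"
proof -
  define G where "G = g11 * g22 - g12 * g12"
  obtain a b c d where m: "quad g11 g12 g22 a b = 1" "quad g11 g12 g22 c d = 1"
    "g11*a*c + g12*(a*d + b*c) + g22*b*d = 0" "h11*a*c + h12*(a*d + b*c) + h22*b*d = 0"
    using simultaneous_diagonalisation[OF g] by blast
  define k1 where "k1 = quad h11 h12 h22 a b"
  define k2 where "k2 = quad h11 h12 h22 c d"
  define e where "e = a*d - b*c"
  have e: "e\<^sup>2 * G = 1"
    using m(1-3) unfolding e_def G_def quad_def by algebra
  have G: "G > 0" "e \<noteq> 0" using g e by (auto simp: G_def)
  have s: "k1 + k2 = e\<^sup>2 * (h11 * g22 - 2 * h12 * g12 + h22 * g11)"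
    using m unfolding k1_def k2_def e_def quad_def by algebra
  have p: "k1 * k2 = e\<^sup>2 * (h11 * h22 - h12 * h12)"
    using m unfolding k1_def k2_def e_def quad_def by algebra
  have S: "S = {(k1 * x\<^sup>2 + k2 * y\<^sup>2) / (x\<^sup>2 + y\<^sup>2) | x y. (x, y) \<noteq> (0, 0)}" (is "S = ?S'")
  proof -
    have q: "quad h11 h12 h22 (x*a + y*c) (x*b + y*d) = k1 * x\<^sup>2 + k2 * y\<^sup>2"
      "quad g11 g12 g22 (x*a + y*c) (x*b + y*d) = x\<^sup>2 + y\<^sup>2" for x y
      using m unfolding k1_def k2_def quad_def by algebra+
    show ?thesis
    proof (intro equalityI subsetI)
      fix r assume "r \<in> ?S'"
      then obtain x y where xy: "(x, y) \<noteq> (0, 0)" "r = (k1 * x\<^sup>2 + k2 * y\<^sup>2) / (x\<^sup>2 + y\<^sup>2)" by blast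
      have "x\<^sup>2 + y\<^sup>2 \<noteq> 0" using xy(1) by (auto simp: sum_power2_eq_zero_iff)
      then have "(x*a + y*c, x*b + y*d) \<noteq> (0, 0)"
        using q(2)[of x y] by (auto simp: quad_def)
      then show "r \<in> S" unfolding S_def xy(2) q[of x y, symmetric] by blast
    next
      fix r assume "r \<in> S"
      then obtain s t where st: "(s, t) \<noteq> (0, 0)" "r = quad h11 h12 h22 s t / quad g11 g12 g22 s t"
        unfolding S_def by blast
      \<comment> \<open>Coordinates of (s, t) in the basis (a, b), (c, d) by Cramer's rule.\<close>
      define x where "x = (s*d - t*c) / e"
      define y where "y = (t*a - s*b) / e"
      have "(s*d - t*c)*a + (t*a - s*b)*c = s*e" "(s*d - t*c)*b + (t*a - s*b)*d = t*e"
        unfolding e_def by algebra+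
      moreover have "x*a + y*c = ((s*d - t*c)*a + (t*a - s*b)*c) / e"
        "x*b + y*d = ((s*d - t*c)*b + (t*a - s*b)*d) / e"
        by (simp_all add: x_def y_def add_divide_distrib)
      ultimately have "x*a + y*c = s" "x*b + y*d = t" using G(2) by simp_all
      moreover from this have "(x, y) \<noteq> (0, 0)" using st(1) by auto
      ultimately show "r \<in> ?S'" using q st(2) by force
    qed
  qed
  have bnd: "(k1 * x\<^sup>2 + k2 * y\<^sup>2) / (x\<^sup>2 + y\<^sup>2) \<le> max k1 k2" "min k1 k2 \<le> (k1 * x\<^sup>2 + k2 * y\<^sup>2) / (x\<^sup>2 + y\<^sup>2)"
    if "(x, y) \<noteq> (0, 0)" for x y
  proof -
    have pos: "x\<^sup>2 + y\<^sup>2 > 0" using that by (auto simp: sum_power2_gt_zero_iff)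
    have "k1 * x\<^sup>2 + k2 * y\<^sup>2 \<le> max k1 k2 * (x\<^sup>2 + y\<^sup>2)" "min k1 k2 * (x\<^sup>2 + y\<^sup>2) \<le> k1 * x\<^sup>2 + k2 * y\<^sup>2"
      unfolding distrib_left by (intro add_mono mult_right_mono; simp)+
    then show "(k1 * x\<^sup>2 + k2 * y\<^sup>2) / (x\<^sup>2 + y\<^sup>2) \<le> max k1 k2" "min k1 k2 \<le> (k1 * x\<^sup>2 + k2 * y\<^sup>2) / (x\<^sup>2 + y\<^sup>2)"
      using pos by (simp_all add: field_simps)
  qed
  have "k1 \<in> S" unfolding S by (rule CollectI, rule exI[of _ 1], rule exI[of _ 0]) simp
  moreover have "k2 \<in> S" unfolding S by (rule CollectI, rule exI[of _ 0], rule exI[of _ 1]) simp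
  ultimately have "max k1 k2 \<in> S" "min k1 k2 \<in> S" by (auto simp: max_def min_def)
  moreover have "r \<le> max k1 k2" "min k1 k2 \<le> r" if "r \<in> S" for r
    using that bnd unfolding S by blast+
  ultimately have "Sup S = max k1 k2" "Inf S = min k1 k2"
    by (intro cSup_eq_maximum cInf_eq_minimum; simp)+
  then have "Sup S + Inf S = k1 + k2" "Sup S * Inf S = k1 * k2"
    by (auto simp: max_def min_def)
  moreover have "e\<^sup>2 = 1 / G" using e G by (simp add: field_simps)
  ultimately show "Sup S + Inf S = (h11 * g22 - 2 * h12 * g12 + h22 * g11) / (g11 * g22 - g12 * g12)"
    "Sup S * Inf S = (h11 * h22 - h12 * h12) / (g11 * g22 - g12 * g12)"
    unfolding s p G_def by simp_all
qed

section \<open>Projective charts of the sphere\<close>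

locale tangent_chart =
  fixes p0 u1 u2 :: "real^3"
  assumes on: "p0 \<bullet> p0 = 1" "u1 \<bullet> u1 = 1" "u2 \<bullet> u2 = 1" "u1 \<bullet> p0 = 0" "u2 \<bullet> p0 = 0" "u1 \<bullet> u2 = 0"
    and span: "\<And>v. v = (v \<bullet> u1) *\<^sub>R u1 + (v \<bullet> u2) *\<^sub>R u2 + (v \<bullet> p0) *\<^sub>R p0"
begin

definition \<phi> :: "real \<times> real \<Rightarrow> real^3" where
  "\<phi> x = p0 + fst x *\<^sub>R u1 + snd x *\<^sub>R u2"

text \<open>Inverse of the central projection of the open hemisphere around p0 to its tangent plane,
  chosen because \<open>dX\<close> and \<open>ddX\<close> are taken along great circles.\<close>

definition \<sigma> :: "real \<times> real \<Rightarrow> real^3" where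
  "\<sigma> x = (1 / norm (\<phi> x)) *\<^sub>R \<phi> x"

definition Z :: "(real \<Rightarrow> real^3 \<Rightarrow> real^3) \<Rightarrow> spacetime \<Rightarrow> real^3" where
  "Z X z = X (fst z) (\<sigma> (snd z))"

lemma \<phi>_coords: "\<phi> x \<bullet> p0 = 1" "\<phi> x \<bullet> u1 = fst x" "\<phi> x \<bullet> u2 = snd x"
  using on by (simp_all add: \<phi>_def inner_add_left inner_add_right inner_commute)

lemma \<phi>_nz: "\<phi> x \<noteq> 0"
  using \<phi>_coords(1)[of x] by auto

lemma norm_\<phi>: "(norm (\<phi> x))\<^sup>2 = 1 + (fst x)\<^sup>2 + (snd x)\<^sup>2" "norm (\<phi> x) > 0"
proof -
  have "\<phi> x \<bullet> \<phi> x = \<phi> x \<bullet> p0 + fst x * (\<phi> x \<bullet> u1) + snd x * (\<phi> x \<bullet> u2)"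
    by (subst (2) \<phi>_def) (simp add: inner_add_right)
  then show "(norm (\<phi> x))\<^sup>2 = 1 + (fst x)\<^sup>2 + (snd x)\<^sup>2"
    unfolding power2_norm_eq_inner by (simp add: \<phi>_coords power2_eq_square)
qed (simp add: \<phi>_nz)

lemma \<sigma>_sphere: "\<sigma> x \<in> S2" "norm (\<sigma> x) = 1"
  using norm_\<phi>(2)[of x] by (simp_all add: \<sigma>_def)

lemma \<phi>_\<sigma>: "\<phi> x = norm (\<phi> x) *\<^sub>R \<sigma> x"
  using norm_\<phi>(2)[of x] by (simp add: \<sigma>_def)

lemma \<sigma>_0: "\<sigma> (0, 0) = p0"
  using on by (simp add: \<sigma>_def \<phi>_def norm_eq_sqrt_inner)

lemma \<sigma>_eqI:
  assumes "norm q = 1" "\<phi> x = k *\<^sub>R q" "k > 0"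
  shows "\<sigma> x = q"
  using assms by (simp add: \<sigma>_def)

lemma Cinf_Z:
  assumes "Cinf U (\<lambda>(t, x). X t x)" "open U" "open W" "\<And>z. z \<in> W \<Longrightarrow> (fst z, \<sigma> (snd z)) \<in> U"
  shows "Cinf W (Z X)"
proof -
  have W: "Cinf W (\<lambda>z::spacetime. \<phi> (snd z))"
    unfolding \<phi>_def by (intro Cinf_intros assms(3))
  have "Cinf W (\<lambda>z::spacetime. (fst z, \<sigma> (snd z)))"
    unfolding \<sigma>_def norm_eq_sqrt_inner
    by (intro Cinf_Pair Cinf_fst Cinf_ident Cinf_scaleR Cinf_divide Cinf_sqrt Cinf_inner Cinf_const W assms(3))
      (use \<phi>_nz in auto)
  from Cinf_compose[OF assms(3,1) this] assms(4) show ?thesis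
    by (simp add: Z_def[abs_def] image_subset_iff)
qed

lemma open_chart_domain: "open U \<Longrightarrow> open {z::spacetime. (fst z, \<sigma> (snd z)) \<in> U}"
proof -
  have "continuous_on UNIV (\<lambda>z::spacetime. (fst z, \<sigma> (snd z)))"
    unfolding \<sigma>_def \<phi>_def
    by (intro continuous_intros) (use \<phi>_nz in \<open>auto simp: \<phi>_def\<close>)
  then show "open U \<Longrightarrow> open {z::spacetime. (fst z, \<sigma> (snd z)) \<in> U}"
    using open_vimage[of U "\<lambda>z::spacetime. (fst z, \<sigma> (snd z))"] by (simp add: vimage_def)
qed

definition chart_dir :: "real \<times> real \<Rightarrow> real^3 \<Rightarrow> spacetime" where
  "chart_dir x v = (0, norm (\<phi> x) * (v \<bullet> u1 - fst x * (v \<bullet> p0)), norm (\<phi> x) * (v \<bullet> u2 - snd x * (v \<bullet> p0)))"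

text \<open>In the projective chart the great circle through \<open>\<sigma> x\<close> is a straight line with a
  fractional linear parametrisation, whose derivative is \<open>chart_dir x v\<close> divided by
  \<open>(cos s + b sin s)\<^sup>2\<close>.\<close>
lemma great_circle_derivatives:
  assumes W: "open W" "(t, x) \<in> W" and Z: "Cinf W (Z X)"
    and v: "unit_tangent (\<sigma> x) v"
  defines "w \<equiv> chart_dir x v"
  shows "dX (X t) (\<sigma> x) v = pd w (Z X) (t, x)"
    and "\<exists>c. ddX (X t) (\<sigma> x) v = pd w (pd w (Z X)) (t, x) + c *\<^sub>R pd w (Z X) (t, x)"
proof -
  define R where "R = norm (\<phi> x)"
  define b where "b = R * (v \<bullet> p0)"
  define a1 where "a1 = R * (v \<bullet> u1)"
  define a2 where "a2 = R * (v \<bullet> u2)"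
  \<comment> \<open>Component along p0 of R times the great circle; the numerators of
    \<open>\<gamma>\<close> are those along u1 and u2, and the quotients are the chart
    coordinates.\<close>
  define D where "D s = cos s + b * sin s" for s
  define \<gamma> where "\<gamma> s = (t, (fst x * cos s + a1 * sin s) / D s, (snd x * cos s + a2 * sin s) / D s)" for s
  have wdef: "w = (0, a1 - fst x * b, a2 - snd x * b)"
    by (simp add: w_def chart_dir_def a1_def a2_def b_def R_def algebra_simps)
  have R: "R > 0" using norm_\<phi> by (simp add: R_def)
  have "isCont D 0" unfolding D_def by (intro continuous_intros)
  moreover have D0: "D 0 = 1" by (simp add: D_def)
  moreover have "isCont \<gamma> 0" unfolding \<gamma>_def D_def by (intro continuous_intros) auto
  moreover have \<gamma>0: "\<gamma> 0 = (t, x)" by (simp add: \<gamma>_def D_def)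
  ultimately have "\<forall>\<^sub>F s in nhds 0. D s > 0 \<and> \<gamma> s \<in> W"
    using W order_tendstoD(1)[of D 1 "nhds 0" 0] topological_tendstoD[of \<gamma> "(t, x)" "nhds 0" W]
    by (auto simp: isCont_def tendsto_nhds_iff intro: eventually_conj)
  then obtain N where N: "open N" "0 \<in> N" "\<And>s. s \<in> N \<Longrightarrow> D s > 0" "\<And>s. s \<in> N \<Longrightarrow> \<gamma> s \<in> W"
    unfolding eventually_nhds by blast
  have gc: "gc (\<sigma> x) v s = \<sigma> (snd (\<gamma> s))" if "s \<in> N" for s
  proof (rule \<sigma>_eqI[symmetric])
    show "R / D s > 0" using R N(3)[OF that] by simp
    have "gc (\<sigma> x) v s \<bullet> gc (\<sigma> x) v s = (cos s)\<^sup>2 * (norm (\<sigma> x))\<^sup>2 + (sin s)\<^sup>2 * (norm v)\<^sup>2"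
      using v unfolding gc_def unit_tangent_def power2_norm_eq_inner
      by (simp add: inner_add_left inner_add_right inner_commute power2_eq_square algebra_simps)
    then have "gc (\<sigma> x) v s \<bullet> gc (\<sigma> x) v s = 1"
      using v \<sigma>_sphere(2)[of x] by (simp add: unit_tangent_def)
    then show "norm (gc (\<sigma> x) v s) = 1" by (simp add: norm_eq_sqrt_inner)
    have v': "R *\<^sub>R v = a1 *\<^sub>R u1 + a2 *\<^sub>R u2 + b *\<^sub>R p0"
      by (subst span[of v]) (simp add: a1_def a2_def b_def scaleR_add_right)
    have "R *\<^sub>R gc (\<sigma> x) v s = cos s *\<^sub>R (R *\<^sub>R \<sigma> x) + sin s *\<^sub>R (R *\<^sub>R v)"
      by (simp add: gc_def scaleR_add_right mult.commute)
    also have "R *\<^sub>R \<sigma> x = \<phi> x" using \<phi>_\<sigma>[of x] by (simp add: R_def)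
    also have "cos s *\<^sub>R \<phi> x + sin s *\<^sub>R (R *\<^sub>R v) = D s *\<^sub>R p0 + (fst x * cos s + a1 * sin s) *\<^sub>R u1 + (snd x * cos s + a2 * sin s) *\<^sub>R u2"
      unfolding v' \<phi>_def D_def by (simp add: algebra_simps)
    also have "\<dots> = D s *\<^sub>R \<phi> (snd (\<gamma> s))"
      using N(3)[OF that] by (simp add: \<phi>_def \<gamma>_def scaleR_add_right)
    finally have "(1 / D s) *\<^sub>R (R *\<^sub>R gc (\<sigma> x) v s) = \<phi> (snd (\<gamma> s))"
      using N(3)[OF that] by simp
    then show "\<phi> (snd (\<gamma> s)) = (R / D s) *\<^sub>R gc (\<sigma> x) v s" by simp
  qed
  have \<gamma>': "(\<gamma> has_vector_derivative (1 / (D s)\<^sup>2) *\<^sub>R w) (at s)" if "s \<in> N" for s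
  proof -
    have Ds: "D s \<noteq> 0" using N(3)[OF that] by simp
    have q: "((\<lambda>s. (y * cos s + a * sin s) / D s) has_vector_derivative (1 / (D s)\<^sup>2) * (a - y * b)) (at s)" for y a
    proof -
      have "((\<lambda>s. (y * cos s + a * sin s) / (cos s + b * sin s)) has_real_derivative
          (((- (y * sin s) + a * cos s) * D s - (y * cos s + a * sin s) * (- sin s + b * cos s)) / (D s * D s))) (at s)"
        using Ds unfolding D_def by (auto intro!: derivative_eq_intros simp: algebra_simps)
      moreover have "(- (y * sin s) + a * cos s) * D s - (y * cos s + a * sin s) * (- sin s + b * cos s) = a - y * b"
        unfolding D_def using sin_cos_squared_add[of s] by algebra
      ultimately show ?thesis
        by (simp add: has_real_derivative_iff_has_vector_derivative D_def power2_eq_square)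
    qed
    show ?thesis unfolding \<gamma>_def wdef
      by (rule has_vector_derivative_eq_rhs[OF has_vector_derivative_Pair[OF has_vector_derivative_const
              has_vector_derivative_Pair[OF q q]]]) simp
  qed
  define k where "k s = 1 / (D s)\<^sup>2" for s
  have c': "((\<lambda>r. X t (gc (\<sigma> x) v r)) has_vector_derivative k s *\<^sub>R pd w (Z X) (\<gamma> s)) (at s)" if s: "s \<in> N" for s
  proof -
    have "(Z X has_derivative (\<lambda>v. pd v (Z X) (\<gamma> s))) (at (\<gamma> s))"
      by (rule Cinf_has_derivative[OF Z N(4)[OF s]])
    from vector_derivative_diff_chain_within[OF \<gamma>'[OF s] has_derivative_at_withinI[OF this]]
    have "((\<lambda>r. Z X (\<gamma> r)) has_vector_derivative pd ((1 / (D s)\<^sup>2) *\<^sub>R w) (Z X) (\<gamma> s)) (at s)"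
      by (simp add: o_def)
    then have "((\<lambda>r. Z X (\<gamma> r)) has_vector_derivative k s *\<^sub>R pd w (Z X) (\<gamma> s)) (at s)"
      by (simp add: pd_dir_scale[OF Cinf_differentiable[OF Z N(4)[OF s]]] k_def)
    then show ?thesis
      by (rule has_vector_derivative_transform_within_open[OF _ N(1) s])
        (use gc in \<open>simp add: Z_def \<gamma>_def\<close>)
  qed
  show "dX (X t) (\<sigma> x) v = pd w (Z X) (t, x)"
    unfolding dX_def using vector_derivative_at[OF c'[OF N(2)]] by (simp add: k_def D0 \<gamma>0)
  have W2: "Cinf W (pd w (Z X))" by (rule Cinf_pd[OF Z])
  have "((\<lambda>r. pd w (Z X) (\<gamma> r)) has_vector_derivative pd w (pd w (Z X)) (t, x)) (at 0)"
  proof -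
    have "(pd w (Z X) has_derivative (\<lambda>v. pd v (pd w (Z X)) (\<gamma> 0))) (at (\<gamma> 0))"
      by (rule Cinf_has_derivative[OF W2 N(4)[OF N(2)]])
    from vector_derivative_diff_chain_within[OF \<gamma>'[OF N(2)] has_derivative_at_withinI[OF this]]
    show ?thesis by (simp add: o_def D0 \<gamma>0)
  qed
  \<comment> \<open>The change of speed adds only a multiple of the first derivative, which is
    tangential and drops out of the normal curvature.\<close>
  moreover have "(k has_real_derivative - 2 * b) (at 0)"
    unfolding k_def D_def by (auto intro!: derivative_eq_intros simp: power2_eq_square)
  ultimately have "((\<lambda>r. k r *\<^sub>R pd w (Z X) (\<gamma> r)) has_vector_derivative
      k 0 *\<^sub>R pd w (pd w (Z X)) (t, x) + (- 2 * b) *\<^sub>R pd w (Z X) (\<gamma> 0)) (at 0)"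
    by (intro has_vector_derivative_scaleR)
  then have "((\<lambda>r. k r *\<^sub>R pd w (Z X) (\<gamma> r)) has_vector_derivative
      pd w (pd w (Z X)) (t, x) + (- 2 * b) *\<^sub>R pd w (Z X) (t, x)) (at 0)"
    by (simp add: k_def D0 \<gamma>0)
  then have "((\<lambda>s. vector_derivative (\<lambda>r. X t (gc (\<sigma> x) v r)) (at s)) has_vector_derivative
      pd w (pd w (Z X)) (t, x) + (- 2 * b) *\<^sub>R pd w (Z X) (t, x)) (at 0)"
    by (rule has_vector_derivative_transform_within_open[OF _ N(1,2)])
      (simp add: vector_derivative_at[OF c'])
  then show "\<exists>c. ddX (X t) (\<sigma> x) v = pd w (pd w (Z X)) (t, x) + c *\<^sub>R pd w (Z X) (t, x)"
    unfolding ddX_def using vector_derivative_at by blast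
qed

end

section \<open>Principal curvatures as extremal quotients of quadratic forms\<close>

lemma pd_inner:
  assumes "f differentiable (at z)"
  shows "pd v (\<lambda>y. f y \<bullet> n) z = pd v f z \<bullet> n"
  by (rule pd_linear[OF assms bounded_linear_inner_left])

text \<open>The last claim rests on uniqueness of the normal: if the whole surface lay in the
  tangent plane, the opposite vector would qualify too.\<close>

lemma convex_normal:
  assumes "strictly_convex_embedded Y" "p \<in> S2"
  shows "norm (outer_normal Y p) = 1"
    and "unit_tangent p v \<Longrightarrow> outer_normal Y p \<bullet> dX Y p v = 0"
    and "q \<in> S2 \<Longrightarrow> (Y q - Y p) \<bullet> outer_normal Y p \<le> 0"
    and "\<exists>q\<in>S2. (Y q - Y p) \<bullet> outer_normal Y p < 0"
proof -
  define Q where "Q n \<longleftrightarrow> norm n = 1 \<and> (\<forall>v. unit_tangent p v \<longrightarrow> n \<bullet> dX Y p v = 0)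
       \<and> (\<forall>q\<in>S2. (Y q - Y p) \<bullet> n \<le> 0)" for n
  have ex1: "\<exists>!n. Q n" using assms by (simp add: strictly_convex_embedded_def Q_def)
  have Q: "Q (outer_normal Y p)"
    using theI'[OF ex1] by (simp add: outer_normal_def Q_def)
  then show "norm (outer_normal Y p) = 1"
    "unit_tangent p v \<Longrightarrow> outer_normal Y p \<bullet> dX Y p v = 0"
    "q \<in> S2 \<Longrightarrow> (Y q - Y p) \<bullet> outer_normal Y p \<le> 0"
    by (auto simp: Q_def)
  show "\<exists>q\<in>S2. (Y q - Y p) \<bullet> outer_normal Y p < 0"
  proof (rule ccontr)
    assume "\<not> ?thesis"
    then have "Q (- outer_normal Y p)" using Q by (auto simp: Q_def not_less)
    with ex1 Q have "- outer_normal Y p = outer_normal Y p" by blast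
    then have "- (outer_normal Y p \<bullet> outer_normal Y p) = outer_normal Y p \<bullet> outer_normal Y p"
      by (metis inner_minus_left)
    with Q show False by (simp add: Q_def norm_eq_1)
  qed
qed

context tangent_chart
begin

lemma chart_dir_surj:
  assumes "(a, b) \<noteq> (0, 0)"
  obtains v k where "unit_tangent (\<sigma> x) v" "k > 0" "chart_dir x v = k *\<^sub>R (0, a, b)"
proof -
  define R where "R = norm (\<phi> x)"
  define c where "c = (a * fst x + b * snd x) / R\<^sup>2"
  \<comment> \<open>Lift of (a, b) to a tangent vector of the sphere at \<open>\<sigma> x\<close>.
    Subtracting a multiple of \<open>\<phi> x\<close> does not change the direction seen in the
    chart.\<close>
  define v0 where "v0 = a *\<^sub>R u1 + b *\<^sub>R u2 - c *\<^sub>R \<phi> x"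
  have R: "R > 0" using norm_\<phi> by (simp add: R_def)
  have co: "v0 \<bullet> u1 = a - c * fst x" "v0 \<bullet> u2 = b - c * snd x" "v0 \<bullet> p0 = - c"
    using on \<phi>_coords[of x] by (simp_all add: v0_def inner_add_left inner_diff_left inner_add_right inner_diff_right inner_commute)
  have "v0 \<noteq> 0"
  proof
    assume "v0 = 0"
    then have "a = 0" "b = 0" using co by auto
    with assms show False by simp
  qed
  then have n: "norm v0 > 0" by simp
  have "v0 \<bullet> \<phi> x = a * fst x + b * snd x - c * R\<^sup>2"
    unfolding R_def power2_norm_eq_inner
    using \<phi>_coords(2,3)[of x, unfolded inner_commute[of "\<phi> x"]]
    by (simp add: v0_def inner_diff_left inner_add_left)
  also have "\<dots> = 0" using R by (simp add: c_def)
  finally have orth: "v0 \<bullet> \<sigma> x = 0" by (simp add: \<sigma>_def)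
  show thesis
  proof (rule that[of "(1 / norm v0) *\<^sub>R v0" "R / norm v0"])
    show "unit_tangent (\<sigma> x) ((1 / norm v0) *\<^sub>R v0)"
      using n orth by (simp add: unit_tangent_def)
    show "chart_dir x ((1 / norm v0) *\<^sub>R v0) = (R / norm v0) *\<^sub>R (0, a, b)"
      by (simp add: chart_dir_def co R_def[symmetric] algebra_simps)
  qed (use R n in simp)
qed

text \<open>The normal curvatures at a point are exactly the quotients of h by g over nonzero chart
  directions, so \<open>Sup_Inf_Rayleigh\<close> makes the sum and product of the principal
  curvatures rational in h and g.\<close>

lemma curvature_forms:
  assumes W: "open W" "(t, x) \<in> W" and Z: "Cinf W (Z X)" and conv: "strictly_convex_embedded (X t)"
  defines "n \<equiv> outer_normal (X t) (\<sigma> x)"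
  defines "g a b \<equiv> pd a (Z X) (t, x) \<bullet> pd b (Z X) (t, x)"
    and "h a b \<equiv> - (pd a (pd b (Z X)) (t, x) \<bullet> n)"
  shows "n \<bullet> pd e1 (Z X) (t, x) = 0" "n \<bullet> pd e2 (Z X) (t, x) = 0"
    and "g e1 e1 > 0" "g e1 e1 * g e2 e2 - g e1 e2 * g e1 e2 > 0"
    and "lambda1 (X t) (\<sigma> x) + lambda2 (X t) (\<sigma> x)
      = (h e1 e1 * g e2 e2 - 2 * h e1 e2 * g e1 e2 + h e2 e2 * g e1 e1) / (g e1 e1 * g e2 e2 - g e1 e2 * g e1 e2)"
    and "lambda1 (X t) (\<sigma> x) * lambda2 (X t) (\<sigma> x)
      = (h e1 e1 * h e2 e2 - h e1 e2 * h e1 e2) / (g e1 e1 * g e2 e2 - g e1 e2 * g e1 e2)"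
proof -
  note d = Cinf_differentiable[OF Z W(2)]
  note gcd = great_circle_derivatives[OF W Z]
  note norm_props = convex_normal[OF conv \<sigma>_sphere(1)[of x], folded n_def]
  have dX_nz: "dX (X t) (\<sigma> x) v \<noteq> 0" if "unit_tangent (\<sigma> x) v" for v
    using conv that \<sigma>_sphere(1)[of x] by (auto simp: strictly_convex_embedded_def)
  have nz: "pd (0, a, b) (Z X) (t, x) \<noteq> 0" and orth: "n \<bullet> pd (0, a, b) (Z X) (t, x) = 0"
    if ab: "(a, b) \<noteq> (0, 0)" for a b
  proof -
    obtain v k where v: "unit_tangent (\<sigma> x) v" "k > 0" "chart_dir x v = k *\<^sub>R (0, a, b)"
      using chart_dir_surj[OF ab] .
    have "dX (X t) (\<sigma> x) v = k *\<^sub>R pd (0, a, b) (Z X) (t, x)"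
      unfolding gcd(1)[OF v(1)] v(3) pd_dir_scale[OF d] ..
    with dX_nz[OF v(1)] norm_props(2)[OF v(1)] v(2)
    show "pd (0, a, b) (Z X) (t, x) \<noteq> 0" "n \<bullet> pd (0, a, b) (Z X) (t, x) = 0" by auto
  qed
  show n12: "n \<bullet> pd e1 (Z X) (t, x) = 0" "n \<bullet> pd e2 (Z X) (t, x) = 0"
    by (intro orth; simp)+
  have G: "(norm (pd (0, a, b) (Z X) (t, x)))\<^sup>2 = quad (g e1 e1) (g e1 e2) (g e2 e2) a b" for a b
    unfolding power2_norm_eq_inner quad_def g_def
    by (subst (1 2) pd_coords[OF d])
      (simp add: inner_add_left inner_add_right inner_commute power2_eq_square algebra_simps)
  show g11: "g e1 e1 > 0" using nz[of 1 0] by (simp add: g_def)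
  \<comment> \<open>The direction (-g12, g11) has squared length g11 times the Gram
    determinant.\<close>
  have "quad (g e1 e1) (g e1 e2) (g e2 e2) (- g e1 e2) (g e1 e1)
      = g e1 e1 * (g e1 e1 * g e2 e2 - g e1 e2 * g e1 e2)"
    unfolding quad_def by algebra
  moreover have "quad (g e1 e1) (g e1 e2) (g e2 e2) (- g e1 e2) (g e1 e1) > 0"
    unfolding G[symmetric] using nz[of "- g e1 e2" "g e1 e1"] g11 by simp
  ultimately show gdet: "g e1 e1 * g e2 e2 - g e1 e2 * g e1 e2 > 0"
    using g11 by (simp add: zero_less_mult_iff)
  \<comment> \<open>Freezing the normal turns the second form into the Hessian of a real function,
    to which \<open>pd_commute\<close> applies.\<close>
  define F where "F y = Z X y \<bullet> n" for y
  have F: "Cinf W F" unfolding F_def by (intro Cinf_inner W Z Cinf_const)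
  have pdF: "pd v F y = pd v (Z X) y \<bullet> n" if "y \<in> W" for v y
    unfolding F_def by (rule pd_inner[OF Cinf_differentiable[OF Z that]])
  have ppF: "pd v (pd w F) (t, x) = pd v (pd w (Z X)) (t, x) \<bullet> n" for v w
  proof -
    have "pd v (pd w F) (t, x) = pd v (\<lambda>y. pd w (Z X) y \<bullet> n) (t, x)"
      by (rule pd_cong_open[OF W(1) pdF W(2)])
    then show ?thesis by (simp add: pd_inner[OF Cinf_differentiable[OF Cinf_pd[OF Z] W(2)]])
  qed
  have H: "- (pd (0, a, b) (pd (0, a, b) (Z X)) (t, x) \<bullet> n) = quad (h e1 e1) (h e1 e2) (h e2 e2) a b" for a b
  proof -
    have "pd v (pd (0, a, b) F) (t, x) = a * pd v (pd e1 F) (t, x) + b * pd v (pd e2 F) (t, x)" for v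
    proof -
      have "pd v (pd (0, a, b) F) (t, x) = pd v (\<lambda>y. a * pd e1 F y + b * pd e2 F y) (t, x)"
        by (rule pd_cong_open[OF W(1) _ W(2)])
          (use pd_coords[OF Cinf_differentiable[OF F], of _ 0 a b] in simp)
      then show ?thesis
        using Cinf_differentiable[OF Cinf_pd[OF F] W(2)]
        by (simp add: pd_add pd_mult pd_const differentiable_mult)
    qed
    then have "pd (0, a, b) (pd (0, a, b) F) (t, x)
      = a * pd (0, a, b) (pd e1 F) (t, x) + b * pd (0, a, b) (pd e2 F) (t, x)" .
    also have "\<dots> = a * (a * pd e1 (pd e1 F) (t, x) + b * pd e2 (pd e1 F) (t, x))
        + b * (a * pd e1 (pd e2 F) (t, x) + b * pd e2 (pd e2 F) (t, x))"
      using pd_coords[OF Cinf_differentiable[OF Cinf_pd[OF F] W(2)], of 0 a b e1]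
        pd_coords[OF Cinf_differentiable[OF Cinf_pd[OF F] W(2)], of 0 a b e2] by simp
    finally show ?thesis
      unfolding quad_def h_def ppF[symmetric] pd_commute[OF W F, of e2 e1]
      by (simp add: power2_eq_square algebra_simps)
  qed
  have S: "{normal_curv (X t) (\<sigma> x) v | v. unit_tangent (\<sigma> x) v}
    = {quad (h e1 e1) (h e1 e2) (h e2 e2) a b / quad (g e1 e1) (g e1 e2) (g e2 e2) a b | a b. (a, b) \<noteq> (0, 0)}"
    (is "?A = ?B")
  proof -
    have curv: "normal_curv (X t) (\<sigma> x) v
        = quad (h e1 e1) (h e1 e2) (h e2 e2) a b / quad (g e1 e1) (g e1 e2) (g e2 e2) a b"
      if v: "unit_tangent (\<sigma> x) v" and k: "chart_dir x v = (0, a, b)" for v a b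
    proof -
      obtain c where c: "ddX (X t) (\<sigma> x) v = pd (0, a, b) (pd (0, a, b) (Z X)) (t, x) + c *\<^sub>R pd (0, a, b) (Z X) (t, x)"
        using gcd(2)[OF v] unfolding k by blast
      have "pd (0, a, b) (Z X) (t, x) \<bullet> n = 0"
        using norm_props(2)[OF v] unfolding gcd(1)[OF v] k by (simp add: inner_commute)
      then have "- (ddX (X t) (\<sigma> x) v \<bullet> n) = quad (h e1 e1) (h e1 e2) (h e2 e2) a b"
        unfolding c H[symmetric] by (simp add: inner_add_left)
      then show ?thesis unfolding normal_curv_def n_def[symmetric] gcd(1)[OF v] k G[symmetric] by simp
    qed
    have scale: "quad p q r (k * a) (k * b) = k\<^sup>2 * quad p q r a b" for p q r k a b
      unfolding quad_def by algebra
    show ?thesis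
    proof (intro equalityI subsetI)
      fix r assume "r \<in> ?A"
      then obtain v where v: "unit_tangent (\<sigma> x) v" "r = normal_curv (X t) (\<sigma> x) v" by blast
      obtain a b where ab: "chart_dir x v = (0, a, b)" by (simp add: chart_dir_def)
      have "(a, b) \<noteq> (0, 0)"
      proof
        assume "(a, b) = (0, 0)"
        then have "dX (X t) (\<sigma> x) v = pd (0 *\<^sub>R 0) (Z X) (t, x)"
          unfolding gcd(1)[OF v(1)] ab by (simp add: zero_prod_def)
        also have "\<dots> = 0" unfolding pd_dir_scale[OF d] by simp
        finally show False using dX_nz[OF v(1)] by simp
      qed
      then show "r \<in> ?B" using v(2) curv[OF v(1) ab] by blast
    next
      fix r assume "r \<in> ?B"
      then obtain a b where ab: "(a, b) \<noteq> (0, 0)"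
        "r = quad (h e1 e1) (h e1 e2) (h e2 e2) a b / quad (g e1 e1) (g e1 e2) (g e2 e2) a b" by blast
      obtain v k where v: "unit_tangent (\<sigma> x) v" "k > 0" "chart_dir x v = k *\<^sub>R (0, a, b)"
        using chart_dir_surj[OF ab(1)] .
      have "r = normal_curv (X t) (\<sigma> x) v"
        using curv[OF v(1), of "k * a" "k * b"] v(2,3) ab(2) by (simp add: scale)
      then show "r \<in> ?A" using v(1) by blast
    qed
  qed
  show "lambda1 (X t) (\<sigma> x) + lambda2 (X t) (\<sigma> x)
      = (h e1 e1 * g e2 e2 - 2 * h e1 e2 * g e1 e2 + h e2 e2 * g e1 e1) / (g e1 e1 * g e2 e2 - g e1 e2 * g e1 e2)"
    "lambda1 (X t) (\<sigma> x) * lambda2 (X t) (\<sigma> x)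
      = (h e1 e1 * h e2 e2 - h e1 e2 * h e1 e2) / (g e1 e1 * g e2 e2 - g e1 e2 * g e1 e2)"
    unfolding lambda1_def lambda2_def S by (rule Sup_Inf_Rayleigh[OF g11 gdet])+
qed

end

section \<open>The normal in a chart\<close>

lemma orthonormal_expansion:
  fixes a b c :: "real^3"
  assumes "a \<bullet> a = 1" "b \<bullet> b = 1" "c \<bullet> c = 1" "a \<bullet> b = 0" "a \<bullet> c = 0" "b \<bullet> c = 0"
  shows "v = (v \<bullet> a) *\<^sub>R a + (v \<bullet> b) *\<^sub>R b + (v \<bullet> c) *\<^sub>R c"
proof -
  have ne: "a \<noteq> b" "a \<noteq> c" "b \<noteq> c" "a \<noteq> 0" "b \<noteq> 0" "c \<noteq> 0" using assms by auto
  have "pairwise orthogonal {a, b, c}"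
    using assms by (auto simp: pairwise_def orthogonal_def inner_commute)
  then have ind: "independent {a, b, c}"
    using ne by (intro pairwise_orthogonal_independent) auto
  have "UNIV \<subseteq> span {a, b, c}"
    by (rule card_ge_dim_independent[OF _ ind]) (use ne in auto)
  define r where "r = v - ((v \<bullet> a) *\<^sub>R a + (v \<bullet> b) *\<^sub>R b + (v \<bullet> c) *\<^sub>R c)"
  have "r \<bullet> a = 0" "r \<bullet> b = 0" "r \<bullet> c = 0"
    using assms by (simp_all add: r_def inner_diff_left inner_add_left inner_diff_right inner_add_right inner_commute)
  then have "orthogonal r x" if "x \<in> {a, b, c}" for x
    using that by (auto simp: orthogonal_def)
  then have "orthogonal r r"
    using orthogonal_to_span[of "r" "{a, b, c}" r] \<open>UNIV \<subseteq> _\<close> by blast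
  then show ?thesis by (simp add: r_def orthogonal_def)
qed

lemma open_Collect_mem:
  assumes "continuous_on W f" "open W" "open A"
  shows "open {z \<in> W. f z \<in> A}"
proof -
  have "{z \<in> W. f z \<in> A} = W \<inter> f -` A" by auto
  then show ?thesis using continuous_open_preimage[OF assms] by simp
qed

lemma orthonormal_extension:
  fixes p :: "real^3"
  assumes "norm p = 1"
  obtains a b where "tangent_chart p a b"
proof -
  obtain f :: "real^3 \<Rightarrow> real^3" where f: "orthogonal_transformation f" "f (axis (1::3) 1) = p"
    by (rule orthogonal_transformation_exists_1[OF norm_axis_1[of "1::3"] assms])
  have i: "f x \<bullet> f y = x \<bullet> y" for x y
    using f(1) by (simp add: orthogonal_transformation_def)
  have "(1::3) \<noteq> 2" "(1::3) \<noteq> 3" "(2::3) \<noteq> 3" by simp_all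
  then have o: "p \<bullet> p = 1" "f (axis 2 1) \<bullet> f (axis 2 1) = 1" "f (axis 3 1) \<bullet> f (axis 3 1) = 1"
    "f (axis 2 1) \<bullet> p = 0" "f (axis 3 1) \<bullet> p = 0" "f (axis 2 1) \<bullet> f (axis 3 1) = 0"
    unfolding f(2)[symmetric] i by (auto simp: inner_axis_axis)
  have "tangent_chart p (f (axis 2 1)) (f (axis 3 1))"
    by unfold_locales (fact o orthonormal_expansion[OF o(2,3,1,6,4,5)])+
  then show thesis by (rule that)
qed

locale convex_flow =
  fixes X :: "real \<Rightarrow> real^3 \<Rightarrow> real^3" and T :: real and U :: "(real \<times> (real^3)) set"
  assumes smooth: "smooth_on U (\<lambda>(t, x). X t x)"
    and dom: "{0..<T} \<times> S2 \<subseteq> U"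
    and convex: "\<And>t. t \<in> {0..<T} \<Longrightarrow> strictly_convex_embedded (X t)"
    and flow: "\<And>t p. t \<in> {0..<T} \<Longrightarrow> p \<in> S2 \<Longrightarrow>
        ((\<lambda>\<tau>. X \<tau> p) has_vector_derivative
          ((normA2 (X t) p / (gaussK (X t) p)\<^sup>2) *\<^sub>R outer_normal (X t) p)) (at t)"
begin

lemma open_U: "open U"
  using smooth by (simp add: smooth_on_def)

lemma Cinf_X: "Cinf U (\<lambda>(t, x). X t x)"
  by (rule smooth_on_imp_Cinf[OF smooth])

end

locale flow_chart = convex_flow X T U + tangent_chart p0 u1 u2
  for X T U p0 u1 u2 +
  fixes t0 :: real and n1 n2 n3 :: "real^3"
  assumes t0: "t0 \<in> {0..<T}"
    and n: "n1 \<bullet> n1 = 1" "n2 \<bullet> n2 = 1" "n3 \<bullet> n3 = 1" "n1 \<bullet> n2 = 0" "n1 \<bullet> n3 = 0" "n2 \<bullet> n3 = 0"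
    and n3: "n3 = outer_normal (X t0) p0"
begin

abbreviation "Y \<equiv> Z X"

definition W0 :: "spacetime set" where "W0 = {z. (fst z, \<sigma> (snd z)) \<in> U}"

lemma W0: "open W0" "Cinf W0 Y"
  unfolding W0_def using open_U open_chart_domain Cinf_Z[OF Cinf_X] by auto

lemma mem_W0: "t \<in> {0..<T} \<Longrightarrow> (t, x) \<in> W0"
  using dom \<sigma>_sphere(1)[of x] by (auto simp: W0_def)

definition "\<zeta>1 z = Y z \<bullet> n1"
definition "\<zeta>2 z = Y z \<bullet> n2"
definition "\<zeta>3 z = Y z \<bullet> n3"

lemma Cinf_\<zeta>: "Cinf W0 \<zeta>1" "Cinf W0 \<zeta>2" "Cinf W0 \<zeta>3"
  unfolding \<zeta>1_def \<zeta>2_def \<zeta>3_def by (intro Cinf_inner W0 Cinf_const)+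

lemma pd_\<zeta>:
  assumes "z \<in> W0"
  shows "pd v \<zeta>1 z = pd v Y z \<bullet> n1" "pd v \<zeta>2 z = pd v Y z \<bullet> n2" "pd v \<zeta>3 z = pd v Y z \<bullet> n3"
  unfolding \<zeta>1_def[abs_def] \<zeta>2_def[abs_def] \<zeta>3_def[abs_def]
  using pd_inner[OF Cinf_differentiable[OF W0(2) assms]] by simp_all

lemma pd2_\<zeta>:
  assumes z: "z \<in> W0"
  shows "pd v (pd w \<zeta>1) z = pd v (pd w Y) z \<bullet> n1" "pd v (pd w \<zeta>2) z = pd v (pd w Y) z \<bullet> n2"
    "pd v (pd w \<zeta>3) z = pd v (pd w Y) z \<bullet> n3"
proof -
  have "pd v (pd w \<zeta>1) z = pd v (\<lambda>y. pd w Y y \<bullet> n1) z" "pd v (pd w \<zeta>2) z = pd v (\<lambda>y. pd w Y y \<bullet> n2) z"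
    "pd v (pd w \<zeta>3) z = pd v (\<lambda>y. pd w Y y \<bullet> n3) z"
    by (rule pd_cong_open[OF W0(1) _ z], erule pd_\<zeta>)+
  then show "pd v (pd w \<zeta>1) z = pd v (pd w Y) z \<bullet> n1" "pd v (pd w \<zeta>2) z = pd v (pd w Y) z \<bullet> n2"
    "pd v (pd w \<zeta>3) z = pd v (pd w Y) z \<bullet> n3"
    unfolding pd_inner[OF Cinf_differentiable[OF Cinf_pd[OF W0(2)] z]] .
qed

lemma n_expansion: "v = (v \<bullet> n1) *\<^sub>R n1 + (v \<bullet> n2) *\<^sub>R n2 + (v \<bullet> n3) *\<^sub>R n3"
  by (rule orthonormal_expansion[OF n])

lemma inner_n: "u \<bullet> v = (u \<bullet> n1) * (v \<bullet> n1) + (u \<bullet> n2) * (v \<bullet> n2) + (u \<bullet> n3) * (v \<bullet> n3)"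
  by (subst n_expansion[of v]) (simp add: inner_add_right mult.commute)

text \<open>\<open>C1\<close>, \<open>C2\<close>, \<open>C3\<close> are the frame components of the
  cross product of the chart derivatives of the position, a normal field as smooth as the surface;
  dividing by \<open>C3\<close> gives the slopes.\<close>

definition "C1 z = pd e1 \<zeta>2 z * pd e2 \<zeta>3 z - pd e1 \<zeta>3 z * pd e2 \<zeta>2 z"
definition "C2 z = pd e1 \<zeta>3 z * pd e2 \<zeta>1 z - pd e1 \<zeta>1 z * pd e2 \<zeta>3 z"
definition "C3 z = pd e1 \<zeta>1 z * pd e2 \<zeta>2 z - pd e1 \<zeta>2 z * pd e2 \<zeta>1 z"

definition "y1 z = C1 z / C3 z"
definition "y2 z = C2 z / C3 z"
definition "nn z = y1 z *\<^sub>R n1 + y2 z *\<^sub>R n2 + n3"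
definition "rho z = sqrt (1 + (y1 z)\<^sup>2 + (y2 z)\<^sup>2)"

lemma rho: "rho z > 0" "(rho z)\<^sup>2 = 1 + (y1 z)\<^sup>2 + (y2 z)\<^sup>2"
  by (simp_all add: rho_def add_pos_nonneg)

lemma nn_n: "nn z \<bullet> n1 = y1 z" "nn z \<bullet> n2 = y2 z" "nn z \<bullet> n3 = 1"
  using n by (simp_all add: nn_def inner_add_left inner_add_right inner_commute)

lemma Cinf_C: "Cinf W0 C1" "Cinf W0 C2" "Cinf W0 C3"
  unfolding C1_def C2_def C3_def by (intro Cinf_diff Cinf_mult W0(1) Cinf_pd Cinf_\<zeta>)+

definition "gg a b z = pd a Y z \<bullet> pd b Y z"
text \<open>Uses the explicit field \<open>nn\<close> instead of \<open>outer_normal\<close>, whose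
  definition by description carries no smoothness; \<open>local_normal\<close> identifies the
  two.\<close>

definition "hh a b z = - (pd a (pd b Y) z \<bullet> ((1 / rho z) *\<^sub>R nn z))"

abbreviation z0 :: spacetime where "z0 \<equiv> (t0, 0, 0)"

lemma z0_normal: "pd e1 \<zeta>3 z0 = 0" "pd e2 \<zeta>3 z0 = 0"
proof -
  have "(t0, 0::real, 0::real) \<in> W0" by (rule mem_W0[OF t0])
  then show "pd e1 \<zeta>3 z0 = 0" "pd e2 \<zeta>3 z0 = 0"
    using curvature_forms(1,2)[where x="(0,0)", OF W0(1) _ W0(2) convex[OF t0]]
    by (simp_all add: pd_\<zeta> \<sigma>_0 n3[symmetric] inner_commute)
qed

lemma C3_z0: "C3 z0 \<noteq> 0"
proof -
  have z: "z0 \<in> W0" by (rule mem_W0[OF t0])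
  have "pd e1 Y z0 \<bullet> pd e1 Y z0 * (pd e2 Y z0 \<bullet> pd e2 Y z0) - pd e1 Y z0 \<bullet> pd e2 Y z0 * (pd e1 Y z0 \<bullet> pd e2 Y z0) > 0"
    by (rule curvature_forms(4)[where x="(0,0)", OF W0(1) z W0(2) convex[OF t0]])
  \<comment> \<open>Lagrange's identity: the Gram determinant is the squared length of the cross
    product, whose first two components vanish here.\<close>
  also have "pd e1 Y z0 \<bullet> pd e1 Y z0 * (pd e2 Y z0 \<bullet> pd e2 Y z0) - pd e1 Y z0 \<bullet> pd e2 Y z0 * (pd e1 Y z0 \<bullet> pd e2 Y z0)
     = (C3 z0)\<^sup>2"
    unfolding inner_n[of "pd e1 Y z0"] inner_n[of "pd e2 Y z0"] pd_\<zeta>[OF z, symmetric] z0_normal C3_def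
    by algebra
  finally show ?thesis by auto
qed

lemma y_z0: "y1 z0 = 0" "y2 z0 = 0"
  by (simp_all add: y1_def y2_def C1_def C2_def z0_normal)

lemma normal_relation:
  assumes "C3 z \<noteq> 0"
  shows "pd e1 \<zeta>1 z * y1 z + pd e1 \<zeta>2 z * y2 z + pd e1 \<zeta>3 z = 0"
    "pd e2 \<zeta>1 z * y1 z + pd e2 \<zeta>2 z * y2 z + pd e2 \<zeta>3 z = 0"
proof -
  have y: "C3 z * y1 z = C1 z" "C3 z * y2 z = C2 z" using assms by (simp_all add: y1_def y2_def)
  have "C3 z * (pd e1 \<zeta>1 z * y1 z + pd e1 \<zeta>2 z * y2 z + pd e1 \<zeta>3 z) = 0"
    "C3 z * (pd e2 \<zeta>1 z * y1 z + pd e2 \<zeta>2 z * y2 z + pd e2 \<zeta>3 z) = 0"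
    using y unfolding C1_def C2_def C3_def by algebra+
  then show "pd e1 \<zeta>1 z * y1 z + pd e1 \<zeta>2 z * y2 z + pd e1 \<zeta>3 z = 0"
    "pd e2 \<zeta>1 z * y1 z + pd e2 \<zeta>2 z * y2 z + pd e2 \<zeta>3 z = 0"
    using assms by simp_all
qed

text \<open>Near the base point the outer normal is the normalised vector \<open>nn\<close>: its sign is pinned down by
  a point \<open>q\<close> of the surface lying strictly below the tangent plane.\<close>
lemma local_normal:
  obtains W where "open W" "z0 \<in> W" "W \<subseteq> W0" "\<And>z. z \<in> W \<Longrightarrow> C3 z \<noteq> 0"
    "\<And>z. z \<in> W \<Longrightarrow> fst z \<in> {0..<T} \<Longrightarrow> outer_normal (X (fst z)) (\<sigma> (snd z)) = (1 / rho z) *\<^sub>R nn z"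
proof -
  obtain q where q: "q \<in> S2" "(X t0 q - X t0 p0) \<bullet> n3 < 0"
    using convex_normal(4)[OF convex[OF t0], of p0] \<sigma>_sphere(1)[of "(0,0)"] unfolding \<sigma>_0 n3 by blast
  \<comment> \<open>The witness q, seen from the moving point, paired with \<open>nn\<close>:
    negative at the base point and, by continuity, nearby.\<close>
  define \<psi> where "\<psi> z = (X (fst z) q - Y z) \<bullet> (C1 z *\<^sub>R n1 + C2 z *\<^sub>R n2 + C3 z *\<^sub>R n3) / C3 z" for z
  define W1 where "W1 = W0 \<inter> (\<lambda>z. (fst z, q)) -` U"
  have "continuous_on UNIV (\<lambda>z::spacetime. (fst z, q))" by (intro continuous_intros)
  then have W1: "open W1" unfolding W1_def by (intro open_Int W0 open_vimage open_U)
  define W2 where "W2 = {z \<in> W1. C3 z \<noteq> 0}"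
  have "continuous_on W1 C3"
    by (rule continuous_on_subset[OF Cinf_continuous_on[OF Cinf_C(3)]]) (auto simp: W1_def)
  then have W2: "open W2"
    unfolding W2_def using open_Collect_mem[OF _ W1, of C3 "- {0}"] by auto
  have W2_sub: "W2 \<subseteq> W0" by (auto simp: W2_def W1_def)
  have "continuous_on W2 (\<lambda>z. X (fst z) q)"
  proof -
    have "continuous_on W2 (\<lambda>z. (\<lambda>(t, x). X t x) (fst z, q))"
      by (rule continuous_on_compose2[OF Cinf_continuous_on[OF Cinf_X]])
        (auto intro!: continuous_intros simp: W2_def W1_def)
    then show ?thesis by simp
  qed
  moreover have "continuous_on W2 Y" "continuous_on W2 C1" "continuous_on W2 C2" "continuous_on W2 C3"
    using Cinf_continuous_on[OF W0(2)] Cinf_C[THEN Cinf_continuous_on] W2_sub continuous_on_subset by blast+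
  ultimately have "continuous_on W2 \<psi>"
    unfolding \<psi>_def by (intro continuous_intros) (auto simp: W2_def)
  define W where "W = {z \<in> W2. \<psi> z < 0}"
  have W: "open W"
    unfolding W_def using open_Collect_mem[OF \<open>continuous_on W2 \<psi>\<close> W2, of "{..<0}"] by simp
  have \<psi>: "\<psi> z = (X (fst z) q - Y z) \<bullet> nn z" if "C3 z \<noteq> 0" for z
    using that by (simp add: \<psi>_def nn_def y1_def y2_def inner_add_right add_divide_distrib)
  show thesis
  proof (rule that[OF W])
    have "z0 \<in> W1" using mem_W0[OF t0] dom t0 q by (auto simp: W1_def)
    moreover have "\<psi> z0 < 0"
      unfolding \<psi>[OF C3_z0] using q(2) by (simp add: nn_def y_z0 Z_def \<sigma>_0)
    ultimately show "z0 \<in> W" using C3_z0 by (simp add: W_def W2_def)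
    show "W \<subseteq> W0" "\<And>z. z \<in> W \<Longrightarrow> C3 z \<noteq> 0" using W2_sub by (auto simp: W_def W2_def)
    fix z assume z: "z \<in> W" and t: "fst z \<in> {0..<T}"
    obtain t x where tx: "z = (t, x)" by (cases z)
    have zW: "z \<in> W0" "C3 z \<noteq> 0" "\<psi> z < 0" using z W2_sub by (auto simp: W_def W2_def)
    define m where "m = outer_normal (X t) (\<sigma> x)"
    have t': "t \<in> {0..<T}" using t tx by simp
    note cv = convex_normal[OF convex[OF t'] \<sigma>_sphere(1)[of x], folded m_def]
    have "m \<bullet> pd e1 Y z = 0" "m \<bullet> pd e2 Y z = 0"
      using curvature_forms(1,2)[OF W0(1) _ W0(2) convex[OF t'], of x] zW by (simp_all add: m_def tx)
    then have o: "(m \<bullet> n1) * pd e1 \<zeta>1 z + (m \<bullet> n2) * pd e1 \<zeta>2 z + (m \<bullet> n3) * pd e1 \<zeta>3 z = 0"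
      "(m \<bullet> n1) * pd e2 \<zeta>1 z + (m \<bullet> n2) * pd e2 \<zeta>2 z + (m \<bullet> n3) * pd e2 \<zeta>3 z = 0"
      unfolding inner_n[of m "pd e1 Y z"] inner_n[of m "pd e2 Y z"] pd_\<zeta>[OF zW(1)] by auto
    \<comment> \<open>Orthogonality to both chart derivatives makes m a multiple of their cross
      product, hence of \<open>nn z\<close>; the unit length then leaves only the sign open.\<close>
    have "C3 z * (m \<bullet> n1) = (m \<bullet> n3) * C1 z" "C3 z * (m \<bullet> n2) = (m \<bullet> n3) * C2 z"
      using o unfolding C1_def C2_def C3_def by algebra+
    then have mn: "m \<bullet> n1 = (m \<bullet> n3) * y1 z" "m \<bullet> n2 = (m \<bullet> n3) * y2 z"
      using zW(2) by (simp_all add: y1_def y2_def field_simps)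
    have m: "m = (m \<bullet> n3) *\<^sub>R nn z"
      by (subst n_expansion[of m]) (simp add: mn nn_def scaleR_add_right)
    have "1 = (norm m)\<^sup>2" using cv(1) by simp
    also have "\<dots> = ((m \<bullet> n3) * rho z)\<^sup>2"
      unfolding power2_norm_eq_inner inner_n[of m m] mn power_mult_distrib rho(2) by algebra
    finally have "\<bar>(m \<bullet> n3) * rho z\<bar> = 1" by (simp add: abs_square_eq_1)
    moreover have "(m \<bullet> n3) * \<psi> z \<le> 0"
    proof -
      have "(X t q - X t (\<sigma> x)) \<bullet> m \<le> 0" using cv(3)[OF q(1)] .
      then show ?thesis
        unfolding \<psi>[OF zW(2)] by (subst (asm) m) (simp add: tx Z_def)
    qed
    then have "m \<bullet> n3 \<ge> 0" using zW(3) by (simp add: mult_le_0_iff)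
    ultimately have "(m \<bullet> n3) * rho z = 1" using rho(1)[of z] by simp
    then have "m \<bullet> n3 = 1 / rho z" using rho(1)[of z] by (simp add: field_simps)
    then show "outer_normal (X (fst z)) (\<sigma> (snd z)) = (1 / rho z) *\<^sub>R nn z"
      using m by (simp add: m_def tx)
  qed
qed

end

section \<open>The pinching quotient along the flow\<close>

text \<open>With radii 1/l1 and 1/l2, tr/dh is their sum and dg/dh their product. Quotient and speed
  are symmetric in the radii, so they can be written in these two without separating the
  curvatures.\<close>

lemma pinching_in_forms:
  fixes l1 l2 tr dh dg :: real
  assumes pos: "l1 > 0" "l2 > 0" "dg > 0" and eq: "l1 + l2 = tr / dg" "l1 * l2 = dh / dg"
  shows "dh > 0" "tr > 0"
    and "(l1 - l2)\<^sup>2 / (2 * (l1 + l2) * l1 * l2) = ((tr / dh)\<^sup>2 - 4 * (dg / dh)) / (2 * (tr / dh))"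
    and "(l1\<^sup>2 + l2\<^sup>2) / (l1 * l2)\<^sup>2 = (tr / dh)\<^sup>2 - 2 * (dg / dh)"
proof -
  have e: "tr = (l1 + l2) * dg" "dh = l1 * l2 * dg" using eq pos by (simp_all add: field_simps)
  show "dh > 0" "tr > 0" using pos by (simp_all add: e)
  have r: "tr / dh = 1 / l1 + 1 / l2" "dg / dh = 1 / l1 * (1 / l2)"
    using pos by (simp_all add: e field_simps)
  show "(l1 - l2)\<^sup>2 / (2 * (l1 + l2) * l1 * l2) = ((tr / dh)\<^sup>2 - 4 * (dg / dh)) / (2 * (tr / dh))"
  proof -
    have "((tr / dh)\<^sup>2 - 4 * (dg / dh)) = (1 / l1 - 1 / l2)\<^sup>2"
      unfolding r by (simp add: power2_eq_square algebra_simps)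
    also have "\<dots> = (l1 - l2)\<^sup>2 / (l1 * l2)\<^sup>2"
      using pos by (simp add: power2_eq_square field_simps)
    finally have 1: "((tr / dh)\<^sup>2 - 4 * (dg / dh)) = (l1 - l2)\<^sup>2 / (l1 * l2)\<^sup>2" .
    have 2: "2 * (tr / dh) = 2 * (l1 + l2) / (l1 * l2)"
      unfolding r using pos by (simp add: field_simps)
    show ?thesis unfolding 1 2 using pos by (simp add: power2_eq_square)
  qed
  have "(l1\<^sup>2 + l2\<^sup>2) / (l1 * l2)\<^sup>2 = (1 / l1)\<^sup>2 + (1 / l2)\<^sup>2"
    using pos by (simp add: power2_eq_square field_simps)
  then show "(l1\<^sup>2 + l2\<^sup>2) / (l1 * l2)\<^sup>2 = (tr / dh)\<^sup>2 - 2 * (dg / dh)"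
    unfolding r by (simp add: power2_eq_square algebra_simps)
qed

locale flow_chart_nbhd = flow_chart X T U p0 u1 u2 t0 n1 n2 n3
  for X T U p0 u1 u2 t0 n1 n2 n3 +
  fixes W :: "spacetime set"
  assumes W: "open W" "z0 \<in> W" "W \<subseteq> W0"
    and C3: "\<And>z. z \<in> W \<Longrightarrow> C3 z \<noteq> 0"
    and normal: "\<And>z. z \<in> W \<Longrightarrow> fst z \<in> {0..<T} \<Longrightarrow>
      outer_normal (X (fst z)) (\<sigma> (snd z)) = (1 / rho z) *\<^sub>R nn z"
begin

definition "tr z = hh e1 e1 z * gg e2 e2 z - 2 * hh e1 e2 z * gg e1 e2 z + hh e2 e2 z * gg e1 e1 z"
definition "dh z = hh e1 e1 z * hh e2 e2 z - hh e1 e2 z * hh e1 e2 z"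
definition "dg z = gg e1 e1 z * gg e2 e2 z - gg e1 e2 z * gg e1 e2 z"
definition "pq z = ((tr z / dh z)\<^sup>2 - 4 * (dg z / dh z)) / (2 * (tr z / dh z))"

lemma Cinf_Y: "Cinf W Y"
  by (rule Cinf_subset[OF W0(2) W(3)])

lemma Cinf_\<zeta>': "Cinf W \<zeta>1" "Cinf W \<zeta>2" "Cinf W \<zeta>3"
  using Cinf_\<zeta> Cinf_subset W(3) by blast+

lemma Cinf_y: "Cinf W y1" "Cinf W y2"
  using Cinf_C[THEN Cinf_subset, OF W(3)] C3
  by (auto simp: y1_def[abs_def] y2_def[abs_def] intro!: Cinf_divide W(1))

lemma Cinf_rho: "Cinf W rho"
  unfolding rho_def[abs_def]
  by (intro Cinf_sqrt Cinf_add Cinf_power Cinf_const W(1) Cinf_y) (simp add: add_pos_nonneg)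

lemma Cinf_forms: "Cinf W (gg a b)" "Cinf W (hh a b)"
proof -
  show "Cinf W (gg a b)"
    unfolding gg_def[abs_def] by (intro Cinf_inner W(1) Cinf_pd Cinf_Y)
  have "Cinf W (\<lambda>z. 1 / rho z)"
    by (rule Cinf_divide[OF W(1) Cinf_const[OF W(1)] Cinf_rho]) (metis rho(1) less_irrefl)
  moreover have "Cinf W nn"
    unfolding nn_def[abs_def] by (intro Cinf_add Cinf_scaleR Cinf_const W(1) Cinf_y)
  ultimately show "Cinf W (hh a b)"
    unfolding hh_def[abs_def] by (intro Cinf_minus Cinf_inner Cinf_scaleR W(1) Cinf_pd Cinf_Y)
qed

lemma Cinf_dets: "Cinf W tr" "Cinf W dh" "Cinf W dg"
  unfolding tr_def[abs_def] dh_def[abs_def] dg_def[abs_def]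
  by (intro Cinf_add Cinf_diff Cinf_mult Cinf_const W(1) Cinf_forms)+

lemma curvatures:
  assumes z: "z \<in> W" "fst z \<in> {0..<T}"
  shows "tr z > 0" "dh z > 0" "dg z > 0"
    and "pinching_quot (X (fst z)) (\<sigma> (snd z)) = pq z"
    and "normA2 (X (fst z)) (\<sigma> (snd z)) / (gaussK (X (fst z)) (\<sigma> (snd z)))\<^sup>2 = (tr z / dh z)\<^sup>2 - 2 * (dg z / dh z)"
proof -
  obtain t x where tx: "z = (t, x)" by (cases z)
  have t: "t \<in> {0..<T}" using z(2) tx by simp
  have zW: "(t, x) \<in> W0" using z(1) W(3) tx by auto
  note cf = curvature_forms[OF W0(1) zW W0(2) convex[OF t]]
  have n: "outer_normal (X t) (\<sigma> x) = (1 / rho (t, x)) *\<^sub>R nn (t, x)"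
    using normal[OF z] tx by simp
  have l: "lambda1 (X t) (\<sigma> x) > 0" "lambda2 (X t) (\<sigma> x) > 0"
    using convex[OF t] \<sigma>_sphere(1)[of x] by (auto simp: strictly_convex_embedded_def)
  have g: "dg z > 0" unfolding dg_def gg_def tx by (rule cf(4))
  have "lambda1 (X t) (\<sigma> x) + lambda2 (X t) (\<sigma> x) = tr z / dg z"
    "lambda1 (X t) (\<sigma> x) * lambda2 (X t) (\<sigma> x) = dh z / dg z"
    using cf(5,6) unfolding n tr_def dg_def dh_def gg_def hh_def tx by simp_all
  note p = pinching_in_forms[OF l g this]
  show "tr z > 0" "dh z > 0" "dg z > 0" using p(1,2) g by simp_all
  show "pinching_quot (X (fst z)) (\<sigma> (snd z)) = pq z"
    "normA2 (X (fst z)) (\<sigma> (snd z)) / (gaussK (X (fst z)) (\<sigma> (snd z)))\<^sup>2 = (tr z / dh z)\<^sup>2 - 2 * (dg z / dh z)"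
    using p(3,4) by (simp_all add: tx pinching_quot_def pq_def normA2_def gaussK_def)
qed

lemma fst_z0: "fst z0 \<in> {0..<T}" using t0 by simp

lemma continuous_pinching:
  "((\<lambda>(t, p). pinching_quot (X t) p) \<longlongrightarrow> pinching_quot (X t0) p0) (at (t0, p0) within {0..<T} \<times> S2)"
proof -
  \<comment> \<open>Central projection into the chart, inverse to \<open>\<sigma>\<close> where the
    product with p0 is positive.\<close>
  define F where "F a = (fst a, (snd a \<bullet> u1) / (snd a \<bullet> p0), (snd a \<bullet> u2) / (snd a \<bullet> p0))" for a :: "real \<times> (real^3)"
  have F0: "F (t0, p0) = z0" using on by (simp add: F_def inner_commute)
  have "isCont F (t0, p0)"
    unfolding F_def using on by (intro continuous_intros) auto
  then have F: "(F \<longlongrightarrow> z0) (at (t0, p0) within {0..<T} \<times> S2)"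
    using F0 by (metis isCont_def tendsto_within_subset subset_UNIV)
  \<comment> \<open>\<open>curvatures\<close> controls the denominators only for times in the
    interval, so an open set where they are nonzero is cut out.\<close>
  define W' where "W' = {z \<in> {z \<in> W. dh z \<in> - {0}}. tr z \<in> - {0}}"
  have W1: "open {z \<in> W. dh z \<in> - {0}}"
    by (rule open_Collect_mem[OF Cinf_continuous_on[OF Cinf_dets(2)] W(1)]) (rule open_Compl, simp)
  have W': "open W'" unfolding W'_def
    by (rule open_Collect_mem[OF continuous_on_subset[OF Cinf_continuous_on[OF Cinf_dets(1)]] W1]) auto
  have z0W: "z0 \<in> W'" using curvatures(1,2)[OF W(2) fst_z0] W(2) by (auto simp: W'_def)
  have "continuous_on W' tr" "continuous_on W' dh" "continuous_on W' dg"
    using Cinf_dets[THEN Cinf_continuous_on] by (auto intro: continuous_on_subset simp: W'_def)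
  then have "continuous_on W' pq"
    unfolding pq_def[abs_def] by (intro continuous_intros) (auto simp: W'_def)
  then have "isCont pq z0" using W' z0W by (simp add: continuous_on_eq_continuous_at)
  then have lim: "((\<lambda>a. pq (F a)) \<longlongrightarrow> pq z0) (at (t0, p0) within {0..<T} \<times> S2)"
    by (rule isCont_tendsto_compose[OF _ F])
  have ev1: "\<forall>\<^sub>F a in at (t0, p0) within {0..<T} \<times> S2. F a \<in> W"
    using topological_tendstoD[OF F W(1,2)] .
  have "((\<lambda>a. snd a \<bullet> p0) \<longlongrightarrow> snd (t0, p0) \<bullet> p0) (at (t0, p0) within {0..<T} \<times> S2)"
    by (intro tendsto_intros)
  then have ev2: "\<forall>\<^sub>F a in at (t0, p0) within {0..<T} \<times> S2. snd a \<bullet> p0 > 0"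
    using on by (intro order_tendstoD) auto
  have ev3: "\<forall>\<^sub>F a in at (t0, p0) within {0..<T} \<times> S2. a \<in> {0..<T} \<times> S2"
    by (simp add: eventually_at_filter)
  have "\<forall>\<^sub>F a in at (t0, p0) within {0..<T} \<times> S2. pq (F a) = (case a of (t, p) \<Rightarrow> pinching_quot (X t) p)"
    using ev1 ev2 ev3
  proof eventually_elim
    case (elim a)
    obtain t p where a: "a = (t, p)" by (cases a)
    have "\<sigma> (snd (F a)) = p"
    proof (rule \<sigma>_eqI)
      show "norm p = 1" "1 / (p \<bullet> p0) > 0" using elim a by auto
      have "(1 / (p \<bullet> p0)) *\<^sub>R p = (1 / (p \<bullet> p0)) *\<^sub>R ((p \<bullet> u1) *\<^sub>R u1 + (p \<bullet> u2) *\<^sub>R u2 + (p \<bullet> p0) *\<^sub>R p0)"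
        using span[of p] by simp
      also have "\<dots> = \<phi> (snd (F a))"
        using elim(2) by (simp add: a F_def \<phi>_def scaleR_add_right)
      finally show "\<phi> (snd (F a)) = (1 / (p \<bullet> p0)) *\<^sub>R p" ..
    qed
    then show ?case using curvatures(4)[OF elim(1)] elim(3) a by (simp add: F_def)
  qed
  from tendsto_cong[THEN iffD1, OF this lim] show ?thesis
    using curvatures(4)[OF W(2) fst_z0] by (simp add: \<sigma>_0)
qed

lemma hh_sym:
  assumes z: "z \<in> W"
  shows "hh a b z = hh b a z"
proof -
  have zW: "z \<in> W0" using z W(3) by blast
  have "hh a b z = - ((pd a (pd b \<zeta>1) z * y1 z + pd a (pd b \<zeta>2) z * y2 z + pd a (pd b \<zeta>3) z) / rho z)" for a b
    unfolding hh_def inner_scaleR_right inner_n[of "pd a (pd b Y) z" "nn z"] nn_n pd2_\<zeta>[OF zW] by simp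
  then show ?thesis using pd_commute[OF W0(1) zW] Cinf_\<zeta> by simp
qed

text \<open>Differentiating the orthogonality relation moves one derivative from the position to the
  normal, which turns \<open>hh\<close> into the form used in \<open>graph_flow\<close>.\<close>

lemma second_form_eq:
  assumes z: "z \<in> W"
  shows "(pd e1 \<zeta>1 z * pd b y1 z + pd e1 \<zeta>2 z * pd b y2 z) / rho z = hh e1 b z"
    "(pd e2 \<zeta>1 z * pd b y1 z + pd e2 \<zeta>2 z * pd b y2 z) / rho z = hh e2 b z"
proof -
  have zW: "z \<in> W0" using z W(3) by blast
  have *: "(pd a \<zeta>1 z * pd b y1 z + pd a \<zeta>2 z * pd b y2 z) / rho z = hh a b z"
    if rel: "\<And>x. x \<in> W \<Longrightarrow> pd a \<zeta>1 x * y1 x + pd a \<zeta>2 x * y2 x + pd a \<zeta>3 x = 0" for a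
  proof -
    have "pd b (\<lambda>x. pd a \<zeta>1 x * y1 x + pd a \<zeta>2 x * y2 x + pd a \<zeta>3 x) z = pd b (\<lambda>x. 0) z"
      by (rule pd_cong_open[OF W(1) rel z])
    then have S: "pd b (pd a \<zeta>1) z * y1 z + pd b (pd a \<zeta>2) z * y2 z + pd b (pd a \<zeta>3) z
        = - (pd a \<zeta>1 z * pd b y1 z + pd a \<zeta>2 z * pd b y2 z)"
      using Cinf_\<zeta>'[THEN Cinf_pd, THEN Cinf_differentiable, OF z] Cinf_y[THEN Cinf_differentiable, OF z]
      by (simp add: pd_add pd_mult pd_const differentiable_mult differentiable_add algebra_simps)
    have "hh b a z = - ((pd b (pd a \<zeta>1) z * y1 z + pd b (pd a \<zeta>2) z * y2 z + pd b (pd a \<zeta>3) z) / rho z)"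
      unfolding hh_def inner_scaleR_right inner_n[of "pd b (pd a Y) z" "nn z"] nn_n pd2_\<zeta>[OF zW] by simp
    then have "hh b a z = (pd a \<zeta>1 z * pd b y1 z + pd a \<zeta>2 z * pd b y2 z) / rho z"
      unfolding S by (simp only: minus_divide_left minus_minus)
    then show ?thesis using hh_sym[OF z] by simp
  qed
  show "(pd e1 \<zeta>1 z * pd b y1 z + pd e1 \<zeta>2 z * pd b y2 z) / rho z = hh e1 b z"
    "(pd e2 \<zeta>1 z * pd b y1 z + pd e2 \<zeta>2 z * pd b y2 z) / rho z = hh e2 b z"
    using *[of e1] *[of e2] normal_relation C3 by blast+
qed

lemma first_form_eq:
  assumes z: "z \<in> W"
  shows "pd a \<zeta>1 z * pd b \<zeta>1 z + pd a \<zeta>2 z * pd b \<zeta>2 z + pd a \<zeta>3 z * pd b \<zeta>3 z = gg a b z"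
proof -
  have zW: "z \<in> W0" using z W(3) by blast
  show ?thesis unfolding gg_def inner_n[of "pd a Y z" "pd b Y z"] pd_\<zeta>[OF zW] ..
qed

lemma pd_time:
  assumes z: "z \<in> W" "fst z \<in> {0..<T}"
  shows "pd e0 Y z = (((tr z / dh z)\<^sup>2 - 2 * (dg z / dh z)) / rho z) *\<^sub>R nn z"
proof -
  obtain t x where tx: "z = (t, x)" by (cases z)
  have "((\<lambda>r. Y ((0, x) + r *\<^sub>R e0)) has_vector_derivative pd e0 Y ((0, x) + t *\<^sub>R e0)) (at t)"
    by (rule has_vector_derivative_line) (use Cinf_differentiable[OF Cinf_Y z(1)] tx in \<open>cases x, simp\<close>)
  then have "((\<lambda>\<tau>. X \<tau> (\<sigma> x)) has_vector_derivative pd e0 Y z) (at t)"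
    by (cases x) (simp add: Z_def tx)
  from vector_derivative_unique_at[OF this flow[of t "\<sigma> x"]] z(2) \<sigma>_sphere(1)[of x]
  have "pd e0 Y z = (normA2 (X t) (\<sigma> x) / (gaussK (X t) (\<sigma> x))\<^sup>2) *\<^sub>R outer_normal (X t) (\<sigma> x)"
    by (simp add: tx)
  then show ?thesis
    using curvatures(5)[OF z] normal[OF z] by (simp add: tx)
qed

theorem pinching_decreasing:
  assumes pos: "t0 > 0" and nz: "pinching_quot (X t0) p0 \<noteq> 0"
    and diag: "pd e2 \<zeta>1 z0 * pd e1 y1 z0 = pd e1 \<zeta>1 z0 * pd e2 y1 z0"
    and max: "\<And>p. p \<in> S2 \<Longrightarrow> pinching_quot (X t0) p \<le> pinching_quot (X t0) p0"
  shows "\<exists>d<0. ((\<lambda>\<tau>. pinching_quot (X \<tau>) p0) has_real_derivative d) (at t0)"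
proof -
  \<comment> \<open>An open set on which the flow equation holds throughout, hence times strictly
    between 0 and T.\<close>
  define V where "V = {z \<in> W. fst z \<in> {0<..<T}}"
  have V: "open V" unfolding V_def by (intro open_Collect_mem continuous_intros W(1))
  have VW: "V \<subseteq> W" and Vt: "\<And>z. z \<in> V \<Longrightarrow> fst z \<in> {0..<T}" by (auto simp: V_def)
  have VW0: "V \<subseteq> W0" using VW W(3) by blast
  have z0V: "z0 \<in> V" using W(2) pos t0 by (simp add: V_def)
  have cv: "tr z > 0" "dh z > 0" "dg z > 0" if "z \<in> V" for z
    using curvatures(1-3)[of z] that VW Vt by blast+
  \<comment> \<open>The determinant of the second form times \<open>rho\<close>^2 is
    \<open>C3\<close> times the Jacobian of the slopes, and strict convexity keeps it from
    vanishing.\<close>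
  have J: "pd e1 y1 z * pd e2 y2 z - pd e2 y1 z * pd e1 y2 z \<noteq> 0" if z: "z \<in> V" for z
  proof
    assume J: "pd e1 y1 z * pd e2 y2 z - pd e2 y1 z * pd e1 y2 z = 0"
    have zW: "z \<in> W" using z VW by blast
    have r: "rho z \<noteq> 0" using rho(1)[of z] by simp
    have h: "rho z * hh a b z = pd a \<zeta>1 z * pd b y1 z + pd a \<zeta>2 z * pd b y2 z" if "a = e1 \<or> a = e2" for a b
      using second_form_eq[OF zW, of b, symmetric] r that by auto
    have "rho z * hh e1 e1 z * (rho z * hh e2 e2 z) - rho z * hh e1 e2 z * (rho z * hh e2 e1 z) = 0"
      using J unfolding h[OF disjI1[OF refl]] h[OF disjI2[OF refl]] by algebra
    then have "(rho z)\<^sup>2 * dh z = 0"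
      unfolding dh_def hh_sym[OF zW, of e2 e1] by algebra
    then show False using r cv(2)[OF z] by simp
  qed
  interpret G: graph_flow V y1 y2 \<zeta>1 \<zeta>2 \<zeta>3
    by unfold_locales (use V J Cinf_y Cinf_\<zeta>' Cinf_subset[OF _ VW] normal_relation C3 VW in blast)+
  have rho: "G.\<rho> z = rho z" for z by (simp add: G.\<rho>_def rho_def)
  have sf: "G.second_form e1 b z = hh e1 b z" "G.second_form e2 b z = hh e2 b z" if "z \<in> V" for b z
    using second_form_eq that VW unfolding G.second_form_def rho by blast+
  have ff: "G.first_form a b z = gg a b z" if "z \<in> V" for a b z
    using first_form_eq that VW unfolding G.first_form_def by blast
  have det: "G.det_second z = dh z" if "z \<in> V" for z
    unfolding G.det_second_def dh_def sf[OF that] ..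
  have rs: "G.radii_sum z = tr z / dh z" "G.radii_prod z = dg z / dh z" if "z \<in> V" for z
    unfolding G.radii_sum_def G.radii_prod_def tr_def dg_def det[OF that] sf[OF that] ff[OF that] by (rule refl)+
  have Cpq: "Cinf V pq"
  proof -
    have nz: "dh z \<noteq> 0" "2 * (tr z / dh z) \<noteq> 0" if "z \<in> V" for z using cv[OF that] by auto
    note D = Cinf_dets[THEN Cinf_subset, OF VW]
    note q = Cinf_divide[OF V D(1) D(2) nz(1)] Cinf_divide[OF V D(3) D(2) nz(1)]
    show ?thesis unfolding pq_def[abs_def]
      by (rule Cinf_divide[OF V Cinf_diff[OF V Cinf_power[OF V q(1)] Cinf_mult[OF V Cinf_const[OF V] q(2)]]
            Cinf_mult[OF V Cinf_const[OF V] q(1)] nz(2)])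
  qed
  have pq0: "pq z0 = pinching_quot (X t0) p0"
    using curvatures(4)[OF W(2) fst_z0] by (simp add: \<sigma>_0)
  have time: "pd e0 \<zeta>1 z = ((G.radii_sum z)\<^sup>2 - 2 * G.radii_prod z) * (y1 z / G.\<rho> z)"
      "pd e0 \<zeta>2 z = ((G.radii_sum z)\<^sup>2 - 2 * G.radii_prod z) * (y2 z / G.\<rho> z)"
      "pd e0 \<zeta>3 z = ((G.radii_sum z)\<^sup>2 - 2 * G.radii_prod z) * (1 / G.\<rho> z)" if z: "z \<in> V" for z
    using pd_time[of z] z VW VW0 Vt[OF z]
    by (auto simp: pd_\<zeta> rs rho nn_n subset_eq)
  have "pd e0 pq z0 < 0"
  proof (rule G.time_derivative_neg[OF Cpq _ time _ z0V y_z0 diag])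
    show "G.det_second z \<noteq> 0" if "z \<in> V" for z using cv[OF that] by (simp add: det[OF that])
    show "2 * pq z * G.radii_sum z = (G.radii_sum z)\<^sup>2 - 4 * G.radii_prod z" if "z \<in> V" for z
      unfolding rs[OF that] pq_def using cv[OF that] by simp
    show "G.radii_sum z0 > 0" "G.radii_prod z0 > 0" unfolding rs[OF z0V] using cv[OF z0V] by simp_all
    show "pq z0 \<noteq> 0" using nz by (simp add: pq0)
    fix s a b assume v: "z0 + s *\<^sub>R (0, a, b) \<in> V"
    have "pq (z0 + s *\<^sub>R (0, a, b)) = pinching_quot (X t0) (\<sigma> (s * a, s * b))"
      using curvatures(4)[of "z0 + s *\<^sub>R (0, a, b)"] v VW Vt[OF v] by auto
    then show "pq (z0 + s *\<^sub>R (0, a, b)) \<le> pq z0"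
      using max[OF \<sigma>_sphere(1)] by (simp add: pq0)
  qed
  moreover have "((\<lambda>\<tau>. pinching_quot (X \<tau>) p0) has_real_derivative pd e0 pq z0) (at t0)"
  proof -
    have "((\<lambda>r. pq ((0, 0, 0) + r *\<^sub>R e0)) has_vector_derivative pd e0 pq ((0, 0, 0) + t0 *\<^sub>R e0)) (at t0)"
      by (rule has_vector_derivative_line) (use Cinf_differentiable[OF Cpq z0V] in \<open>simp add: zero_prod_def\<close>)
    then have D: "((\<lambda>r. pq (r, 0, 0)) has_vector_derivative pd e0 pq z0) (at t0)"
      by simp
    have "open ((\<lambda>r. (r, 0, 0)) -` V)"
      by (rule open_vimage[OF V]) (intro continuous_intros)
    then have "((\<lambda>\<tau>. pinching_quot (X \<tau>) p0) has_vector_derivative pd e0 pq z0) (at t0)"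
    proof (rule has_vector_derivative_transform_within_open[OF D])
      show "t0 \<in> (\<lambda>r. (r, 0, 0)) -` V" using z0V by simp
      show "pq (r, 0, 0) = pinching_quot (X r) p0" if "r \<in> (\<lambda>r. (r, 0, 0)) -` V" for r
        using curvatures(4)[of "(r, 0, 0)"] that VW Vt[of "(r, 0, 0)"] by (auto simp: \<sigma>_0)
    qed
    then show ?thesis by (simp add: has_real_derivative_iff_has_vector_derivative)
  qed
  ultimately show ?thesis by blast
qed

end

section \<open>Continuity over the whole sphere and the maximum principle\<close>

context convex_flow
begin

lemma continuous_on_pinching: "continuous_on ({0..<T} \<times> S2) (\<lambda>(t, p). pinching_quot (X t) p)"
  unfolding continuous_on_def
proof (intro ballI)
  fix z assume "z \<in> {0..<T} \<times> S2"
  then obtain t0 p0 where z: "z = (t0, p0)" "t0 \<in> {0..<T}" "p0 \<in> S2" by blast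
  obtain u1 u2 where u: "tangent_chart p0 u1 u2"
    using orthonormal_extension[of p0] z(3) by auto
  define n3 where "n3 = outer_normal (X t0) p0"
  obtain n1 n2 where n: "tangent_chart n3 n1 n2"
    using orthonormal_extension[OF convex_normal(1)[OF convex[OF z(2)] z(3)], folded n3_def] by blast
  interpret F: flow_chart X T U p0 u1 u2 t0 n1 n2 n3
    by (intro flow_chart.intro flow_chart_axioms.intro convex_flow_axioms u)
      (use z(2) tangent_chart.on[OF n] in \<open>auto simp: n3_def\<close>)
  obtain W where W: "open W" "(t0, 0, 0) \<in> W" "W \<subseteq> F.W0" "\<And>z. z \<in> W \<Longrightarrow> F.C3 z \<noteq> 0"
    "\<And>z. z \<in> W \<Longrightarrow> fst z \<in> {0..<T} \<Longrightarrow> outer_normal (X (fst z)) (F.\<sigma> (snd z)) = (1 / F.rho z) *\<^sub>R F.nn z"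
    by (rule F.local_normal) blast
  interpret G: flow_chart_nbhd X T U p0 u1 u2 t0 n1 n2 n3 W
    by unfold_locales (use W in auto)
  show "((\<lambda>(t, p). pinching_quot (X t) p) \<longlongrightarrow> (case z of (t, p) \<Rightarrow> pinching_quot (X t) p)) (at z within {0..<T} \<times> S2)"
    using G.continuous_pinching by (simp add: z)
qed

text \<open>The frame \<open>n1, n2\<close> is chosen along the principal directions, so that the Hessian of the support
  function is diagonal at the base point.\<close>
lemma pinching_decreasing_at_max:
  assumes t0: "0 < t0" "t0 < T" and p0: "p0 \<in> S2" and nz: "pinching_quot (X t0) p0 \<noteq> 0"
    and max: "\<And>p. p \<in> S2 \<Longrightarrow> pinching_quot (X t0) p \<le> pinching_quot (X t0) p0"
  shows "\<exists>d<0. ((\<lambda>\<tau>. pinching_quot (X \<tau>) p0) has_real_derivative d) (at t0)"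
proof -
  have t: "t0 \<in> {0..<T}" using t0 by simp
  obtain u1 u2 where u: "tangent_chart p0 u1 u2"
    using orthonormal_extension[of p0] p0 by auto
  define n3 where "n3 = outer_normal (X t0) p0"
  have n3: "n3 \<bullet> n3 = 1" using convex_normal(1)[OF convex[OF t] p0] by (simp add: n3_def norm_eq_1)
  interpret C: tangent_chart p0 u1 u2 by (rule u)
  define W where "W = {z::spacetime. (fst z, C.\<sigma> (snd z)) \<in> U}"
  have W: "open W" "Cinf W (C.Z X)"
    unfolding W_def using open_U C.open_chart_domain C.Cinf_Z[OF Cinf_X] by auto
  have z0: "(t0, 0, 0) \<in> W"
    using dom t p0 by (auto simp: W_def C.\<sigma>_0)
  note cf = C.curvature_forms[OF W(1) z0 W(2) convex[OF t], unfolded C.\<sigma>_0, folded n3_def]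
  define A1 where "A1 = pd e1 (C.Z X) (t0, 0, 0)"
  define A2 where "A2 = pd e2 (C.Z X) (t0, 0, 0)"
  define h where "h a b = - (pd a (pd b (C.Z X)) (t0, 0, 0) \<bullet> n3)" for a b
  \<comment> \<open>Chart directions that are g-orthonormal and h-conjugate: their images n1, n2 are
    orthonormal principal directions.\<close>
  obtain a b c d where q: "quad (A1 \<bullet> A1) (A1 \<bullet> A2) (A2 \<bullet> A2) a b = 1" "quad (A1 \<bullet> A1) (A1 \<bullet> A2) (A2 \<bullet> A2) c d = 1"
    "(A1 \<bullet> A1)*a*c + (A1 \<bullet> A2)*(a*d + b*c) + (A2 \<bullet> A2)*b*d = 0"
    "h e1 e1*a*c + h e1 e2*(a*d + b*c) + h e2 e2*b*d = 0"
    by (rule simultaneous_diagonalisation[OF cf(3,4), folded A1_def A2_def])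
  define n1 where "n1 = a *\<^sub>R A1 + b *\<^sub>R A2"
  define n2 where "n2 = c *\<^sub>R A1 + d *\<^sub>R A2"
  have on: "n1 \<bullet> n1 = 1" "n2 \<bullet> n2 = 1" "n1 \<bullet> n2 = 0"
    using q(1-3) unfolding n1_def n2_def quad_def
    by (simp_all add: inner_add_left inner_add_right inner_commute power2_eq_square algebra_simps)
  have on3: "n1 \<bullet> n3 = 0" "n2 \<bullet> n3 = 0"
    using cf(1,2) by (simp_all add: n1_def n2_def A1_def A2_def inner_add_left inner_add_right inner_commute)
  interpret F: flow_chart X T U p0 u1 u2 t0 n1 n2 n3
    by (intro flow_chart.intro flow_chart_axioms.intro convex_flow_axioms u t on on3 n3 n3_def)
  obtain W' where W': "open W'" "(t0, 0, 0) \<in> W'" "W' \<subseteq> F.W0" "\<And>z. z \<in> W' \<Longrightarrow> F.C3 z \<noteq> 0"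
    "\<And>z. z \<in> W' \<Longrightarrow> fst z \<in> {0..<T} \<Longrightarrow> outer_normal (X (fst z)) (C.\<sigma> (snd z)) = (1 / F.rho z) *\<^sub>R F.nn z"
    by (rule F.local_normal) blast
  interpret G: flow_chart_nbhd X T U p0 u1 u2 t0 n1 n2 n3 W'
    by unfold_locales (use W' in auto)
  define z where "z = ((t0, 0, 0) :: spacetime)"
  have zW: "z \<in> W'" "z \<in> F.W0" using W' by (auto simp: z_def)
  have y: "F.y1 z = 0" "F.y2 z = 0" using F.y_z0 by (simp_all add: z_def)
  have rho: "F.rho z = 1" and nn: "F.nn z = n3" by (simp_all add: F.rho_def F.nn_def y)
  have hh: "F.hh v w z = h v w" for v w unfolding F.hh_def h_def rho nn by (simp add: z_def)
  define x1 where "x1 = A1 \<bullet> n1"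
  define x2 where "x2 = A2 \<bullet> n1"
  define w1 where "w1 = A1 \<bullet> n2"
  define w2 where "w2 = A2 \<bullet> n2"
  have x: "pd e1 F.\<zeta>1 z = x1" "pd e2 F.\<zeta>1 z = x2" "pd e1 F.\<zeta>2 z = w1" "pd e2 F.\<zeta>2 z = w2"
    using F.pd_\<zeta>(1,2)[OF zW(2)] by (simp_all add: x1_def x2_def w1_def w2_def A1_def A2_def z_def)
  have "n1 \<bullet> v = a * (A1 \<bullet> v) + b * (A2 \<bullet> v)" "n2 \<bullet> v = c * (A1 \<bullet> v) + d * (A2 \<bullet> v)" for v
    by (simp_all add: n1_def n2_def inner_add_left)
  from this(1)[of n1] this(1)[of n2] this(2)[of n1]
  have o: "a * x1 + b * x2 = 1" "a * w1 + b * w2 = 0" "c * x1 + d * x2 = 0"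
    unfolding x1_def x2_def w1_def w2_def using on inner_commute[of n2 n1] by simp_all
  note sf = G.second_form_eq[OF zW(1), unfolded x rho hh div_by_1]
  have sym: "h e2 e1 = h e1 e2" using G.hh_sym[OF zW(1)] by (simp add: hh)
  define a1 where "a1 = pd e1 F.y1 z"
  define a2 where "a2 = pd e2 F.y1 z"
  define b1 where "b1 = pd e1 F.y2 z"
  define b2 where "b2 = pd e2 F.y2 z"
  have h: "h e1 e1 = x1 * a1 + w1 * b1" "h e1 e2 = x1 * a2 + w1 * b2" "h e1 e2 = x2 * a1 + w2 * b1" "h e2 e2 = x2 * a2 + w2 * b2"
    using sf[of e1] sf[of e2] sym by (simp_all add: a1_def a2_def b1_def b2_def)
  \<comment> \<open>Conjugacy of n1 and n2 becomes the vanishing of the derivative of y1 in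
    direction n2.\<close>
  have "h e1 e1*a*c + h e1 e2*(a*d) + h e1 e2*(b*c) + h e2 e2*b*d = 0"
    using q(4) by (simp add: algebra_simps)
  moreover have "h e1 e1*a*c + h e1 e2*(a*d) + h e1 e2*(b*c) + h e2 e2*b*d
      = c * ((a * x1 + b * x2) * a1 + (a * w1 + b * w2) * b1) + d * ((a * x1 + b * x2) * a2 + (a * w1 + b * w2) * b2)"
    using h by algebra
  ultimately have "c * a1 + d * a2 = 0" using o by simp
  \<comment> \<open>The nonzero (c, d) annihilates both (x1, x2) and (a1, a2), so these are
    parallel, which is the required diagonality.\<close>
  then have "c * (x2 * a1 - x1 * a2) = 0" "d * (x2 * a1 - x1 * a2) = 0" using o(3) by algebra+
  moreover have "c \<noteq> 0 \<or> d \<noteq> 0" using q(2) by (auto simp: quad_def)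
  ultimately have "x2 * a1 = x1 * a2" by auto
  then have "pd e2 F.\<zeta>1 z * pd e1 F.y1 z = pd e1 F.\<zeta>1 z * pd e2 F.y1 z"
    by (simp add: x a1_def a2_def)
  then show ?thesis
    using G.pinching_decreasing[OF t0(1) nz _ max] by (simp add: z_def)
qed

lemma pinching_nonneg:
  assumes "t \<in> {0..<T}" "p \<in> S2"
  shows "pinching_quot (X t) p \<ge> 0"
proof -
  have "lambda1 (X t) p > 0" "lambda2 (X t) p > 0"
    using convex[OF assms(1)] assms(2) by (auto simp: strictly_convex_embedded_def)
  then show ?thesis
    unfolding pinching_quot_def by (intro divide_nonneg_pos mult_pos_pos add_pos_pos) auto
qed

end

theorem theorem10p3:
  fixes X :: "real \<Rightarrow> real^3 \<Rightarrow> real^3" and T :: real and U :: "(real \<times> (real^3)) set"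
  assumes smooth: "smooth_on U (\<lambda>(t, x). X t x)"
    and dom: "{0..<T} \<times> S2 \<subseteq> U"
    and convex: "\<And>t. t \<in> {0..<T} \<Longrightarrow> strictly_convex_embedded (X t)"
    and flow: "\<And>t p. t \<in> {0..<T} \<Longrightarrow> p \<in> S2 \<Longrightarrow>
        ((\<lambda>\<tau>. X \<tau> p) has_vector_derivative
          ((normA2 (X t) p / (gaussK (X t) p)\<^sup>2) *\<^sub>R outer_normal (X t) p)) (at t)"
    and st: "0 \<le> s" "s \<le> t" "t < T"
  shows "Sup (pinching_quot (X t) ` S2) \<le> Sup (pinching_quot (X s) ` S2)"
proof -
  interpret convex_flow X T U by unfold_locales (fact smooth dom convex flow)+
  define f where "f z = (case z of (t, p) \<Rightarrow> pinching_quot (X t) p)" for z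
  have f: "continuous_on ({0..<T} \<times> S2) f"
    unfolding f_def[abs_def] by (rule continuous_on_pinching)
  have ne: "S2 \<noteq> {}" by simp
  define M where "M = Sup (pinching_quot (X s) ` S2)"
  have M: "pinching_quot (X s) p \<le> M" if "p \<in> S2" for p
  proof -
    have "continuous_on S2 (\<lambda>p. f (s, p))"
      by (rule continuous_on_compose2[OF f]) (use st in \<open>auto intro!: continuous_intros\<close>)
    then have "compact ((\<lambda>p. f (s, p)) ` S2)"
      by (rule compact_continuous_image) (rule compact_sphere)
    then have "bdd_above (pinching_quot (X s) ` S2)"
      by (simp add: f_def bounded_imp_bdd_above compact_imp_bounded)
    then show ?thesis unfolding M_def using that by (intro cSup_upper) auto
  qed
  have "pinching_quot (X t) p \<le> M" if p: "p \<in> S2" for p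
  proof (rule ccontr)
    assume gt: "\<not> pinching_quot (X t) p \<le> M"
    have sub: "{s..t} \<times> S2 \<subseteq> {0..<T} \<times> S2" using st by auto
    have "compact ({s..t} \<times> S2)" by (intro compact_Times compact_sphere) simp
    moreover have "{s..t} \<times> S2 \<noteq> {}" using st p by auto
    \<comment> \<open>A maximum over the whole slab is a spatial maximum at its own time and also
      bounds earlier values at the same point.\<close>
    ultimately obtain z where z: "z \<in> {s..t} \<times> S2" "\<And>y. y \<in> {s..t} \<times> S2 \<Longrightarrow> f y \<le> f z"
      using continuous_attains_sup[OF _ _ continuous_on_subset[OF f sub]] by blast
    obtain t' p' where z': "z = (t', p')" by (cases z)
    have t': "s \<le> t'" "t' \<le> t" and p': "p' \<in> S2" using z(1) z' by auto
    have max: "pinching_quot (X r) q \<le> pinching_quot (X t') p'" if "r \<in> {s..t}" "q \<in> S2" for r q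
      using z(2)[of "(r, q)"] that by (simp add: f_def z')
    have big: "pinching_quot (X t') p' > M" using max[of t p] gt p st by simp
    have "M \<ge> 0" using M[OF p] pinching_nonneg[of s p] p st by simp
    \<comment> \<open>The maximum exceeds \<open>M\<close>, which bounds the slice at time s, so
      earlier times in the slab are available.\<close>
    have "t' \<noteq> s" using big M[OF p'] by auto
    then have "t' > s" using t' by simp
    have "\<exists>d<0. ((\<lambda>\<tau>. pinching_quot (X \<tau>) p') has_real_derivative d) (at t')"
      by (rule pinching_decreasing_at_max) (use \<open>t' > s\<close> t' st p' big \<open>M \<ge> 0\<close> max in auto)
    then obtain d e where "e > 0" "\<And>h. 0 < h \<Longrightarrow> h < e \<Longrightarrow> pinching_quot (X t') p' < pinching_quot (X (t' - h)) p'"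
      using DERIV_neg_dec_left by metis
    \<comment> \<open>The half keeps h strictly below e, and the bound t' - s keeps the earlier time
      in the slab.\<close>
    moreover define h where "h = min (e / 2) (t' - s)"
    ultimately have "pinching_quot (X t') p' < pinching_quot (X (t' - h)) p'"
      using \<open>t' > s\<close> by (simp add: min_def)
    moreover have "t' - h \<in> {s..t}" using t' \<open>t' > s\<close> \<open>e > 0\<close> by (auto simp: h_def min_def)
    ultimately show False using max[of "t' - h" p'] p' by simp
  qed
  then show ?thesis unfolding M_def using ne by (intro cSup_least) auto
qed

end
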